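(* Let $\delta>0$ and let $W:\mathbb{Z}\to\mathbb{R}$ be symmetric ($W_{-\kappa}=W_\kappa$) with $\Delta^{\!\delta} W$ everywhere positive and bounded, and $$\Lambda:=2\sup_{\kappa}\big|(\Delta^{\!\delta}\Delta^{\!\delta} W)_\kappa\big|+\sup_{\kappa}\frac{\big(\Delta^{\!\delta}[(\Delta^{\!\delta} W)^2]\big)_\kappa}{(\Delta^{\!\delta} W)_\kappa}<\infty.$$ Then the semigroup $\mathfrak{S}$ on $\mathcal{P}^\delta_{2,c}$ generated by $\dot\rho_\kappa=\big(\Delta^{\!\delta}(\rho\,\Delta^{\!\delta}(W\ast_\delta\rho))\big)_\kappa$, $\kappa\in\mathbb{Z}$, is $(-\Lambda)$-contractive with respect to the energy $\mathcal{E}(\rho)=-\frac\delta2\sum_\kappa\rho_\kappa(W\ast_\delta\rho)_\kappa$.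
   Context: Fix $\delta>0$. For $f:\mathbb{Z}\to\mathbb{R}$, $(\Delta^{\!\delta} f)_\kappa=(f_{\kappa+1}+f_{\kappa-1}-2f_\kappa)/\delta^2$; the discrete convolution is $(f\ast_\delta g)_\kappa=\delta\sum_\lambda f_\lambda g_{\kappa-\lambda}$; products and squares are pointwise. $\mathcal{P}^\delta_{2,c}$ is the set of $\rho:\mathbb{Z}\to[0,\infty)$ with $\delta\sum_\kappa\rho_\kappa=1$, $\delta\sum_\kappa(\delta\kappa)^2\rho_\kappa<\infty$, $\delta\sum_\kappa(\delta\kappa)\rho_\kappa=0$. Define $Q(p,r)=p^2/r$ if $r>0$, $Q(0,0)=0$, $Q(p,0)=+\infty$ if $p\ne0$. $\mathcal{C}(\rho^0,\rho^1)$ is the set of pairs $(\rho,\mathfrak{w})$, $\rho:[0,1]\to\mathcal{P}^\delta_{2,c}$, $\mathfrak{w}:[0,1]\to\ell^2$, with $\rho(0)=\rho^0$, $\rho(1)=\rho^1$, $\rho_\kappa\in H^1(0,1)$, $\mathfrak{w}_\kappa\in L^2(0,1)$ and $\dot\rho_\kappa=(\Delta^{\!\delta}\mathfrak{w})_\kappa$ a.e., for each $\kappa$. ${\mathbb{D}}^\delta(\rho^0,\rho^1)^2=\inf_{\mathcal{C}(\rho^0,\rho^1)}\delta\sum_\kappa\int_0^1Q(\mathfrak{w}_\kappa(s),\rho_\kappa(s))\,ds$. A semigroup $\mathfrak{S}$ on $\mathcal{P}^\delta_{2,c}$ is $\lambda$-contractive with respect to $\mathcal{E}$ if for all $\bar\rho,\bar\eta\in\mathcal{P}^\delta_{2,c}$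 with ${\mathbb{D}}^\delta(\bar\rho,\bar\eta)<\infty$: $$\limsup_{t\downarrow0}\frac{{\mathbb{D}}^\delta(\mathfrak{S}^t\bar\rho,\bar\eta)^2-{\mathbb{D}}^\delta(\bar\rho,\bar\eta)^2}{2t}+\frac\lambda2{\mathbb{D}}^\delta(\bar\rho,\bar\eta)^2\le\mathcal{E}(\bar\eta)-\mathcal{E}(\bar\rho).$$ *)

theory Defs
  imports "HOL-Analysis.Analysis"
begin

definition dlap :: "real \<Rightarrow> (int \<Rightarrow> real) \<Rightarrow> int \<Rightarrow> real" where
  "dlap \<delta> f k = (f (k + 1) + f (k - 1) - 2 * f k) / \<delta>\<^sup>2"

definition dconv :: "real \<Rightarrow> (int \<Rightarrow> real) \<Rightarrow> (int \<Rightarrow> real) \<Rightarrow> int \<Rightarrow> real" where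
  "dconv \<delta> f g k = \<delta> * (\<Sum>\<^sub>\<infinity>l. f l * g (k - l))"

definition Pdelta :: "real \<Rightarrow> (int \<Rightarrow> real) set" where
  "Pdelta \<delta> = {\<rho>. (\<forall>k. \<rho> k \<ge> 0) \<and> \<rho> summable_on UNIV \<and> \<delta> * (\<Sum>\<^sub>\<infinity>k. \<rho> k) = 1
      \<and> (\<lambda>k. (\<delta> * of_int k)\<^sup>2 * \<rho> k) summable_on UNIV
      \<and> \<delta> * (\<Sum>\<^sub>\<infinity>k. (\<delta> * of_int k) * \<rho> k) = 0}"

definition Qfun :: "real \<Rightarrow> real \<Rightarrow> ennreal" where
  "Qfun p r = (if r > 0 then ennreal (p\<^sup>2 / r) else if p = 0 then 0 else \<infinity>)"

text \<open>Admissible curves C(rho0, rho1).  The requirement that rho_k lies in H^1(0,1) with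
  derivative equal to (Delta w)_k a.e. is expressed through the (absolutely continuous)
  representative: rho_k(t) = rho_k(0) + integral over [0,t] of (Delta w(s))_k.\<close>
definition admissible :: "real \<Rightarrow> (int \<Rightarrow> real) \<Rightarrow> (int \<Rightarrow> real)
    \<Rightarrow> ((real \<Rightarrow> int \<Rightarrow> real) \<times> (real \<Rightarrow> int \<Rightarrow> real)) set" where
  "admissible \<delta> \<rho>0 \<rho>1 = {(\<rho>, w).
      (\<forall>s\<in>{0..1}. \<rho> s \<in> Pdelta \<delta>) \<and> \<rho> 0 = \<rho>0 \<and> \<rho> 1 = \<rho>1
    \<and> (\<forall>s\<in>{0..1}. (\<lambda>k. (w s k)\<^sup>2) summable_on UNIV)
    \<and> (\<forall>k. (\<lambda>s. indicator {0..1} s * w s k) \<in> borel_measurable lborel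
           \<and> integrable lborel (\<lambda>s. indicator {0..1} s * (w s k)\<^sup>2))
    \<and> (\<forall>k. \<forall>t\<in>{0..1}. \<rho> t k = \<rho> 0 k + (LINT s:{0..t}|lborel. dlap \<delta> (w s) k))}"

definition Dsq :: "real \<Rightarrow> (int \<Rightarrow> real) \<Rightarrow> (int \<Rightarrow> real) \<Rightarrow> ennreal" where
  "Dsq \<delta> \<rho>0 \<rho>1 = (INF p \<in> admissible \<delta> \<rho>0 \<rho>1.
      ennreal \<delta> * (\<Sum>\<^sub>\<infinity>k. \<integral>\<^sup>+ s. indicator {0..1} s * Qfun (snd p s k) (fst p s k) \<partial>lborel))"

definition energy :: "real \<Rightarrow> (int \<Rightarrow> real) \<Rightarrow> (int \<Rightarrow> real) \<Rightarrow> real" where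
  "energy \<delta> W \<rho> = - (\<delta> / 2) * (\<Sum>\<^sub>\<infinity>k. \<rho> k * dconv \<delta> W \<rho> k)"

definition generated_semigroup :: "real \<Rightarrow> (int \<Rightarrow> real)
    \<Rightarrow> (real \<Rightarrow> (int \<Rightarrow> real) \<Rightarrow> (int \<Rightarrow> real)) \<Rightarrow> bool" where
  "generated_semigroup \<delta> W S \<longleftrightarrow>
    (\<forall>\<rho>\<in>Pdelta \<delta>.
       S 0 \<rho> = \<rho>
     \<and> (\<forall>t\<ge>0. S t \<rho> \<in> Pdelta \<delta>)
     \<and> (\<forall>t\<ge>0. \<forall>s\<ge>0. S (t + s) \<rho> = S t (S s \<rho>))
     \<and> (\<forall>t\<ge>0. \<forall>k. ((\<lambda>\<tau>. S \<tau> \<rho> k) has_real_derivative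
            dlap \<delta> (\<lambda>j. S t \<rho> j * dlap \<delta> (dconv \<delta> W (S t \<rho>)) j) k) (at t within {0..})))"

definition contractive :: "real \<Rightarrow> real \<Rightarrow> ((int \<Rightarrow> real) \<Rightarrow> real)
    \<Rightarrow> (real \<Rightarrow> (int \<Rightarrow> real) \<Rightarrow> (int \<Rightarrow> real)) \<Rightarrow> bool" where
  "contractive \<delta> lam E S \<longleftrightarrow>
    (\<forall>\<rho>\<in>Pdelta \<delta>. \<forall>\<eta>\<in>Pdelta \<delta>. Dsq \<delta> \<rho> \<eta> < \<infinity> \<longrightarrow>
       Limsup (at_right 0) (\<lambda>t. (enn2ereal (Dsq \<delta> (S t \<rho>) \<eta>) - enn2ereal (Dsq \<delta> \<rho> \<eta>)) / ereal (2 * t))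
         + ereal (lam / 2 * enn2real (Dsq \<delta> \<rho> \<eta>))
       \<le> ereal (E \<eta> - E \<rho>))"

end

theory Submission
  imports Defs
begin

text \<open>
  Take an almost minimal curve \<open>(\<rho>, w)\<close> from \<open>\<rho>\<close> to \<open>\<eta>\<close> and push it along the flow for the time
  \<open>t (1 - s)\<close> by one explicit Euler step.  Since \<open>p\<^sup>2 / r\<close> is jointly convex and homogeneous, the action
  density of the pushed curve is bounded exactly, without any smoothness of the flow in its initial datum.
  The term of first order in \<open>t\<close> is \<open>- 2 t \<delta> \<Sum> w (V * \<rho>)\<close> with \<open>V = \<Delta>W\<close>, and \<open>\<delta> \<Sum> w (V * \<rho>)\<close> is minus the
  derivative of the energy along the curve; the remaining terms of order \<open>t\<close> are bounded by
  \<open>\<Lambda>\<close> times the action, because \<open>\<Delta>(b\<^sup>2) / b\<close> for \<open>b = V * \<rho>\<close> inherits the bound for \<open>\<Delta>(V\<^sup>2) / V\<close> from the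
  Cauchy--Schwarz inequality.  The end point of the pushed curve differs from the true flow, but the gap can be
  crossed with action \<open>O(t\<^sup>3)\<close>; spending the fraction \<open>t \<surd>t\<close> of the unit time interval on it costs only
  \<open>O(t \<surd>t)\<close>, which disappears in the difference quotient.
\<close>

section \<open>Sums over the integers\<close>

text \<open>The two summands of \<Lambda> have separate origins. Write b for
  \<open>mob \<rho>\<close> and \<open>U\<close> for \<Delta>V. Pushing the density by
  \<open>t * (1 - s) * \<Delta>(\<rho> b)\<close> changes the momentum by t times
  \<open>(1 - s) * (\<Delta>w b + \<rho> (U * w)) - \<rho> b\<close>. The nonlocal term with
  \<open>U * w\<close> costs twice the supremum of |U|; the term with \<Delta>w b, charged to the
  mass that arrives from the neighbours, costs the supremum of \<Delta>(V^2) / V; the last term,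
  from differentiating \<open>1 - s\<close>, gives the energy. Moments are scarce: \<open>W\<close>
  grows quadratically, densities have just a second moment, and the integrated momentum of a curve
  is only known to be summable. The energy identity therefore rests on a summation by parts without
  control at infinity. The flux remainder is formally of order t^2, which suggests a gap of action
  t^4. But the action divides by the density at the same site, which may be far smaller than at its
  neighbours; one factor of the remainder is spent against this density, leaving t^3. Balancing
  \<open>t^3 / h\<close> against \<open>h\<close> yields \<open>h = t * sqrt t\<close>.\<close>

lemma summable_on_abs_real:
  fixes f :: "'a \<Rightarrow> real"
  shows "f summable_on A \<Longrightarrow> (\<lambda>x. \<bar>f x\<bar>) summable_on A"
  using summable_on_iff_abs_summable_on_real[of f A] by simp

lemma summable_on_bounded_by:
  fixes f g :: "'a \<Rightarrow> real"
  assumes "g summable_on A" "\<And>x. x \<in> A \<Longrightarrow> \<bar>f x\<bar> \<le> g x"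
  shows "f summable_on A"
proof -
  have "(\<lambda>x. \<bar>f x\<bar>) summable_on A"
    using assms by (intro summable_on_comparison_test[OF assms(1)]) auto
  then show ?thesis using summable_on_iff_abs_summable_on_real[of f A] by simp
qed

lemma summable_on_mult_bounded:
  fixes f g :: "'a \<Rightarrow> real"
  assumes "g summable_on A" "\<And>x. x \<in> A \<Longrightarrow> \<bar>f x\<bar> \<le> M"
  shows "(\<lambda>x. f x * g x) summable_on A"
proof (rule summable_on_bounded_by)
  show "(\<lambda>x. M * \<bar>g x\<bar>) summable_on A"
    by (intro summable_on_cmult_right summable_on_abs_real assms)
qed (use assms in \<open>auto simp: abs_mult intro!: mult_right_mono\<close>)

lemma summable_on_diff_real:
  fixes f g :: "'a \<Rightarrow> real"
  shows "f summable_on A \<Longrightarrow> g summable_on A \<Longrightarrow> (\<lambda>x. f x - g x) summable_on A"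
  using summable_on_add[of f A "\<lambda>x. - g x"] by (simp add: summable_on_uminus)

lemma infsum_diff_real:
  fixes f g :: "'a \<Rightarrow> real"
  assumes "f summable_on A" "g summable_on A"
  shows "(\<Sum>\<^sub>\<infinity>x\<in>A. f x - g x) = infsum f A - infsum g A"
  using infsum_add[of f A "\<lambda>x. - g x"] assms by (simp add: summable_on_uminus infsum_uminus)

lemma abs_infsum_le_real:
  fixes f g :: "'a \<Rightarrow> real"
  assumes "g summable_on A" "\<And>x. x \<in> A \<Longrightarrow> \<bar>f x\<bar> \<le> g x"
  shows "\<bar>infsum f A\<bar> \<le> infsum g A"
proof -
  have f: "f summable_on A" by (rule summable_on_bounded_by[OF assms])
  have "infsum f A \<le> infsum g A"
    using assms by (intro infsum_mono f) (auto simp: abs_le_iff)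
  moreover have "infsum (\<lambda>x. - f x) A \<le> infsum g A"
    using assms by (intro infsum_mono) (auto simp: abs_le_iff f summable_on_uminus)
  ultimately show ?thesis by (simp add: infsum_uminus abs_le_iff)
qed

lemma le_infsum_nonneg:
  fixes f :: "'a \<Rightarrow> real"
  assumes "f summable_on A" "\<And>x. x \<in> A \<Longrightarrow> f x \<ge> 0" "a \<in> A"
  shows "f a \<le> infsum f A"
  using finite_sum_le_infsum[of f A "{a}"] assms by auto

lemma summable_on_shift_int:
  fixes f :: "int \<Rightarrow> real"
  shows "(\<lambda>k. f (k + a)) summable_on UNIV \<longleftrightarrow> f summable_on UNIV"
    and "(\<lambda>k. f (k - a)) summable_on UNIV \<longleftrightarrow> f summable_on UNIV"
    and "(\<lambda>k. f (a - k)) summable_on UNIV \<longleftrightarrow> f summable_on UNIV"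
  by (rule summable_on_reindex_bij_witness[of _ "\<lambda>k. k - a" "\<lambda>k. k + a"], simp_all)
     (rule summable_on_reindex_bij_witness[of _ "\<lambda>k. k + a" "\<lambda>k. k - a"]
        summable_on_reindex_bij_witness[of _ "\<lambda>k. a - k" "\<lambda>k. a - k"], simp_all)+

lemma infsum_shift_int:
  fixes f :: "int \<Rightarrow> real"
  shows "(\<Sum>\<^sub>\<infinity>k. f (k + a)) = infsum f UNIV"
    and "(\<Sum>\<^sub>\<infinity>k. f (k - a)) = infsum f UNIV"
    and "(\<Sum>\<^sub>\<infinity>k. f (a - k)) = infsum f UNIV"
  by (rule infsum_reindex_bij_witness[of _ "\<lambda>k. k - a" "\<lambda>k. k + a"], simp_all)
     (rule infsum_reindex_bij_witness[of _ "\<lambda>k. k + a" "\<lambda>k. k - a"]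
        infsum_reindex_bij_witness[of _ "\<lambda>k. a - k" "\<lambda>k. a - k"], simp_all)+

lemma infsum_swap_bounded:
  fixes h :: "'a \<Rightarrow> 'b \<Rightarrow> real"
  assumes "\<And>x. h x summable_on UNIV" "B summable_on UNIV" "\<And>x. (\<Sum>\<^sub>\<infinity>y. \<bar>h x y\<bar>) \<le> B x"
  shows "(\<Sum>\<^sub>\<infinity>x. \<Sum>\<^sub>\<infinity>y. h x y) = (\<Sum>\<^sub>\<infinity>y. \<Sum>\<^sub>\<infinity>x. h x y)"
proof (rule infsum_swap_banach)
  have "Infinite_Sum.abs_summable_on (\<lambda>(x,y). h x y) (UNIV \<times> UNIV)"
    unfolding Infinite_Sum.abs_summable_on_Sigma_iff
    using assms by (auto simp: infsum_nonneg summable_on_abs_real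
        intro!: summable_on_bounded_by[OF assms(2)])
  then show "(\<lambda>(x,y). h x y) summable_on (UNIV \<times> UNIV)"
    by (rule abs_summable_summable)
qed

text \<open>Over the reals unconditional summability is absolute, hence integrability for the
  counting measure. This gives access to dominated convergence and Fubini.\<close>

lemma infsum_eq_integral_count_space:
  fixes f :: "'a \<Rightarrow> real"
  assumes "f summable_on A"
  shows "integrable (count_space A) f" "infsum f A = integral\<^sup>L (count_space A) f"
proof -
  have *: "Infinite_Set_Sum.abs_summable_on f A"
    using assms abs_summable_equivalent summable_on_iff_abs_summable_on_real by blast
  then show "integrable (count_space A) f" by (simp add: Infinite_Set_Sum.abs_summable_on_def)
  show "infsum f A = integral\<^sup>L (count_space A) f"
    using infsetsum_infsum[OF *] by (simp add: infsetsum_def)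
qed

lemma infsum_dominated_convergence:
  fixes f :: "nat \<Rightarrow> 'a \<Rightarrow> real"
  assumes "g summable_on A" "\<And>n x. x \<in> A \<Longrightarrow> \<bar>f n x\<bar> \<le> g x"
    and "\<And>x. x \<in> A \<Longrightarrow> (\<lambda>n. f n x) \<longlonglongrightarrow> F x"
  shows "F summable_on A" "(\<lambda>n. infsum (f n) A) \<longlonglongrightarrow> infsum F A"
proof -
  have F: "\<bar>F x\<bar> \<le> g x" if "x \<in> A" for x
    using assms(2,3)[OF that] by (intro LIMSEQ_le_const2[OF tendsto_rabs]) auto
  show sF: "F summable_on A" by (rule summable_on_bounded_by[OF assms(1) F])
  have sf: "f n summable_on A" for n by (rule summable_on_bounded_by[OF assms(1,2)])
  have "(\<lambda>n. integral\<^sup>L (count_space A) (f n)) \<longlonglongrightarrow> integral\<^sup>L (count_space A) F"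
    by (rule integral_dominated_convergence[where w=g])
       (use assms infsum_eq_integral_count_space(1)[OF assms(1)] in \<open>auto simp: AE_count_space\<close>)
  then show "(\<lambda>n. infsum (f n) A) \<longlonglongrightarrow> infsum F A"
    using infsum_eq_integral_count_space(2)[OF sf] infsum_eq_integral_count_space(2)[OF sF] by simp
qed

text \<open>The weighted inequality \<open>2|x| \<le> c a + r / c\<close> is summed first and
  \<open>c\<close> is chosen afterwards. The product form \<open>x^2 \<le> a r\<close> suits momenta
  measured against densities that may vanish.\<close>

lemma infsum_Cauchy_Schwarz:
  fixes x a r :: "'a \<Rightarrow> real"
  assumes a: "a summable_on A" and r: "r summable_on A"
    and nn: "\<And>k. k \<in> A \<Longrightarrow> a k \<ge> 0" "\<And>k. k \<in> A \<Longrightarrow> r k \<ge> 0"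
    and le: "\<And>k. k \<in> A \<Longrightarrow> (x k)\<^sup>2 \<le> a k * r k"
  shows "x summable_on A" "(\<Sum>\<^sub>\<infinity>k\<in>A. \<bar>x k\<bar>)\<^sup>2 \<le> infsum a A * infsum r A"
proof -
  have sq: "\<bar>x k\<bar> \<le> (c * a k + r k / c) / 2" if "k \<in> A" "c > 0" for k c
  proof (rule power2_le_imp_le)
    have "(c * a k + r k / c)\<^sup>2 - 4 * (a k * r k) = (c * a k - r k / c)\<^sup>2"
      using that(2) by (simp add: field_simps power2_eq_square)
    then have "4 * (a k * r k) \<le> (c * a k + r k / c)\<^sup>2"
      using zero_le_power2[of "c * a k - r k / c"] by linarith
    then show "\<bar>x k\<bar>\<^sup>2 \<le> ((c * a k + r k / c) / 2)\<^sup>2"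
      using le[OF that(1)] by (simp add: power_divide)
    show "0 \<le> (c * a k + r k / c) / 2" using nn that by auto
  qed
  have eq: "(\<lambda>k. (c * a k + r k / c) / 2) = (\<lambda>k. (c / 2) * a k + (1 / (2 * c)) * r k)" for c
    by (simp add: field_simps)
  have sm: "(\<lambda>k. (c * a k + r k / c) / 2) summable_on A" for c
    unfolding eq by (intro summable_on_add summable_on_cmult_right a r)
  show xs: "x summable_on A"
    by (rule summable_on_bounded_by[OF sm[of 1]]) (use sq[of _ 1] in auto)
  define X where "X = (\<Sum>\<^sub>\<infinity>k\<in>A. \<bar>x k\<bar>)"
  define P where "P = infsum a A"
  define R where "R = infsum r A"
  have X0: "X \<ge> 0" "P \<ge> 0" "R \<ge> 0"
    using nn by (auto simp: X_def P_def R_def intro!: infsum_nonneg)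
  have X: "2 * X \<le> c * P + R / c" if "c > 0" for c
  proof -
    have "X \<le> (\<Sum>\<^sub>\<infinity>k\<in>A. (c * a k + r k / c) / 2)"
      unfolding X_def by (rule infsum_mono[OF summable_on_abs_real[OF xs] sm sq]) (use that in auto)
    also have "\<dots> = (c / 2) * P + (1 / (2 * c)) * R"
      unfolding eq P_def R_def
      by (subst infsum_add) (auto simp only: infsum_cmult_right' intro!: summable_on_cmult_right a r)
    finally show ?thesis by (simp add: field_simps)
  qed
  have "X\<^sup>2 \<le> P * R"
  proof (cases "P = 0")
    case True
    have "X \<le> 0"
    proof (rule field_le_epsilon)
      fix e :: real assume "e > 0"
      have "R / ((R + 1) / e) \<le> e" using X0 \<open>e > 0\<close> by (simp add: field_simps)
      moreover have "2 * X \<le> R / ((R + 1) / e)"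
        using X[of "(R + 1) / e"] True X0 \<open>e > 0\<close> by simp
      ultimately show "X \<le> 0 + e" using \<open>e > 0\<close> by linarith
    qed
    then show ?thesis using X0 True by simp
  next
    case False
    then have P: "P > 0" using X0 by simp
    show ?thesis
    proof (cases "X = 0")
      case False
      then have "X > 0" using X0 by simp
      have "2 * X \<le> (X / P) * P + R / (X / P)" using X[of "X / P"] P \<open>X > 0\<close> by simp
      then have "X \<le> R * P / X" using P \<open>X > 0\<close> by simp
      then show ?thesis using \<open>X > 0\<close> by (simp add: field_simps power2_eq_square)
    qed (use X0 in auto)
  qed
  then show "(\<Sum>\<^sub>\<infinity>k\<in>A. \<bar>x k\<bar>)\<^sup>2 \<le> infsum a A * infsum r A" by (simp add: X_def P_def R_def)
qed

section \<open>Discrete Laplacian and convolution\<close>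

lemma dlap_summable:
  assumes "f summable_on UNIV"
  shows "dlap \<delta> f summable_on UNIV"
proof -
  have "(\<lambda>k. (f (k + 1) + f (k - 1) - 2 * f k) * (1 / \<delta>\<^sup>2)) summable_on UNIV"
    by (intro summable_on_cmult_left summable_on_diff_real summable_on_add summable_on_cmult_right)
       (simp_all add: assms summable_on_shift_int(1,2)[of f])
  then show ?thesis by (simp add: dlap_def[abs_def])
qed

text \<open>Summation by parts is a shift of the summation index: with \<open>f\<close> bounded and
  \<open>g\<close> summable each shifted product is summable on its own, so no boundary terms
  arise.\<close>

lemma infsum_mult_dlap_bounded:
  assumes g: "g summable_on UNIV" and f: "\<And>k. \<bar>f k\<bar> \<le> M"
  shows "(\<Sum>\<^sub>\<infinity>k. f k * dlap \<delta> g k) = (\<Sum>\<^sub>\<infinity>k. dlap \<delta> f k * g k)"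
proof -
  have s: "(\<lambda>k. f (k + i) * g (k + j)) summable_on UNIV" for i j
    by (rule summable_on_mult_bounded[where M=M]) (simp_all add: f g summable_on_shift_int(1)[of g])
  have s': "(\<lambda>k. f k * g (k + j)) summable_on UNIV" "(\<lambda>k. f k * g (k - j)) summable_on UNIV"
       "(\<lambda>k. f (k + j) * g k) summable_on UNIV" "(\<lambda>k. f (k - j) * g k) summable_on UNIV"
       "(\<lambda>k. f k * g k) summable_on UNIV" for j
    using s[of 0 j] s[of 0 "-j"] s[of j 0] s[of "-j" 0] s[of 0 0] by simp_all
  have "(\<Sum>\<^sub>\<infinity>k. f k * dlap \<delta> g k)
      = (\<Sum>\<^sub>\<infinity>k. (f k * g (k + 1) + f k * g (k - 1) - 2 * (f k * g k)) * (1 / \<delta>\<^sup>2))"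
    by (intro infsum_cong) (simp add: dlap_def field_simps)
  also have "\<dots> = ((\<Sum>\<^sub>\<infinity>k. f k * g (k + 1)) + (\<Sum>\<^sub>\<infinity>k. f k * g (k - 1)) - 2 * (\<Sum>\<^sub>\<infinity>k. f k * g k)) * (1 / \<delta>\<^sup>2)"
    by (simp add: infsum_cmult_left' infsum_cmult_right' infsum_diff_real infsum_add summable_on_add
        summable_on_cmult_right s' del: times_divide_eq_right)
  also have "(\<Sum>\<^sub>\<infinity>k. f k * g (k + 1)) = (\<Sum>\<^sub>\<infinity>k. f (k - 1) * g k)"
    using infsum_shift_int(1)[of "\<lambda>k. f (k - 1) * g k" 1] by simp
  also have "(\<Sum>\<^sub>\<infinity>k. f k * g (k - 1)) = (\<Sum>\<^sub>\<infinity>k. f (k + 1) * g k)"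
    using infsum_shift_int(2)[of "\<lambda>k. f (k + 1) * g k" 1] by simp
  also have "((\<Sum>\<^sub>\<infinity>k. f (k - 1) * g k) + (\<Sum>\<^sub>\<infinity>k. f (k + 1) * g k) - 2 * (\<Sum>\<^sub>\<infinity>k. f k * g k)) * (1 / \<delta>\<^sup>2)
     = (\<Sum>\<^sub>\<infinity>k. (f (k - 1) * g k + f (k + 1) * g k - 2 * (f k * g k)) * (1 / \<delta>\<^sup>2))"
    by (simp add: infsum_cmult_left' infsum_cmult_right' infsum_diff_real infsum_add summable_on_add
        summable_on_cmult_right s' del: times_divide_eq_right)
  also have "\<dots> = (\<Sum>\<^sub>\<infinity>k. dlap \<delta> f k * g k)"
    by (intro infsum_cong) (simp add: dlap_def field_simps)
  finally show ?thesis .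
qed

lemma dconv_eq: "dconv \<delta> f g k = \<delta> * (\<Sum>\<^sub>\<infinity>l. f (k - l) * g l)"
  unfolding dconv_def using infsum_shift_int(3)[of "\<lambda>l. f (k - l) * g l" k] by simp

lemma dlap_dconv:
  assumes s: "\<And>k. (\<lambda>l. f (k - l) * g l) summable_on UNIV"
  shows "dlap \<delta> (dconv \<delta> f g) k = dconv \<delta> (dlap \<delta> f) g k"
proof -
  have "(\<Sum>\<^sub>\<infinity>l. dlap \<delta> f (k - l) * g l)
    = (\<Sum>\<^sub>\<infinity>l. (f (k + 1 - l) * g l + f (k - 1 - l) * g l - 2 * (f (k - l) * g l)) * (1 / \<delta>\<^sup>2))"
    by (intro infsum_cong) (simp add: dlap_def algebra_simps add_divide_distrib diff_divide_distrib)
  also have "\<dots> = ((\<Sum>\<^sub>\<infinity>l. f (k + 1 - l) * g l) + (\<Sum>\<^sub>\<infinity>l. f (k - 1 - l) * g l) - 2 * (\<Sum>\<^sub>\<infinity>l. f (k - l) * g l)) * (1 / \<delta>\<^sup>2)"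
    by (simp add: infsum_cmult_left' infsum_cmult_right' infsum_diff_real infsum_add summable_on_add
        summable_on_cmult_right s del: times_divide_eq_right)
  finally show ?thesis by (simp add: dconv_eq dlap_def field_simps)
qed

lemma dlap_even: "(\<And>k. f (- k) = f k) \<Longrightarrow> dlap \<delta> f (- k) = dlap \<delta> f k"
proof -
  assume f: "\<And>k. f (- k) = f k"
  have "f (- k + 1) = f (k - 1)" "f (- k - 1) = f (k + 1)"
    using f[of "k - 1"] f[of "k + 1"] minus_diff_eq[of k 1] minus_add_distrib[of k 1] by auto
  then show ?thesis by (simp add: dlap_def f)
qed

lemma dconv_summand:
  fixes f g :: "int \<Rightarrow> real"
  assumes "g summable_on UNIV" "\<And>k. \<bar>f k\<bar> \<le> M"
  shows "(\<lambda>l. f (k - l) * g l) summable_on UNIV"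
  by (rule summable_on_mult_bounded[where M=M]) (use assms in auto)

text \<open>Lets a Laplacian pass to the kernel, so that \<open>V\<close> convolved with a density
  increment becomes \<open>U\<close> convolved with the integrated momentum.\<close>

lemma dconv_dlap_right:
  assumes "g summable_on UNIV" "\<And>k. \<bar>f k\<bar> \<le> M"
  shows "dconv \<delta> f (dlap \<delta> g) k = dconv \<delta> (dlap \<delta> f) g k"
proof -
  have "dlap \<delta> (\<lambda>l. f (k - l)) l = dlap \<delta> f (k - l)" for l
    by (simp add: dlap_def algebra_simps)
  then show ?thesis
    using infsum_mult_dlap_bounded[OF assms(1), of "\<lambda>l. f (k - l)" M \<delta>] assms(2) by (simp add: dconv_eq)
qed

lemma abs_dconv_le:
  assumes "g summable_on UNIV" "\<And>k. \<bar>f k\<bar> \<le> M" "\<delta> \<ge> 0"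
  shows "\<bar>dconv \<delta> f g k\<bar> \<le> M * (\<delta> * (\<Sum>\<^sub>\<infinity>l. \<bar>g l\<bar>))"
proof -
  have "\<bar>\<Sum>\<^sub>\<infinity>l. f (k - l) * g l\<bar> \<le> (\<Sum>\<^sub>\<infinity>l. M * \<bar>g l\<bar>)"
    using assms by (intro abs_infsum_le_real summable_on_cmult_right summable_on_abs_real)
       (auto simp: abs_mult intro!: mult_right_mono)
  then show ?thesis using assms(3)
    by (simp add: dconv_eq abs_mult infsum_cmult_right' mult_left_mono mult.left_commute[of M])
qed

lemma dconv_diff:
  assumes "\<And>k. \<bar>f k\<bar> \<le> M" "g summable_on UNIV" "h summable_on UNIV"
  shows "dconv \<delta> f (\<lambda>l. g l - h l) k = dconv \<delta> f g k - dconv \<delta> f h k"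
  using dconv_summand[where f=f, OF assms(2,1)] dconv_summand[where f=f, OF assms(3,1)]
  by (simp add: dconv_eq right_diff_distrib infsum_diff_real)

text \<open>Fubini and evenness of the kernel. The majorant is requested after the inner summation,
  so the lemma serves the bounded kernel \<open>U\<close> as well as the quadratically growing
  \<open>W\<close>.\<close>

lemma infsum_mult_dconv_sym:
  assumes even: "\<And>k. f (- k) = f k"
    and s: "\<And>k. (\<lambda>l. f (k - l) * g l) summable_on UNIV"
    and B: "B summable_on UNIV" "\<And>k. \<bar>h k\<bar> * (\<Sum>\<^sub>\<infinity>l. \<bar>f (k - l) * g l\<bar>) \<le> B k"
  shows "(\<Sum>\<^sub>\<infinity>k. h k * dconv \<delta> f g k) = (\<Sum>\<^sub>\<infinity>k. g k * dconv \<delta> f h k)"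
proof -
  have ev: "f (k - l) = f (l - k)" for k l using even[of "k - l"] by simp
  have "(\<Sum>\<^sub>\<infinity>k. \<Sum>\<^sub>\<infinity>l. h k * (f (k - l) * g l)) = (\<Sum>\<^sub>\<infinity>l. \<Sum>\<^sub>\<infinity>k. h k * (f (k - l) * g l))"
    by (rule infsum_swap_bounded[OF _ B(1)])
       (use s B(2) in \<open>auto simp: abs_mult infsum_cmult_right' intro!: summable_on_cmult_right\<close>)
  also have "\<dots> = (\<Sum>\<^sub>\<infinity>l. \<Sum>\<^sub>\<infinity>k. g l * (f (l - k) * h k))"
    by (intro infsum_cong) (subst ev, simp)
  finally show ?thesis
    by (simp add: dconv_eq infsum_cmult_right' mult.left_commute[of _ \<delta>])
qed

section \<open>Summation by parts against functions of quadratic growth\<close>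

text \<open>Two discrete integrations outward from 0: increments grow at most linearly, values at
  most quadratically. The bound on increments later compares a squared increment with the function
  itself.\<close>

lemma second_difference_growth:
  assumes "\<delta> \<noteq> 0" and K: "\<And>k. \<bar>dlap \<delta> f k\<bar> \<le> K"
  obtains C where "C \<ge> 0" "\<And>k. \<bar>f k\<bar> \<le> C * (1 + (real_of_int k)\<^sup>2)"
    "\<And>k. \<bar>f (k + 1) - f k\<bar> \<le> C * (1 + \<bar>real_of_int k\<bar>)"
proof -
  define D where "D = \<delta>\<^sup>2 * K"
  define d where "d k = f (k + 1) - f k" for k
  have K0: "K \<ge> 0" using K[of 0] by linarith
  have D0: "D \<ge> 0" using K0 by (simp add: D_def)
  have dd: "\<bar>d k - d (k - 1)\<bar> \<le> D" for k
  proof -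
    have "d k - d (k - 1) = \<delta>\<^sup>2 * dlap \<delta> f k" using assms(1) by (simp add: d_def dlap_def)
    then show ?thesis using mult_left_mono[OF K[of k], of "\<delta>\<^sup>2"] by (simp add: D_def abs_mult)
  qed
  have d: "\<bar>d k\<bar> \<le> \<bar>d 0\<bar> + D * \<bar>real_of_int k\<bar>" for k
  proof (induction k rule: int_induct[where k=0])
    case (step1 i)
    have "\<bar>real_of_int (i + 1)\<bar> = \<bar>real_of_int i\<bar> + 1" using step1 by simp
    then show ?case using dd[of "i + 1"] step1 by (simp add: distrib_left)
  next
    case (step2 i)
    have "\<bar>real_of_int (i - 1)\<bar> = \<bar>real_of_int i\<bar> + 1" using step2 by simp
    then show ?case using dd[of i] step2 by (simp add: algebra_simps)
  qed auto
  have f: "\<bar>f k\<bar> \<le> \<bar>f 0\<bar> + \<bar>real_of_int k\<bar> * (\<bar>d 0\<bar> + D * \<bar>real_of_int k\<bar>)" for k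
  proof (induction k rule: int_induct[where k=0])
    case (step1 i)
    define x where "x = \<bar>real_of_int i\<bar>"
    have x: "\<bar>real_of_int (i + 1)\<bar> = x + 1" "x \<ge> 0" using step1 by (simp_all add: x_def)
    have "\<bar>f (i + 1)\<bar> \<le> \<bar>f i\<bar> + \<bar>d i\<bar>" by (simp add: d_def)
    also have "\<dots> \<le> \<bar>f 0\<bar> + x * (\<bar>d 0\<bar> + D * x) + (\<bar>d 0\<bar> + D * x)"
      using step1 d[of i] by (simp add: x_def)
    also have "\<dots> \<le> \<bar>f 0\<bar> + (x + 1) * (\<bar>d 0\<bar> + D * (x + 1))"
      using D0 x by (simp add: algebra_simps)
    finally show ?case unfolding x(1) .
  next
    case (step2 i)
    define x where "x = \<bar>real_of_int i\<bar>"
    have x: "\<bar>real_of_int (i - 1)\<bar> = x + 1" "x \<ge> 0" using step2 by (simp_all add: x_def)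
    have "\<bar>f (i - 1)\<bar> \<le> \<bar>f i\<bar> + \<bar>d (i - 1)\<bar>" by (simp add: d_def)
    also have "\<dots> \<le> \<bar>f 0\<bar> + x * (\<bar>d 0\<bar> + D * x) + (\<bar>d 0\<bar> + D * (x + 1))"
      using step2 d[of "i - 1"] x unfolding x_def by (auto simp del: of_int_diff)
    also have "\<dots> \<le> \<bar>f 0\<bar> + (x + 1) * (\<bar>d 0\<bar> + D * (x + 1))"
      using D0 x by (simp add: algebra_simps)
    finally show ?case unfolding x(1) .
  qed auto
  show thesis
  proof (rule that[of "\<bar>f 0\<bar> + \<bar>d 0\<bar> + D"])
    fix k :: int
    define x where "x = \<bar>real_of_int k\<bar>"
    have x: "x \<ge> 0" "(real_of_int k)\<^sup>2 = x\<^sup>2" by (simp_all add: x_def)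
    have "2 * x \<le> 1 + x\<^sup>2" using zero_le_power2[of "x - 1"] by (simp add: power2_diff)
    then have "x \<le> 1 + x\<^sup>2" using x by linarith
    then have "\<bar>d 0\<bar> * x \<le> \<bar>d 0\<bar> * (1 + x\<^sup>2)" by (intro mult_left_mono) auto
    moreover have "\<bar>f 0\<bar> \<le> \<bar>f 0\<bar> * (1 + x\<^sup>2)" by (simp add: algebra_simps)
    moreover have "D * x\<^sup>2 \<le> D * (1 + x\<^sup>2)" using D0 by (intro mult_left_mono) auto
    ultimately have "\<bar>f 0\<bar> + x * (\<bar>d 0\<bar> + D * x) \<le> (\<bar>f 0\<bar> + \<bar>d 0\<bar> + D) * (1 + x\<^sup>2)"
      by (simp add: algebra_simps power2_eq_square)
    then show "\<bar>f k\<bar> \<le> (\<bar>f 0\<bar> + \<bar>d 0\<bar> + D) * (1 + (real_of_int k)\<^sup>2)"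
      using f[of k] unfolding x(2) x_def by linarith
    have "\<bar>d 0\<bar> + D * x \<le> (\<bar>f 0\<bar> + \<bar>d 0\<bar> + D) * (1 + x)"
      using D0 x by (simp add: algebra_simps)
    then show "\<bar>f (k + 1) - f k\<bar> \<le> (\<bar>f 0\<bar> + \<bar>d 0\<bar> + D) * (1 + \<bar>real_of_int k\<bar>)"
      using d[of k] by (simp add: x_def d_def)
  qed (use D0 in auto)
qed

text \<open>The saturation \<open>x / (1 + \<epsilon> x)\<close> is a bounded truncation, applied
  here to three consecutive values. In the continuous chain rule its second derivative is bounded by
  |\<phi>''| plus \<open>2 \<epsilon> (\<phi>')^2 / (1 + \<epsilon> \<phi>)^3\<close>; a bound
  \<open>(\<phi>')^2 \<le> M \<phi>\<close> makes this uniform in \<epsilon>.\<close>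

lemma second_difference_saturated:
  fixes x y z \<epsilon> :: real
  assumes "x \<ge> 0" "y \<ge> 0" "z \<ge> 0" "0 < \<epsilon>" "\<epsilon> \<le> 1"
    and D: "\<bar>z + x - 2 * y\<bar> \<le> D" and M: "(y - x)\<^sup>2 \<le> M * x" "M \<ge> 0"
  shows "\<bar>z / (1 + \<epsilon> * z) + x / (1 + \<epsilon> * x) - 2 * (y / (1 + \<epsilon> * y))\<bar> \<le> D + 3 * M + D\<^sup>2"
proof -
  define p q r where "p = 1 + \<epsilon> * x" and "q = 1 + \<epsilon> * y" and "r = 1 + \<epsilon> * z"
  have ge1: "p \<ge> 1" "q \<ge> 1" "r \<ge> 1" using assms by (auto simp: p_def q_def r_def)
  have D0: "D \<ge> 0" using D by linarith
  define e where "e = y - x"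
  define u where "u = z + x - 2 * y"
  \<comment> \<open>Discrete chain rule: \<open>u\<close> is the second difference, \<open>e\<close>
    the backward increment, and \<open>2 * e + u\<close> the sum of both increments.\<close>
  have "z / r + x / p - 2 * (y / q) = u / (q * r) - \<epsilon> * e * (2 * e + u) / (p * (q * r))"
  proof -
    have "z / r - y / q = (z - y) / (q * r)" "y / q - x / p = (y - x) / (p * q)"
      using ge1 by (simp_all add: field_simps) (simp_all add: p_def q_def r_def algebra_simps)
    moreover have "u / (q * r) - \<epsilon> * e * (2 * e + u) / (p * (q * r)) = (p * u - \<epsilon> * e * (2 * e + u)) / (p * (q * r))"
      using ge1 by (simp add: field_simps)
    moreover have "(z - y) / (q * r) - (y - x) / (p * q) = (p * (z - y) - r * (y - x)) / (p * (q * r))"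
      using ge1 by (simp add: field_simps)
    moreover have "p * (z - y) - r * (y - x) = p * u - \<epsilon> * e * (2 * e + u)"
      by (simp add: p_def r_def u_def e_def algebra_simps)
    ultimately show ?thesis by simp
  qed
  moreover have "\<bar>u / (q * r)\<bar> \<le> D"
  proof -
    have "q * r \<ge> 1" using ge1 mult_mono[of 1 q 1 r] by simp
    then have "\<bar>u\<bar> / (q * r) \<le> D / 1" using D D0 by (intro frac_le) (auto simp: u_def)
    then show ?thesis using ge1 by (simp add: abs_mult)
  qed
  moreover have "\<bar>\<epsilon> * e * (2 * e + u) / (p * (q * r))\<bar> \<le> 3 * M + D\<^sup>2"
  proof -
    have "\<bar>e * (2 * e + u)\<bar> \<le> 3 * e\<^sup>2 + D\<^sup>2"
    proof -
      have "u\<^sup>2 \<le> D\<^sup>2" using D by (simp add: u_def abs_le_square_iff[symmetric])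
      moreover have "2 * \<bar>e * u\<bar> \<le> e\<^sup>2 + u\<^sup>2"
        using zero_le_power2[of "\<bar>e\<bar> - \<bar>u\<bar>"] by (simp add: power2_diff abs_mult)
      moreover have "\<bar>e * (2 * e + u)\<bar> \<le> 2 * e\<^sup>2 + \<bar>e * u\<bar>"
      proof -
        have "e * (2 * e + u) = 2 * e\<^sup>2 + e * u" by (simp add: power2_eq_square algebra_simps)
        then show ?thesis using zero_le_power2[of e] by linarith
      qed
      ultimately show ?thesis using zero_le_power2[of e] zero_le_power2[of u] by linarith
    qed
    then have "\<epsilon> * \<bar>e * (2 * e + u)\<bar> \<le> \<epsilon> * (3 * (M * x) + D\<^sup>2)"
      using M assms by (intro mult_left_mono) (auto simp: e_def)
    also have "\<dots> \<le> 3 * M * (\<epsilon> * x) + D\<^sup>2"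
      using assms mult_right_mono[of \<epsilon> 1 "D\<^sup>2"] by (simp add: algebra_simps)
    \<comment> \<open>Since \<open>\<epsilon> * x \<le> p\<close>, the growth of
      \<open>M * x\<close> is paid for by one factor of the denominator.\<close>
    also have "\<dots> \<le> (3 * M + D\<^sup>2) * p"
      using assms by (simp add: p_def algebra_simps)
    finally have 1: "\<bar>\<epsilon> * e * (2 * e + u)\<bar> \<le> (3 * M + D\<^sup>2) * p"
      using assms by (simp add: abs_mult mult.assoc)
    have "p * 1 \<le> p * (q * r)" using ge1 mult_mono[of 1 q 1 r] by (intro mult_left_mono) auto
    then have "\<bar>\<epsilon> * e * (2 * e + u)\<bar> \<le> (3 * M + D\<^sup>2) * (p * (q * r))"
      using 1 M(2) by (intro order.trans[OF 1] mult_left_mono) auto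
    then show ?thesis using ge1 by (simp add: abs_mult divide_le_eq)
  qed
  ultimately show ?thesis unfolding p_def q_def r_def by linarith
qed

text \<open>For quadratically growing \<phi> and merely summable \<open>z\<close> the shifted
  products need not be summable separately. The saturations of \<phi> are bounded, so the bounded
  case applies to them; one side converges by the second moment of \<open>dlap \<delta> z\<close>,
  the other because the Laplacians of the saturations are uniformly bounded. The lower bound on
  \<phi> dominates its squared increments, as that uniform bound requires.\<close>

lemma infsum_mult_dlap_coercive:
  assumes "\<delta> \<noteq> 0" and K: "\<And>k. \<bar>dlap \<delta> \<phi> k\<bar> \<le> K" and \<phi>: "\<And>k. 1 + (real_of_int k)\<^sup>2 \<le> \<phi> k"
    and z: "z summable_on UNIV" and z2: "(\<lambda>k. (1 + (real_of_int k)\<^sup>2) * dlap \<delta> z k) summable_on UNIV"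
  shows "(\<lambda>k. \<phi> k * dlap \<delta> z k) summable_on UNIV"
    and "(\<Sum>\<^sub>\<infinity>k. \<phi> k * dlap \<delta> z k) = (\<Sum>\<^sub>\<infinity>k. dlap \<delta> \<phi> k * z k)"
proof -
  obtain C where C: "C \<ge> 0" "\<And>k. \<bar>\<phi> k\<bar> \<le> C * (1 + (real_of_int k)\<^sup>2)"
    "\<And>k. \<bar>\<phi> (k + 1) - \<phi> k\<bar> \<le> C * (1 + \<bar>real_of_int k\<bar>)"
    by (rule second_difference_growth[OF assms(1) K]) (rule that)
  have pos: "\<phi> k \<ge> 1" for k using \<phi>[of k] zero_le_power2[of "real_of_int k"] by linarith
  define \<epsilon> where "\<epsilon> n = inverse (real (Suc n))" for n
  have \<epsilon>: "0 < \<epsilon> n" "\<epsilon> n \<le> 1" "\<epsilon> \<longlonglongrightarrow> 0" for n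
    unfolding \<epsilon>_def using LIMSEQ_inverse_real_of_nat by (auto simp: field_simps)
  define \<psi> where "\<psi> n k = \<phi> k / (1 + \<epsilon> n * \<phi> k)" for n k
  have den: "1 + \<epsilon> n * \<phi> k \<ge> 1" for n k using pos[of k] \<epsilon>(1)[of n] by simp
  have \<psi>_bd: "\<bar>\<psi> n k\<bar> \<le> 1 / \<epsilon> n" for n k
    using pos[of k] \<epsilon>(1)[of n] den[of n k] less_le_trans[OF zero_less_one den[of n k]]
    by (simp add: \<psi>_def abs_mult pos_divide_le_eq pos_le_divide_eq mult.commute)
  have \<psi>_le: "\<bar>\<psi> n k\<bar> \<le> \<phi> k" for n k
  proof -
    have "\<phi> k / (1 + \<epsilon> n * \<phi> k) \<le> \<phi> k / 1" using pos[of k] den[of n k] by (intro frac_le) auto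
    moreover have "\<psi> n k \<ge> 0" using pos[of k] den[of n k] by (simp add: \<psi>_def)
    ultimately show ?thesis unfolding \<psi>_def by linarith
  qed
  have \<psi>_lim: "(\<lambda>n. \<psi> n k) \<longlonglongrightarrow> \<phi> k" for k
  proof -
    have "(\<lambda>n. \<phi> k / (1 + \<epsilon> n * \<phi> k)) \<longlonglongrightarrow> \<phi> k / (1 + 0 * \<phi> k)"
      by (intro tendsto_intros \<epsilon>) auto
    then show ?thesis by (simp add: \<psi>_def)
  qed
  define D where "D = \<delta>\<^sup>2 * K"
  define M where "M = D + 3 * (2 * C\<^sup>2) + D\<^sup>2"
  have lap: "\<bar>dlap \<delta> (\<psi> n) k\<bar> \<le> M / \<delta>\<^sup>2" for n k
  proof -
    have "\<bar>\<psi> n (k + 1) + \<psi> n (k - 1) - 2 * \<psi> n k\<bar> \<le> M"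
      unfolding \<psi>_def M_def
    proof (rule second_difference_saturated)
      show "\<bar>\<phi> (k + 1) + \<phi> (k - 1) - 2 * \<phi> k\<bar> \<le> D"
        using mult_left_mono[OF K[of k], of "\<delta>\<^sup>2"] assms(1) by (simp add: D_def dlap_def abs_mult)
      \<comment> \<open>A linear bound on increments, once squared, is a multiple of
        \<open>1 + (k - 1)^2\<close>, which coercivity bounds by \<phi> at
        \<open>k - 1\<close>.\<close>
      have "(\<phi> k - \<phi> (k - 1))\<^sup>2 \<le> (C * (1 + \<bar>real_of_int (k - 1)\<bar>))\<^sup>2"
        using C(3)[of "k - 1"] C(1) by (subst abs_le_square_iff[symmetric]) (auto simp: abs_mult)
      also have "\<dots> \<le> C\<^sup>2 * (2 * (1 + (real_of_int (k - 1))\<^sup>2))"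
        unfolding power_mult_distrib
      proof (intro mult_left_mono)
        show "(1 + \<bar>real_of_int (k - 1)\<bar>)\<^sup>2 \<le> 2 * (1 + (real_of_int (k - 1))\<^sup>2)"
          using zero_le_power2[of "1 - \<bar>real_of_int (k - 1)\<bar>"] by (simp add: power2_sum power2_diff del: of_int_diff)
      qed auto
      also have "\<dots> \<le> C\<^sup>2 * (2 * \<phi> (k - 1))" using \<phi>[of "k - 1"] by (intro mult_left_mono) auto
      finally show "(\<phi> k - \<phi> (k - 1))\<^sup>2 \<le> 2 * C\<^sup>2 * \<phi> (k - 1)" by (simp add: algebra_simps)
    qed (use pos \<epsilon> in \<open>auto intro: order.trans[OF zero_le_one]\<close>)
    then show ?thesis by (simp add: dlap_def abs_mult divide_right_mono)
  qed
  have dom: "(\<lambda>k. C * \<bar>(1 + (real_of_int k)\<^sup>2) * dlap \<delta> z k\<bar>) summable_on UNIV"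
    by (intro summable_on_cmult_right summable_on_abs_real z2)
  have le1: "\<bar>\<phi> k * dlap \<delta> z k\<bar> \<le> C * \<bar>(1 + (real_of_int k)\<^sup>2) * dlap \<delta> z k\<bar>" for k
    using mult_right_mono[OF C(2)[of k], of "\<bar>dlap \<delta> z k\<bar>"] by (simp add: abs_mult mult.assoc)
  show "(\<lambda>k. \<phi> k * dlap \<delta> z k) summable_on UNIV"
    by (rule summable_on_bounded_by[OF dom le1])
  have le2: "\<bar>\<psi> n k * dlap \<delta> z k\<bar> \<le> C * \<bar>(1 + (real_of_int k)\<^sup>2) * dlap \<delta> z k\<bar>" for n k
    using mult_right_mono[OF \<psi>_le[of n k], of "\<bar>dlap \<delta> z k\<bar>"] le1[of k] pos[of k] by (simp add: abs_mult)
  have "(\<lambda>n. \<Sum>\<^sub>\<infinity>k. \<psi> n k * dlap \<delta> z k) \<longlonglongrightarrow> (\<Sum>\<^sub>\<infinity>k. \<phi> k * dlap \<delta> z k)"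
    by (rule infsum_dominated_convergence(2)[OF dom le2]) (intro tendsto_intros \<psi>_lim)
  moreover have "(\<lambda>n. \<Sum>\<^sub>\<infinity>k. dlap \<delta> (\<psi> n) k * z k) \<longlonglongrightarrow> (\<Sum>\<^sub>\<infinity>k. dlap \<delta> \<phi> k * z k)"
  proof (rule infsum_dominated_convergence(2))
    show "(\<lambda>k. (M / \<delta>\<^sup>2) * \<bar>z k\<bar>) summable_on UNIV"
      by (intro summable_on_cmult_right summable_on_abs_real z)
    show "\<bar>dlap \<delta> (\<psi> n) k * z k\<bar> \<le> (M / \<delta>\<^sup>2) * \<bar>z k\<bar>" for n k
      using mult_right_mono[OF lap[of n k], of "\<bar>z k\<bar>"] by (simp add: abs_mult)
    show "(\<lambda>n. dlap \<delta> (\<psi> n) k * z k) \<longlonglongrightarrow> dlap \<delta> \<phi> k * z k" for k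
      unfolding dlap_def using assms(1) by (intro tendsto_intros \<psi>_lim) auto
  qed
  moreover have "(\<Sum>\<^sub>\<infinity>k. \<psi> n k * dlap \<delta> z k) = (\<Sum>\<^sub>\<infinity>k. dlap \<delta> (\<psi> n) k * z k)" for n
    by (rule infsum_mult_dlap_bounded[OF z \<psi>_bd])
  ultimately show "(\<Sum>\<^sub>\<infinity>k. \<phi> k * dlap \<delta> z k) = (\<Sum>\<^sub>\<infinity>k. dlap \<delta> \<phi> k * z k)"
    using LIMSEQ_unique by force
qed

text \<open>A large multiple of \<open>1 + k^2\<close> added to \<phi> makes it coercive; thus
  \<phi> is a difference of two coercive functions with bounded Laplacians.\<close>

lemma infsum_mult_dlap:
  assumes "\<delta> \<noteq> 0" and K: "\<And>k. \<bar>dlap \<delta> \<phi> k\<bar> \<le> K"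
    and z: "z summable_on UNIV" and z2: "(\<lambda>k. (1 + (real_of_int k)\<^sup>2) * dlap \<delta> z k) summable_on UNIV"
  shows "(\<Sum>\<^sub>\<infinity>k. \<phi> k * dlap \<delta> z k) = (\<Sum>\<^sub>\<infinity>k. dlap \<delta> \<phi> k * z k)"
proof -
  obtain C where C: "C \<ge> 0" "\<And>k. \<bar>\<phi> k\<bar> \<le> C * (1 + (real_of_int k)\<^sup>2)"
    "\<And>k. \<bar>\<phi> (k + 1) - \<phi> k\<bar> \<le> C * (1 + \<bar>real_of_int k\<bar>)"
    by (rule second_difference_growth[OF assms(1) K]) (rule that)
  \<comment> \<open>The share \<open>C\<close> outweighs a negative \<phi>, and the additional 1
    leaves the required lower bound.\<close>
  define \<beta> where "\<beta> k = (C + 1) * (1 + (real_of_int k)\<^sup>2)" for k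
  define \<alpha> where "\<alpha> k = \<phi> k + \<beta> k" for k
  have \<beta>_lap: "dlap \<delta> \<beta> k = 2 * (C + 1) / \<delta>\<^sup>2" for k
    by (simp add: \<beta>_def dlap_def power2_eq_square algebra_simps)
  have \<alpha>_lap: "dlap \<delta> \<alpha> k = dlap \<delta> \<phi> k + dlap \<delta> \<beta> k" for k
    by (simp add: \<alpha>_def dlap_def add_divide_distrib diff_divide_distrib)
  have \<beta>_ge: "1 + (real_of_int k)\<^sup>2 \<le> \<beta> k" for k using C(1) by (simp add: \<beta>_def algebra_simps)
  have \<alpha>_ge: "1 + (real_of_int k)\<^sup>2 \<le> \<alpha> k" for k
    using C(2)[of k] by (simp add: \<alpha>_def \<beta>_def algebra_simps abs_le_iff)
  have \<alpha>_bd: "\<bar>dlap \<delta> \<alpha> k\<bar> \<le> K + \<bar>2 * (C + 1) / \<delta>\<^sup>2\<bar>" for k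
    using K[of k] unfolding \<alpha>_lap \<beta>_lap by linarith
  have \<beta>_bd: "\<bar>dlap \<delta> \<beta> k\<bar> \<le> \<bar>2 * (C + 1) / \<delta>\<^sup>2\<bar>" for k unfolding \<beta>_lap by simp
  note a = infsum_mult_dlap_coercive[OF assms(1) \<alpha>_bd \<alpha>_ge z z2]
  note b = infsum_mult_dlap_coercive[OF assms(1) \<beta>_bd \<beta>_ge z z2]
  have "(\<Sum>\<^sub>\<infinity>k. \<phi> k * dlap \<delta> z k) = (\<Sum>\<^sub>\<infinity>k. \<alpha> k * dlap \<delta> z k - \<beta> k * dlap \<delta> z k)"
    by (intro infsum_cong) (simp add: \<alpha>_def algebra_simps)
  also have "\<dots> = (\<Sum>\<^sub>\<infinity>k. dlap \<delta> \<alpha> k * z k) - (\<Sum>\<^sub>\<infinity>k. dlap \<delta> \<beta> k * z k)"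
    by (subst infsum_diff_real[OF a(1) b(1)]) (simp add: a(2) b(2))
  also have "\<dots> = (\<Sum>\<^sub>\<infinity>k. dlap \<delta> \<alpha> k * z k - dlap \<delta> \<beta> k * z k)"
    by (rule infsum_diff_real[symmetric]; rule summable_on_mult_bounded[OF z]; rule \<alpha>_bd \<beta>_bd)
  also have "\<dots> = (\<Sum>\<^sub>\<infinity>k. dlap \<delta> \<phi> k * z k)"
    by (intro infsum_cong) (simp add: \<alpha>_lap algebra_simps)
  finally show ?thesis .
qed

section \<open>Densities\<close>

lemma PdeltaD:
  assumes "\<rho> \<in> Pdelta \<delta>" "\<delta> > 0"
  shows "\<rho> k \<ge> 0" "\<rho> summable_on UNIV" "\<delta> * (\<Sum>\<^sub>\<infinity>k. \<rho> k) = 1" "infsum \<rho> UNIV = 1 / \<delta>"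
    "(\<lambda>k. (real_of_int k)\<^sup>2 * \<rho> k) summable_on UNIV" "(\<lambda>k. real_of_int k * \<rho> k) summable_on UNIV"
    "(\<Sum>\<^sub>\<infinity>k. real_of_int k * \<rho> k) = 0" "\<rho> k \<le> 1 / \<delta>"
proof -
  show nn: "\<rho> k \<ge> 0" for k using assms by (simp add: Pdelta_def)
  show s: "\<rho> summable_on UNIV" using assms by (simp add: Pdelta_def)
  show 1: "\<delta> * (\<Sum>\<^sub>\<infinity>k. \<rho> k) = 1" using assms by (simp add: Pdelta_def)
  then show 2: "infsum \<rho> UNIV = 1 / \<delta>" using assms(2) by (simp add: field_simps)
  have "(\<lambda>k. (\<delta> * real_of_int k)\<^sup>2 * \<rho> k) summable_on UNIV" using assms by (simp add: Pdelta_def)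
  then have "(\<lambda>k. (1 / \<delta>\<^sup>2) * ((\<delta> * real_of_int k)\<^sup>2 * \<rho> k)) summable_on UNIV"
    by (rule summable_on_cmult_right)
  then show m2: "(\<lambda>k. (real_of_int k)\<^sup>2 * \<rho> k) summable_on UNIV"
    using assms(2) by (simp add: power_mult_distrib)
  show "(\<lambda>k. real_of_int k * \<rho> k) summable_on UNIV"
  proof (rule summable_on_bounded_by[OF summable_on_add[OF s m2]])
    fix k :: int
    have "2 * \<bar>real_of_int k\<bar> \<le> 1 + (real_of_int k)\<^sup>2"
      using zero_le_power2[of "1 - \<bar>real_of_int k\<bar>"] by (simp add: power2_diff)
    then have "\<bar>real_of_int k\<bar> \<le> 1 + (real_of_int k)\<^sup>2" by linarith
    then have "\<bar>real_of_int k\<bar> * \<rho> k \<le> (1 + (real_of_int k)\<^sup>2) * \<rho> k" using nn by (intro mult_right_mono)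
    then show "\<bar>real_of_int k * \<rho> k\<bar> \<le> \<rho> k + (real_of_int k)\<^sup>2 * \<rho> k"
      using nn[of k] by (simp add: abs_mult algebra_simps)
  qed
  have "\<delta> * (\<Sum>\<^sub>\<infinity>k. \<delta> * real_of_int k * \<rho> k) = 0" using assms by (simp add: Pdelta_def)
  then show "(\<Sum>\<^sub>\<infinity>k. real_of_int k * \<rho> k) = 0"
    using assms(2) by (simp add: mult.assoc infsum_cmult_right')
  show "\<rho> k \<le> 1 / \<delta>" using le_infsum_nonneg[OF s nn, of k] 2 by simp
qed

lemma PdeltaI:
  assumes "\<And>k. \<rho> k \<ge> 0" "(\<lambda>k. (real_of_int k)\<^sup>2 * \<rho> k) summable_on UNIV" "\<rho> summable_on UNIV"
    "\<delta> * (\<Sum>\<^sub>\<infinity>k. \<rho> k) = 1" "(\<Sum>\<^sub>\<infinity>k. real_of_int k * \<rho> k) = 0"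
  shows "\<rho> \<in> Pdelta \<delta>"
  unfolding Pdelta_def using assms summable_on_cmult_right[OF assms(2), of "\<delta>\<^sup>2"]
  by (simp add: power_mult_distrib mult.assoc infsum_cmult_right')

lemma Pdelta_convex:
  assumes \<rho>: "\<rho> \<in> Pdelta \<delta>" and \<eta>: "\<eta> \<in> Pdelta \<delta>" and "\<delta> > 0" "0 \<le> c" "c \<le> 1"
  shows "(\<lambda>k. (1 - c) * \<rho> k + c * \<eta> k) \<in> Pdelta \<delta>"
proof (rule PdeltaI)
  note r = PdeltaD[OF \<rho> assms(3)] and e = PdeltaD[OF \<eta> assms(3)]
  show "0 \<le> (1 - c) * \<rho> k + c * \<eta> k" for k using assms r(1) e(1) by simp
  have "(\<lambda>k. (1 - c) * ((real_of_int k)\<^sup>2 * \<rho> k) + c * ((real_of_int k)\<^sup>2 * \<eta> k)) summable_on UNIV"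
    by (intro summable_on_add summable_on_cmult_right r e)
  then show "(\<lambda>k. (real_of_int k)\<^sup>2 * ((1 - c) * \<rho> k + c * \<eta> k)) summable_on UNIV"
    by (simp add: algebra_simps)
  show "(\<lambda>k. (1 - c) * \<rho> k + c * \<eta> k) summable_on UNIV"
    by (intro summable_on_add summable_on_cmult_right r e)
  have "(\<Sum>\<^sub>\<infinity>k. (1 - c) * \<rho> k + c * \<eta> k) = (1 - c) * infsum \<rho> UNIV + c * infsum \<eta> UNIV"
    by (simp add: infsum_add summable_on_cmult_right r e infsum_cmult_right')
  then show "\<delta> * (\<Sum>\<^sub>\<infinity>k. (1 - c) * \<rho> k + c * \<eta> k) = 1" using r(4) e(4) assms(3) by (simp add: field_simps)
  have "(\<Sum>\<^sub>\<infinity>k. real_of_int k * ((1 - c) * \<rho> k + c * \<eta> k))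
      = (\<Sum>\<^sub>\<infinity>k. (1 - c) * (real_of_int k * \<rho> k) + c * (real_of_int k * \<eta> k))"
    by (intro infsum_cong) (simp add: algebra_simps)
  also have "\<dots> = 0"
    by (subst infsum_add) (auto simp only: infsum_cmult_right' r(7) e(7) intro!: summable_on_cmult_right r e)
  finally show "(\<Sum>\<^sub>\<infinity>k. real_of_int k * ((1 - c) * \<rho> k + c * \<eta> k)) = 0" .
qed

text \<open>Mass and centre survive because the Laplacian, moved by summation by parts, annihilates
  constants and linear functions; \<open>|g| \<le> M \<rho>\<close> hands the second moment of
  \<rho> over to \<open>g\<close>.\<close>

lemma Pdelta_add_dlap:
  assumes \<rho>: "\<rho> \<in> Pdelta \<delta>" and "\<delta> > 0" and g: "\<And>k. \<bar>g k\<bar> \<le> M * \<rho> k"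
    and nn: "\<And>k. \<rho> k + dlap \<delta> g k \<ge> 0"
  shows "(\<lambda>k. \<rho> k + dlap \<delta> g k) \<in> Pdelta \<delta>"
proof -
  note r = PdeltaD[OF \<rho> \<open>\<delta> > 0\<close>]
  have g0: "g summable_on UNIV"
    by (rule summable_on_bounded_by[OF summable_on_cmult_right[OF r(2)] g])
  have bd: "(\<lambda>k. f k * g k) summable_on UNIV" if "(\<lambda>k. f k * \<rho> k) summable_on UNIV" for f
  proof (rule summable_on_bounded_by)
    show "(\<lambda>k. M * \<bar>f k * \<rho> k\<bar>) summable_on UNIV"
      by (intro summable_on_cmult_right summable_on_abs_real that)
    show "\<bar>f k * g k\<bar> \<le> M * \<bar>f k * \<rho> k\<bar>" for k
      using mult_left_mono[OF g[of k], of "\<bar>f k\<bar>"] r(1)[of k] by (simp add: abs_mult algebra_simps)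
  qed
  have g1: "(\<lambda>k. real_of_int k * g k) summable_on UNIV" by (intro bd r)
  have g2: "(\<lambda>k. (real_of_int k)\<^sup>2 * g k) summable_on UNIV" by (intro bd r)
  \<comment> \<open>Discrete Leibniz rule: the two shifts of \<open>g\<close> have equal sums and
    cancel. Its quadratic analogue below serves summability only.\<close>
  have e1: "real_of_int k * dlap \<delta> g k
     = dlap \<delta> (\<lambda>k. real_of_int k * g k) k + (g (k - 1) - g (k + 1)) * (1 / \<delta>\<^sup>2)" for k
    unfolding dlap_def times_divide_eq_right mult_1_right add_divide_distrib[symmetric] by (simp add: algebra_simps)
  have e2: "(real_of_int k)\<^sup>2 * dlap \<delta> g k
     = dlap \<delta> (\<lambda>k. (real_of_int k)\<^sup>2 * g k) k
       + (2 * (real_of_int (k - 1) * g (k - 1)) - 2 * (real_of_int (k + 1) * g (k + 1)) + g (k - 1) + g (k + 1)) * (1 / \<delta>\<^sup>2)" for k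
    unfolding dlap_def times_divide_eq_right mult_1_right add_divide_distrib[symmetric]
    by (simp add: algebra_simps power2_eq_square)
  have sh: "(\<lambda>k. f (k + 1)) summable_on UNIV" "(\<lambda>k. f (k - 1)) summable_on UNIV"
    if "f summable_on UNIV" for f :: "int \<Rightarrow> real"
    using that by (simp_all add: summable_on_shift_int(1,2)[of f])
  have lap0: "infsum (dlap \<delta> f) UNIV = 0" if "f summable_on UNIV" for f
    using infsum_mult_dlap_bounded[OF that, of "\<lambda>_. 1" 1 \<delta>] by (simp add: dlap_def[abs_def])
  show ?thesis
  proof (rule PdeltaI)
    show "0 \<le> \<rho> k + dlap \<delta> g k" for k by (rule nn)
    have "(\<lambda>k. (real_of_int k)\<^sup>2 * \<rho> k + (real_of_int k)\<^sup>2 * dlap \<delta> g k) summable_on UNIV"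
      unfolding e2
      by (intro summable_on_add summable_on_diff_real summable_on_cmult_left summable_on_cmult_right
           dlap_summable r g2 sh[OF g1] sh[OF g0])
    then show "(\<lambda>k. (real_of_int k)\<^sup>2 * (\<rho> k + dlap \<delta> g k)) summable_on UNIV" by (simp add: distrib_left)
    show "(\<lambda>k. \<rho> k + dlap \<delta> g k) summable_on UNIV" by (intro summable_on_add r dlap_summable g0)
    show "\<delta> * (\<Sum>\<^sub>\<infinity>k. \<rho> k + dlap \<delta> g k) = 1"
      using \<open>\<delta> > 0\<close> by (simp add: infsum_add r dlap_summable g0 lap0)
    have "(\<Sum>\<^sub>\<infinity>k. real_of_int k * (\<rho> k + dlap \<delta> g k))
        = (\<Sum>\<^sub>\<infinity>k. real_of_int k * \<rho> k + (dlap \<delta> (\<lambda>k. real_of_int k * g k) k + (g (k - 1) - g (k + 1)) * (1 / \<delta>\<^sup>2)))"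
      unfolding distrib_left e1 ..
    also have "\<dots> = (\<Sum>\<^sub>\<infinity>k. real_of_int k * \<rho> k) + (infsum (dlap \<delta> (\<lambda>k. real_of_int k * g k)) UNIV
         + ((\<Sum>\<^sub>\<infinity>k. g (k - 1)) - (\<Sum>\<^sub>\<infinity>k. g (k + 1))) * (1 / \<delta>\<^sup>2))"
      by (simp only: infsum_add infsum_diff_real infsum_cmult_left' summable_on_add summable_on_diff_real
          summable_on_cmult_left dlap_summable r g1 sh[OF g0])
    also have "\<dots> = 0" by (simp add: lap0 g1 r infsum_shift_int[of g])
    finally show "(\<Sum>\<^sub>\<infinity>k. real_of_int k * (\<rho> k + dlap \<delta> g k)) = 0" .
  qed
qed

section \<open>Sums and integrals\<close>

text \<open>Turns the sum over sites in \<open>Dsq\<close> into an integral, so that Tonelli can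
  exchange it with the time integral.\<close>

lemma infsum_ennreal_eq_nn_integral:
  fixes f :: "int \<Rightarrow> ennreal"
  shows "infsum f UNIV = (\<integral>\<^sup>+k. f k \<partial>count_space UNIV)"
proof -
  obtain g :: "nat \<Rightarrow> int" where g: "bij g"
    using countable_infiniteE'[of "UNIV :: int set"] infinite_UNIV_int by auto
  have "(\<integral>\<^sup>+k. f k \<partial>count_space UNIV) = (\<integral>\<^sup>+n. f (g n) \<partial>count_space UNIV)"
    by (rule nn_integral_bij_count_space[OF g, symmetric])
  also have "\<dots> = (\<Sum>n. f (g n))" by (rule nn_integral_count_space_nat)
  also have "\<dots> = (\<Sum>\<^sub>\<infinity>n. f (g n))"
    by (intro sums_unique[symmetric] has_sum_imp_sums has_sum_infsum nonneg_summable_on_complete) auto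
  also have "\<dots> = infsum f UNIV" by (rule infsum_reindex_bij_betw[OF g])
  finally show ?thesis ..
qed

lemma borel_measurable_infsum:
  fixes f :: "'a \<Rightarrow> int \<Rightarrow> real"
  assumes [measurable]: "\<And>k. (\<lambda>s. f s k) \<in> borel_measurable M"
    and s: "\<And>s. s \<in> space M \<Longrightarrow> f s summable_on UNIV"
  shows "(\<lambda>s. infsum (f s) UNIV) \<in> borel_measurable M"
proof -
  interpret sigma_finite_measure "count_space (UNIV :: int set)"
    by (rule sigma_finite_measure_count_space)
  have "(\<lambda>(s, k). f s k) \<in> borel_measurable (M \<Otimes>\<^sub>M count_space UNIV)"
    unfolding case_prod_beta' by (rule measurable_compose_countable[where f="\<lambda>i p. f (fst p) i"]) measurable
  then have "(\<lambda>s. integral\<^sup>L (count_space UNIV) (f s)) \<in> borel_measurable M"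
    by (rule borel_measurable_lebesgue_integral)
  then show ?thesis
    by (rule measurable_cong[THEN iffD2, rotated]) (simp add: infsum_eq_integral_count_space(2)[OF s])
qed

lemma integral_infsum:
  fixes f :: "real \<Rightarrow> int \<Rightarrow> real"
  assumes f: "\<And>k. (\<lambda>s. f s k) \<in> borel_measurable lborel" and s: "\<And>s. f s summable_on UNIV"
    and B: "integrable lborel B" and le: "\<And>s. (\<Sum>\<^sub>\<infinity>k. \<bar>f s k\<bar>) \<le> B s"
  shows "integrable lborel (\<lambda>s. infsum (f s) UNIV)"
    "\<And>k. integrable lborel (\<lambda>s. f s k)"
    "(\<lambda>k. LINT s|lborel. f s k) summable_on UNIV"
    "(LINT s|lborel. infsum (f s) UNIV) = (\<Sum>\<^sub>\<infinity>k. LINT s|lborel. f s k)"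
proof -
  interpret sigma_finite_measure "count_space (UNIV :: int set)"
    by (rule sigma_finite_measure_count_space)
  interpret P: pair_sigma_finite lborel "count_space (UNIV :: int set)" ..
  note s' = summable_on_abs_real[OF s]
  have nn: "0 \<le> (\<Sum>\<^sub>\<infinity>k. \<bar>f s k\<bar>)" for s by (intro infsum_nonneg) auto
  have m: "(\<lambda>(s, k). f s k) \<in> borel_measurable (lborel \<Otimes>\<^sub>M count_space UNIV)"
    unfolding case_prod_beta'
    by (rule measurable_compose_countable[where f="\<lambda>i p. f (fst p) i"]) (use f in measurable)
  have mabs: "(\<lambda>s. \<Sum>\<^sub>\<infinity>k. \<bar>f s k\<bar>) \<in> borel_measurable lborel"
    by (rule borel_measurable_infsum) (use f s' in auto)
  have I: "integrable (lborel \<Otimes>\<^sub>M count_space UNIV) (\<lambda>(s, k). f s k)"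
  proof (rule P.Fubini_integrable[OF m])
    show "integrable lborel (\<lambda>s. \<integral>k. norm (case (s, k) of (s, k) \<Rightarrow> f s k) \<partial>count_space UNIV)"
      using Bochner_Integration.integrable_bound[OF B mabs] le nn
      by (simp add: infsum_eq_integral_count_space(2)[OF s', symmetric] abs_of_nonneg order.trans[OF _ abs_ge_self])
    show "AE s in lborel. integrable (count_space UNIV) (\<lambda>k. case (s, k) of (s, k) \<Rightarrow> f s k)"
      by (simp add: infsum_eq_integral_count_space(1)[OF s])
  qed
  show "integrable lborel (\<lambda>s. infsum (f s) UNIV)"
    using P.integrable_fst'[OF I] by (simp add: infsum_eq_integral_count_space(2)[OF s])
  show "integrable lborel (\<lambda>s. f s k)" for k
  proof (rule Bochner_Integration.integrable_bound[OF B f])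
    show "AE s in lborel. norm (f s k) \<le> norm (B s)"
    proof (rule AE_I2)
      fix s
      have "\<bar>f s k\<bar> \<le> B s" using le_infsum_nonneg[OF s'[of s], of k] le[of s] by simp
      then show "norm (f s k) \<le> norm (B s)" by simp
    qed
  qed
  have "integrable (count_space UNIV) (\<lambda>k. LINT s|lborel. f s k)"
    using P.integrable_snd[OF I] by simp
  then have "Infinite_Set_Sum.abs_summable_on (\<lambda>k. LINT s|lborel. f s k) UNIV"
    by (simp add: Infinite_Set_Sum.abs_summable_on_def)
  then show S: "(\<lambda>k. LINT s|lborel. f s k) summable_on UNIV"
    unfolding abs_summable_equivalent[symmetric] by (rule abs_summable_summable)
  show "(LINT s|lborel. infsum (f s) UNIV) = (\<Sum>\<^sub>\<infinity>k. LINT s|lborel. f s k)"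
    using P.Fubini_integral[OF I]
    by (simp add: infsum_eq_integral_count_space(2)[OF s] infsum_eq_integral_count_space(2)[OF S])
qed

lemma borel_measurable_indefinite_integral:
  fixes f :: "real \<Rightarrow> real"
  assumes [measurable]: "f \<in> borel_measurable lborel"
  shows "(\<lambda>t. LINT s:{0..t}|lborel. f s) \<in> borel_measurable lborel"
proof -
  have "(\<lambda>(t, s). indicator {p :: real \<times> real. 0 \<le> snd p \<and> snd p \<le> fst p} (t, s) * f s)
      \<in> borel_measurable (lborel \<Otimes>\<^sub>M lborel)"
    by measurable
  then have "(\<lambda>t. LINT s|lborel. indicator {p :: real \<times> real. 0 \<le> snd p \<and> snd p \<le> fst p} (t, s) * f s)
      \<in> borel_measurable lborel"
    by (rule lborel.borel_measurable_lebesgue_integral)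
  then show ?thesis by (simp add: set_lebesgue_integral_def indicator_def cong: if_cong)
qed

text \<open>Fubini on the square, split along the diagonal.\<close>
lemma integral_product_rule:
  fixes F G f g :: "real \<Rightarrow> real"
  assumes f: "integrable lborel f" and g: "integrable lborel g"
    and F: "\<And>t. 0 \<le> t \<Longrightarrow> t \<le> T \<Longrightarrow> F t = F 0 + (LINT s:{0..t}|lborel. f s)"
    and G: "\<And>t. 0 \<le> t \<Longrightarrow> t \<le> T \<Longrightarrow> G t = G 0 + (LINT s:{0..t}|lborel. g s)"
    and T: "0 \<le> T"
  shows "set_integrable lborel {0..T} (\<lambda>s. f s * G s + F s * g s)"
    and "F T * G T = F 0 * G 0 + (LINT s:{0..T}|lborel. f s * G s + F s * g s)"
proof -
  define u v where "u s = indicator {0..T} s * f s" and "v s = indicator {0..T} s * g s" for s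
  have [measurable]: "f \<in> borel_measurable lborel" "g \<in> borel_measurable lborel" using f g by auto
  have u: "integrable lborel u" and v: "integrable lborel v"
    using integrable_mult_indicator[OF _ f, of "{0..T}"] integrable_mult_indicator[OF _ g, of "{0..T}"]
    by (simp_all add: u_def[abs_def] v_def[abs_def])
  have [measurable]: "u \<in> borel_measurable borel" "v \<in> borel_measurable borel" using u v by auto
  have I: "integrable (lborel \<Otimes>\<^sub>M lborel) (\<lambda>(x, y). u x * v y)"
  proof (rule lborel_pair.Fubini_integrable)
    show "integrable lborel (\<lambda>x. LINT y|lborel. norm (case (x, y) of (x, y) \<Rightarrow> u x * v y))"
      using u v by (simp add: abs_mult)
    show "AE x in lborel. integrable lborel (\<lambda>y. case (x, y) of (x, y) \<Rightarrow> u x * v y)"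
      using v by simp
  qed measurable
  define D where "D = {p :: real \<times> real. snd p \<le> fst p}"
  have DM[measurable]: "D \<in> sets (lborel \<Otimes>\<^sub>M lborel)"
  proof -
    have "{p \<in> space (lborel \<Otimes>\<^sub>M lborel). snd p \<le> fst p} \<in> sets (lborel \<Otimes>\<^sub>M (lborel :: real measure))"
      by measurable
    then show ?thesis by (simp add: D_def space_pair_measure)
  qed
  have I1: "integrable (lborel \<Otimes>\<^sub>M lborel) (\<lambda>(x, y). indicator D (x, y) * (u x * v y))"
    using integrable_mult_indicator[OF DM I] by (simp add: case_prod_beta')
  have DM2: "- D \<in> sets (lborel \<Otimes>\<^sub>M lborel)"
    using sets.compl_sets[OF DM] by (simp add: space_pair_measure Compl_eq_Diff_UNIV)
  have I2: "integrable (lborel \<Otimes>\<^sub>M lborel) (\<lambda>(x, y). indicator (- D) (x, y) * (u x * v y))"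
    using integrable_mult_indicator[OF DM2 I] by (simp add: case_prod_beta')
  have GG: "(LINT y|lborel. indicator D (x, y) * (u x * v y)) = indicator {0..T} x * (f x * (G x - G 0))" for x
  proof (cases "x \<in> {0..T}")
    case True
    have "(LINT y|lborel. indicator D (x, y) * (u x * v y)) = (LINT y|lborel. u x * (indicator {0..x} y * g y))"
      using True by (intro Bochner_Integration.integral_cong) (auto simp: D_def v_def split: split_indicator)
    also have "\<dots> = u x * (G x - G 0)" using True G[of x] by (simp add: set_lebesgue_integral_def)
    finally show ?thesis using True by (simp add: u_def)
  qed (simp add: u_def)
  have FF: "(LINT x|lborel. indicator (- D) (x, y) * (u x * v y)) = indicator {0..T} y * ((F y - F 0) * g y)" for y
  proof (cases "y \<in> {0..T}")
    case True
    \<comment> \<open>The complement of \<open>D\<close> is the strict triangle; the missing point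
      \<open>x = y\<close> is a null set.\<close>
    have "AE x in lborel. x \<noteq> y" by (rule AE_lborel_singleton)
    then have "(LINT x|lborel. indicator (- D) (x, y) * (u x * v y)) = (LINT x|lborel. (indicator {0..y} x * f x) * v y)"
      using True by (intro integral_cong_AE) (auto simp: D_def u_def split: split_indicator elim!: eventually_mono)
    also have "\<dots> = (F y - F 0) * v y" using True F[of y] by (simp add: set_lebesgue_integral_def)
    finally show ?thesis using True by (simp add: v_def)
  qed (simp add: v_def)
  have i1: "integrable lborel (\<lambda>x. indicator {0..T} x * (f x * (G x - G 0)))"
    using lborel_pair.integrable_fst'[OF I1] by (simp add: GG)
  have i2: "integrable lborel (\<lambda>y. indicator {0..T} y * ((F y - F 0) * g y))"
    using lborel_pair.integrable_snd[OF I2] by (simp add: FF)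
  have "(\<lambda>s. indicator {0..T} s * (f s * G s + F s * g s)) = (\<lambda>s. indicator {0..T} s * (f s * (G s - G 0))
     + indicator {0..T} s * ((F s - F 0) * g s) + G 0 * u s + F 0 * v s)"
    by (auto simp: u_def v_def algebra_simps)
  note eq = this
  show int: "set_integrable lborel {0..T} (\<lambda>s. f s * G s + F s * g s)"
    unfolding set_integrable_def using i1 i2 u v by (simp add: eq)
  have U: "(LINT s|lborel. u s) = F T - F 0" "(LINT s|lborel. v s) = G T - G 0"
    using F[of T] G[of T] T by (simp_all add: set_lebesgue_integral_def u_def v_def)
  have "(F T - F 0) * (G T - G 0) = (LINT x|lborel. LINT y|lborel. u x * v y)" by (simp add: U)
  also have "\<dots> = (LINT p|(lborel \<Otimes>\<^sub>M lborel). (case p of (x, y) \<Rightarrow> u x * v y))"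
    using lborel_pair.integral_fst'[OF I] by simp
  also have "\<dots> = (LINT p|(lborel \<Otimes>\<^sub>M lborel). (case p of (x, y) \<Rightarrow> indicator D (x, y) * (u x * v y))
        + (case p of (x, y) \<Rightarrow> indicator (- D) (x, y) * (u x * v y)))"
    by (intro Bochner_Integration.integral_cong) (auto split: split_indicator)
  also have "\<dots> = (LINT p|(lborel \<Otimes>\<^sub>M lborel). (case p of (x, y) \<Rightarrow> indicator D (x, y) * (u x * v y)))
        + (LINT p|(lborel \<Otimes>\<^sub>M lborel). (case p of (x, y) \<Rightarrow> indicator (- D) (x, y) * (u x * v y)))"
    by (rule Bochner_Integration.integral_add[OF I1 I2])
  also have "\<dots> = (LINT x|lborel. indicator {0..T} x * (f x * (G x - G 0)))
        + (LINT y|lborel. indicator {0..T} y * ((F y - F 0) * g y))"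
    using lborel_pair.integral_fst'[OF I1] lborel_pair.integral_snd[OF I2] by (simp add: GG FF)
  finally have "(LINT s|lborel. indicator {0..T} s * (f s * G s + F s * g s))
     = (F T - F 0) * (G T - G 0) + G 0 * (F T - F 0) + F 0 * (G T - G 0)"
    unfolding eq using i1 i2 u v by (simp add: U)
  then show "F T * G T = F 0 * G 0 + (LINT s:{0..T}|lborel. f s * G s + F s * g s)"
    by (simp add: set_lebesgue_integral_def algebra_simps)
qed


section \<open>Curves of finite action\<close>

text \<open>Continuity equation together with an upper bound for the cost. The inequality
  \<open>w^2 \<le> a \<rho>\<close> stands in for the quotient, which covers vanishing densities,
  and \<open>a\<close> may depend on time in any manner: measurability is asked only of the momentum
  and of the bound \<open>A\<close> on the sum of \<open>a\<close>.\<close>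

definition action_curve :: "real \<Rightarrow> (real \<Rightarrow> int \<Rightarrow> real) \<Rightarrow> (real \<Rightarrow> int \<Rightarrow> real) \<Rightarrow> (real \<Rightarrow> real) \<Rightarrow> bool" where
  "action_curve \<delta> \<rho> w A \<longleftrightarrow> (\<forall>s\<in>{0..1}. \<rho> s \<in> Pdelta \<delta>)
    \<and> (\<forall>k. (\<lambda>s. indicator {0..1} s * w s k) \<in> borel_measurable lborel)
    \<and> (\<forall>s\<in>{0..1}. \<exists>a. a summable_on UNIV \<and> infsum a UNIV \<le> A s \<and> (\<forall>k. 0 \<le> a k \<and> (w s k)\<^sup>2 \<le> a k * \<rho> s k))
    \<and> set_integrable lborel {0..1} A
    \<and> (\<forall>k. \<forall>t\<in>{0..1}. \<rho> t k = \<rho> 0 k + (LINT s:{0..t}|lborel. dlap \<delta> (w s) k))"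

text \<open>The density is an indefinite integral of measurable momenta, so its measurability in
  time, and that of the cost, comes from the continuity equation.\<close>

lemma borel_measurable_curve:
  fixes \<rho> w :: "real \<Rightarrow> int \<Rightarrow> real"
  assumes w: "\<And>k. (\<lambda>s. indicator {0..1} s * w s k) \<in> borel_measurable lborel"
    and \<rho>: "\<And>k t. t \<in> {0..1} \<Longrightarrow> \<rho> t k = \<rho> 0 k + (LINT s:{0..t}|lborel. dlap \<delta> (w s) k)"
  shows "(\<lambda>s. indicator {0..1} s * \<rho> s k) \<in> borel_measurable lborel"
    and "(\<lambda>s. indicator {0..1} s * Qfun (w s k) (\<rho> s k)) \<in> borel_measurable lborel"
proof -
  have [measurable]: "(\<lambda>s. indicator {0..1} s * w s j) \<in> borel_measurable borel" for j
    using w[of j] by simp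
  define f where "f s = dlap \<delta> (\<lambda>j. indicator {0..1} s * w s j) k" for s :: real
  have [measurable]: "f \<in> borel_measurable lborel" unfolding f_def dlap_def by measurable
  have [measurable]: "(\<lambda>t. LINT s:{0..t}|lborel. f s) \<in> borel_measurable borel"
    using borel_measurable_indefinite_integral[of f] by simp
  have eq: "(LINT s:{0..t}|lborel. dlap \<delta> (w s) k) = (LINT s:{0..t}|lborel. f s)" if "t \<in> {0..1}" for t
    unfolding set_lebesgue_integral_def using that
    by (intro Bochner_Integration.integral_cong) (auto simp: f_def split: split_indicator)
  have "(\<lambda>s. indicator {0..1} s * (\<rho> 0 k + (LINT r:{0..s}|lborel. f r))) \<in> borel_measurable lborel" by measurable
  also have "(\<lambda>s. indicator {0..1} s * (\<rho> 0 k + (LINT r:{0..s}|lborel. f r))) = (\<lambda>s. indicator {0..1} s * \<rho> s k)"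
  proof
    fix s :: real
    show "indicator {0..1} s * (\<rho> 0 k + (LINT r:{0..s}|lborel. f r)) = indicator {0..1} s * \<rho> s k"
    proof (cases "s \<in> {0..1}")
      case True
      show ?thesis unfolding \<rho>[OF True, of k] eq[OF True] ..
    qed simp
  qed
  finally show r[measurable]: "(\<lambda>s. indicator {0..1} s * \<rho> s k) \<in> borel_measurable lborel" .
  have [measurable]: "(\<lambda>s. indicator {0..1} s * \<rho> s k) \<in> borel_measurable borel" using r by simp
  have "(\<lambda>s. indicator {0..1} s * Qfun (indicator {0..1} s * w s k) (indicator {0..1} s * \<rho> s k)) \<in> borel_measurable lborel"
    unfolding Qfun_def by measurable
  also have "(\<lambda>s. indicator {0..1} s * Qfun (indicator {0..1} s * w s k) (indicator {0..1} s * \<rho> s k))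
     = (\<lambda>s. indicator {0..1} s * Qfun (w s k) (\<rho> s k))"
    by (auto simp: fun_eq_iff split: split_indicator)
  finally show "(\<lambda>s. indicator {0..1} s * Qfun (w s k) (\<rho> s k)) \<in> borel_measurable lborel" .
qed

lemma Qfun_le:
  assumes "p\<^sup>2 \<le> a * r" "r \<ge> 0"
  shows "Qfun p r \<le> ennreal a"
  using assms by (auto simp: Qfun_def field_simps intro!: ennreal_leI)

text \<open>The bound \<open>\<rho> \<le> 1 / \<delta>\<close> turns
  \<open>w^2 \<le> a \<rho>\<close> into \<open>w^2 \<le> a / \<delta>\<close>, which supplies the
  square summability in space and square integrability in time that admissibility demands.\<close>

lemma Dsq_le_action_curve:
  assumes "action_curve \<delta> \<rho> w A" "\<delta> > 0"
  shows "Dsq \<delta> (\<rho> 0) (\<rho> 1) \<le> ennreal (\<delta> * (LINT s:{0..1}|lborel. A s))"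
proof -
  have P: "\<rho> s \<in> Pdelta \<delta>" if "s \<in> {0..1}" for s using assms(1) that unfolding action_curve_def by blast
  have w: "(\<lambda>s. indicator {0..1} s * w s k) \<in> borel_measurable lborel" for k
    using assms(1) unfolding action_curve_def by blast
  have A: "set_integrable lborel {0..1} A" using assms(1) unfolding action_curve_def by blast
  have \<rho>: "\<rho> t k = \<rho> 0 k + (LINT s:{0..t}|lborel. dlap \<delta> (w s) k)" if "t \<in> {0..1}" for t k
    using assms(1) that unfolding action_curve_def by blast
  have "\<exists>a. s \<in> {0..1} \<longrightarrow> a summable_on UNIV \<and> infsum a UNIV \<le> A s \<and> (\<forall>k. 0 \<le> a k \<and> (w s k)\<^sup>2 \<le> a k * \<rho> s k)" for s
    using assms(1) unfolding action_curve_def by blast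
  then obtain a where a: "\<And>s. s \<in> {0..1} \<Longrightarrow> a s summable_on UNIV" "\<And>s. s \<in> {0..1} \<Longrightarrow> infsum (a s) UNIV \<le> A s"
     "\<And>s k. s \<in> {0..1} \<Longrightarrow> 0 \<le> a s k" "\<And>s k. s \<in> {0..1} \<Longrightarrow> (w s k)\<^sup>2 \<le> a s k * \<rho> s k"
    by metis
  have le: "(w s k)\<^sup>2 \<le> (1 / \<delta>) * a s k" if "s \<in> {0..1}" for s k
    using a(4)[OF that, of k] mult_left_mono[OF PdeltaD(8)[OF P[OF that] assms(2)] a(3)[OF that], of k k] by simp
  have aA: "a s k \<le> A s" if "s \<in> {0..1}" for s k
    using le_infsum_nonneg[OF a(1)[OF that] a(3)[OF that], of k] a(2)[OF that] by simp
  have sq: "(\<lambda>k. (w s k)\<^sup>2) summable_on UNIV" if "s \<in> {0..1}" for s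
    by (rule summable_on_bounded_by[OF summable_on_cmult_right[OF a(1)[OF that], of "1 / \<delta>"]])
       (use le[OF that] in auto)
  have [measurable]: "(\<lambda>s. indicator {0..1} s * w s k) \<in> borel_measurable borel" for k
    using w[of k] by simp
  have L2: "integrable lborel (\<lambda>s. indicator {0..1} s * (w s k)\<^sup>2)" for k
  proof (rule Bochner_Integration.integrable_bound)
    show "integrable lborel (\<lambda>s. (1 / \<delta>) * (indicator {0..1} s * A s))"
      using A by (simp add: set_integrable_def)
    have "(\<lambda>s. (indicator {0..1} s * w s k)\<^sup>2) \<in> borel_measurable lborel" by measurable
    also have "(\<lambda>s. (indicator {0..1} s * w s k)\<^sup>2) = (\<lambda>s. indicator {0..1} s * (w s k)\<^sup>2)"
      by (auto simp: fun_eq_iff split: split_indicator)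
    finally show "(\<lambda>s. indicator {0..1} s * (w s k)\<^sup>2) \<in> borel_measurable lborel" .
    show "AE s in lborel. norm (indicator {0..1} s * (w s k)\<^sup>2) \<le> norm ((1 / \<delta>) * (indicator {0..1} s * A s))"
    proof (rule AE_I2)
      fix s
      show "norm (indicator {0..1} s * (w s k)\<^sup>2) \<le> norm ((1 / \<delta>) * (indicator {0..1} s * A s))"
      proof (cases "s \<in> {0..1}")
        case True
        have "(w s k)\<^sup>2 \<le> (1 / \<delta>) * A s"
          using le[OF True, of k] mult_left_mono[OF aA[OF True, of k], of "1 / \<delta>"] assms(2) by simp
        also have "\<dots> \<le> \<bar>(1 / \<delta>) * A s\<bar>" by (rule abs_ge_self)
        finally show ?thesis using True by (simp del: abs_divide)
      qed simp
    qed
  qed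
  have adm: "(\<rho>, w) \<in> admissible \<delta> (\<rho> 0) (\<rho> 1)"
    unfolding admissible_def using P sq L2 w \<rho> by blast
  have "(\<Sum>\<^sub>\<infinity>k. \<integral>\<^sup>+ s. indicator {0..1} s * Qfun (w s k) (\<rho> s k) \<partial>lborel) \<le> ennreal (LINT s:{0..1}|lborel. A s)"
  proof (rule infsum_le_finite_sums)
    \<comment> \<open>Only finite sums of \<open>Qfun\<close> are exchanged with the time integral;
      \<open>a\<close>, which need not be measurable in time, is compared pointwise.\<close>
    fix F :: "int set" assume F: "finite F"
    have "(\<Sum>k\<in>F. \<integral>\<^sup>+ s. indicator {0..1} s * Qfun (w s k) (\<rho> s k) \<partial>lborel)
        = (\<integral>\<^sup>+ s. (\<Sum>k\<in>F. indicator {0..1} s * Qfun (w s k) (\<rho> s k)) \<partial>lborel)"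
      by (rule nn_integral_sum[symmetric]) (rule borel_measurable_curve(2)[OF w \<rho>])
    also have "\<dots> \<le> (\<integral>\<^sup>+ s. ennreal (indicator {0..1} s * A s) \<partial>lborel)"
    proof (rule nn_integral_mono)
      fix s :: real
      show "(\<Sum>k\<in>F. indicator {0..1} s * Qfun (w s k) (\<rho> s k)) \<le> ennreal (indicator {0..1} s * A s)"
      proof (cases "s \<in> {0..1}")
        case True
        have "(\<Sum>k\<in>F. Qfun (w s k) (\<rho> s k)) \<le> (\<Sum>k\<in>F. ennreal (a s k))"
          by (intro sum_mono Qfun_le a(4)[OF True] PdeltaD(1)[OF P[OF True] assms(2)])
        also have "\<dots> = ennreal (\<Sum>k\<in>F. a s k)" using a(3)[OF True] by simp
        also have "\<dots> \<le> ennreal (A s)"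
          using finite_sum_le_infsum[OF a(1)[OF True] F] a(2,3)[OF True] by (intro ennreal_leI) force
        finally show ?thesis using True by simp
      qed simp
    qed
    also have "\<dots> = ennreal (LINT s:{0..1}|lborel. A s)"
      unfolding set_lebesgue_integral_def real_scaleR_def
    proof (rule nn_integral_eq_integral)
      show "integrable lborel (\<lambda>s. indicator {0..1} s * A s)" using A by (simp add: set_integrable_def)
      show "AE s in lborel. 0 \<le> indicator {0..1} s * A s"
        using order.trans[OF a(3) aA] by (intro AE_I2) (auto split: split_indicator)
    qed
    finally show "(\<Sum>k\<in>F. \<integral>\<^sup>+ s. indicator {0..1} s * Qfun (w s k) (\<rho> s k) \<partial>lborel) \<le> ennreal (LINT s:{0..1}|lborel. A s)" .
  qed (auto intro: nonneg_summable_on_complete)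
  then have "ennreal \<delta> * (\<Sum>\<^sub>\<infinity>k. \<integral>\<^sup>+ s. indicator {0..1} s * Qfun (w s k) (\<rho> s k) \<partial>lborel)
      \<le> ennreal (\<delta> * (LINT s:{0..1}|lborel. A s))"
    using assms(2) by (simp add: ennreal_mult' mult_left_mono)
  then show ?thesis unfolding Dsq_def by (intro INF_lower2[OF adm]) simp
qed


text \<open>Normal form of an almost minimal curve: the momentum is set to zero outside the unit
  interval and at times of infinite action, and the density is continued by its end values. Every
  condition then holds at all times instead of almost all, so later sums over sites converge for
  each \<open>s\<close>.\<close>

lemma Dsq_less_obtains_curve:
  assumes "Dsq \<delta> x y < ennreal c" "\<delta> > 0"
  obtains \<rho> w :: "real \<Rightarrow> int \<Rightarrow> real" where "\<And>s. \<rho> s \<in> Pdelta \<delta>" "\<rho> 0 = x" "\<rho> 1 = y"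
    "\<And>s k. s \<notin> {0..1} \<Longrightarrow> w s k = 0" "\<And>k. (\<lambda>s. w s k) \<in> borel_measurable lborel"
    "\<And>s k. \<rho> s k = 0 \<Longrightarrow> w s k = 0"
    "\<And>s. (\<lambda>k. (w s k)\<^sup>2 / \<rho> s k) summable_on UNIV"
    "integrable lborel (\<lambda>s. \<Sum>\<^sub>\<infinity>k. (w s k)\<^sup>2 / \<rho> s k)"
    "\<delta> * (LINT s|lborel. (\<Sum>\<^sub>\<infinity>k. (w s k)\<^sup>2 / \<rho> s k)) \<le> c"
    "\<And>t k. \<rho> t k = x k + (LINT s:{0..t}|lborel. dlap \<delta> (w s) k)"
proof -
  obtain \<rho>' w' where adm: "(\<rho>', w') \<in> admissible \<delta> x y"
    and cost: "ennreal \<delta> * (\<Sum>\<^sub>\<infinity>k. \<integral>\<^sup>+ s. indicator {0..1} s * Qfun (w' s k) (\<rho>' s k) \<partial>lborel) < ennreal c"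
    using assms(1) unfolding Dsq_def INF_less_iff by auto
  have P: "\<rho>' s \<in> Pdelta \<delta>" if "s \<in> {0..1}" for s using adm that unfolding admissible_def by blast
  have ends: "\<rho>' 0 = x" "\<rho>' 1 = y" using adm unfolding admissible_def by blast+
  have w': "(\<lambda>s. indicator {0..1} s * w' s k) \<in> borel_measurable lborel" for k
    using adm unfolding admissible_def by blast
  have \<rho>': "\<rho>' t k = \<rho>' 0 k + (LINT s:{0..t}|lborel. dlap \<delta> (w' s) k)" if "t \<in> {0..1}" for t k
    using adm that unfolding admissible_def by blast
  define q where "q k s = indicator {0..1} s * Qfun (w' s k) (\<rho>' s k)" for k s
  have q[measurable]: "q k \<in> borel_measurable lborel" for k
    unfolding q_def[abs_def] by (rule borel_measurable_curve(2)[OF w' \<rho>'])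
  define G where "G s = (\<integral>\<^sup>+k. q k s \<partial>count_space UNIV)" for s
  have G[measurable]: "G \<in> borel_measurable lborel"
  proof -
    interpret sigma_finite_measure "count_space (UNIV :: int set)"
      by (rule sigma_finite_measure_count_space)
    have "(\<lambda>(s, k). q k s) \<in> borel_measurable (lborel \<Otimes>\<^sub>M count_space UNIV)"
      unfolding case_prod_beta' by (rule measurable_compose_countable[where f="\<lambda>i p. q i (fst p)"]) measurable
    then show ?thesis unfolding G_def by (rule borel_measurable_nn_integral)
  qed
  have Gint: "(\<integral>\<^sup>+s. G s \<partial>lborel) = (\<Sum>\<^sub>\<infinity>k. \<integral>\<^sup>+ s. q k s \<partial>lborel)"
    unfolding G_def infsum_ennreal_eq_nn_integral
    by (rule nn_integral_count_space_nn_integral) auto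
  have cost': "ennreal \<delta> * (\<integral>\<^sup>+s. G s \<partial>lborel) < ennreal c" unfolding Gint q_def by (rule cost)
  have fin: "(\<integral>\<^sup>+s. G s \<partial>lborel) \<noteq> \<infinity>"
    using cost' assms(2) by (auto simp: ennreal_mult_top)
  have AE: "AE s in lborel. G s \<noteq> \<infinity>" by (rule nn_integral_PInf_AE[OF G fin])
  \<comment> \<open>Times with infinite \<open>G\<close> form a null set because the total cost is
    finite; changing the momentum there leaves the continuity equation intact.\<close>
  define w where "w s k = (if 0 \<le> s \<and> s \<le> 1 \<and> G s \<noteq> \<infinity> then w' s k else 0)" for s k
  define \<rho> where "\<rho> s = \<rho>' (max 0 (min 1 s))" for s :: real
  have \<rho>_in: "\<rho> s = \<rho>' s" if "s \<in> {0..1}" for s using that by (auto simp: \<rho>_def max_def min_def)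
  have fin_q: "Qfun (w' s k) (\<rho>' s k) \<noteq> \<infinity>" if "s \<in> {0..1}" "G s \<noteq> \<infinity>" for s k
  proof -
    have "q k s \<le> G s" unfolding G_def by (rule nn_integral_ge_point) simp
    then show ?thesis using that by (auto simp: q_def top_unique)
  qed
  have fin_eq: "Qfun (w' s k) (\<rho>' s k) = ennreal ((w' s k)\<^sup>2 / \<rho>' s k)" "\<rho>' s k = 0 \<Longrightarrow> w' s k = 0"
    if "s \<in> {0..1}" "G s \<noteq> \<infinity>" for s k
    using fin_q[OF that, of k] PdeltaD(1)[OF P[OF that(1)] assms(2), of k]
    by (auto simp: Qfun_def split: if_splits)
  have P': "\<rho> s \<in> Pdelta \<delta>" for s unfolding \<rho>_def by (rule P) auto
  have zero: "w s k = 0" if "\<rho> s k = 0" for s k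
    using that fin_eq(2)[of s k] \<rho>_in[of s] by (auto simp: w_def)
  have nn: "0 \<le> (w s k)\<^sup>2 / \<rho> s k" for s k using PdeltaD(1)[OF P'[of s] assms(2)] by simp
  have sumG: "(\<integral>\<^sup>+k. ennreal ((w s k)\<^sup>2 / \<rho> s k) \<partial>count_space UNIV) \<le> (if G s = \<infinity> then 0 else G s)" for s
  proof (cases "s \<in> {0..1} \<and> G s \<noteq> \<infinity>")
    case True
    then have "(\<integral>\<^sup>+k. ennreal ((w s k)\<^sup>2 / \<rho> s k) \<partial>count_space UNIV) = G s"
      by (subst G_def, intro nn_integral_cong) (auto simp: w_def \<rho>_in q_def fin_eq(1))
    then show ?thesis using True by simp
  next
    case False
    then have "w s k = 0" for k by (auto simp: w_def)
    then show ?thesis by simp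
  qed
  have sm: "(\<lambda>k. (w s k)\<^sup>2 / \<rho> s k) summable_on UNIV" for s
  proof -
    have "(\<integral>\<^sup>+k. ennreal ((w s k)\<^sup>2 / \<rho> s k) \<partial>count_space UNIV) < \<infinity>"
      using sumG[of s] by (auto simp: less_top[symmetric] top_unique split: if_splits)
    then have "integrable (count_space UNIV) (\<lambda>k. (w s k)\<^sup>2 / \<rho> s k)"
      using nn by (intro integrableI_nonneg) auto
    then have "Infinite_Set_Sum.abs_summable_on (\<lambda>k. (w s k)\<^sup>2 / \<rho> s k) UNIV"
      by (simp add: Infinite_Set_Sum.abs_summable_on_def)
    then show ?thesis unfolding abs_summable_equivalent[symmetric] by (rule abs_summable_summable)
  qed
  define A where "A s = (\<Sum>\<^sub>\<infinity>k. (w s k)\<^sup>2 / \<rho> s k)" for s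
  have A0: "A s \<ge> 0" for s unfolding A_def by (intro infsum_nonneg nn)
  have AG: "ennreal (A s) \<le> G s" for s
  proof -
    have "ennreal (A s) = (\<integral>\<^sup>+k. ennreal ((w s k)\<^sup>2 / \<rho> s k) \<partial>count_space UNIV)"
      unfolding A_def infsum_eq_integral_count_space(2)[OF sm]
      by (rule nn_integral_eq_integral[symmetric]) (use nn infsum_eq_integral_count_space(1)[OF sm] in auto)
    also have "\<dots> \<le> G s" using sumG[of s] by (auto split: if_splits)
    finally show ?thesis .
  qed
  have w_meas[measurable]: "(\<lambda>s. w s k) \<in> borel_measurable lborel" for k
  proof -
    have [measurable]: "(\<lambda>s. indicator {0..1} s * w' s k) \<in> borel_measurable borel" using w'[of k] by simp
    have [measurable]: "G \<in> borel_measurable borel" using G by simp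
    have "(\<lambda>s. if G s = \<infinity> then 0 else indicator {0..1} s * w' s k) \<in> borel_measurable lborel" by measurable
    also have "(\<lambda>s. if G s = \<infinity> then 0 else indicator {0..1} s * w' s k) = (\<lambda>s. w s k)"
      by (auto simp: w_def fun_eq_iff split: split_indicator)
    finally show ?thesis .
  qed
  have [measurable]: "(\<lambda>s. w s k) \<in> borel_measurable borel" for k using w_meas by simp
  have eq0: "x k + (LINT s:{0..t}|lborel. dlap \<delta> (w s) k) = \<rho> t k" for t k
  proof -
    have *: "(LINT s:{0..t}|lborel. dlap \<delta> (w s) k) = (LINT s:{0..t}|lborel. dlap \<delta> (w' s) k)" if "t \<in> {0..1}" for t
    proof -
      have [measurable]: "(\<lambda>s. indicator {0..1} s * w' s j) \<in> borel_measurable borel" for j using w'[of j] by simp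
      define f where "f s = dlap \<delta> (\<lambda>j. indicator {0..1} s * w' s j) k" for s
      have [measurable]: "f \<in> borel_measurable borel" unfolding f_def dlap_def by measurable
      have [measurable]: "(\<lambda>s. dlap \<delta> (w s) k) \<in> borel_measurable borel" unfolding dlap_def by measurable
      have "(LINT s|lborel. indicator {0..t} s *\<^sub>R dlap \<delta> (w s) k) = (LINT s|lborel. indicator {0..t} s *\<^sub>R f s)"
      proof (rule integral_cong_AE)
        show "AE s in lborel. indicator {0..t} s *\<^sub>R dlap \<delta> (w s) k = indicator {0..t} s *\<^sub>R f s"
          using AE by eventually_elim (use that in \<open>auto simp: f_def dlap_def w_def split: split_indicator\<close>)
      qed measurable
      also have "\<dots> = (LINT s|lborel. indicator {0..t} s *\<^sub>R dlap \<delta> (w' s) k)"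
        using that by (intro Bochner_Integration.integral_cong) (auto simp: f_def split: split_indicator)
      finally show ?thesis by (simp add: set_lebesgue_integral_def)
    qed
    consider "t < 0" | "t \<in> {0..1}" | "t > 1" by fastforce
    then show ?thesis
    proof cases
      case 1
      then show ?thesis by (simp add: \<rho>_def max_def min_def ends set_lebesgue_integral_def)
    next
      case 2
      then show ?thesis using \<rho>'[OF 2, of k] *[OF 2] by (simp add: ends \<rho>_in)
    next
      case 3
      have "(LINT s:{0..t}|lborel. dlap \<delta> (w s) k) = (LINT s:{0..1}|lborel. dlap \<delta> (w s) k)"
        unfolding set_lebesgue_integral_def using 3
        by (intro Bochner_Integration.integral_cong) (auto simp: w_def dlap_def split: split_indicator)
      then show ?thesis using 3 \<rho>'[of 1 k] *[of 1] by (simp add: \<rho>_def max_def min_def ends)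
    qed
  qed
  have \<rho>_meas[measurable]: "(\<lambda>s. \<rho> s k) \<in> borel_measurable borel" for k
    unfolding eq0[symmetric] using borel_measurable_indefinite_integral[of "\<lambda>s. dlap \<delta> (w s) k"]
    by (simp add: dlap_def)
  have A_meas: "A \<in> borel_measurable lborel"
    unfolding A_def by (rule borel_measurable_infsum[OF _ sm]) measurable
  have nnA: "(\<integral>\<^sup>+s. ennreal (A s) \<partial>lborel) \<le> (\<integral>\<^sup>+s. G s \<partial>lborel)" by (intro nn_integral_mono AG)
  have Aint: "integrable lborel A"
    using A_meas A0 fin nnA by (intro integrableI_nonneg) (auto simp: less_top[symmetric] top_unique)
  have "ennreal (\<delta> * (LINT s|lborel. A s)) = ennreal \<delta> * (\<integral>\<^sup>+s. ennreal (A s) \<partial>lborel)"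
    using assms(2) A0 Aint by (simp add: nn_integral_eq_integral ennreal_mult')
  also have "\<dots> \<le> ennreal \<delta> * (\<integral>\<^sup>+s. G s \<partial>lborel)" by (intro mult_left_mono nnA) simp
  also have "\<dots> < ennreal c" by (rule cost')
  finally have "\<delta> * (LINT s|lborel. A s) \<le> c"
    by (meson ennreal_less_iff ennreal_leI linorder_not_le less_imp_le)
  then show thesis
    using P' zero sm w_meas Aint eq0 \<rho>_in[of 0] \<rho>_in[of 1] ends
    by (intro that[of \<rho> w]) (auto simp: A_def[abs_def] w_def)
qed

section \<open>Time reparametrisation and concatenation of curves\<close>

lemma set_integral_affine:
  fixes f :: "real \<Rightarrow> real"
  assumes "c > 0"
  shows "(LINT s:{\<alpha>..\<beta>}|lborel. f ((s - \<gamma>) / c)) = c * (LINT r:{(\<alpha> - \<gamma>) / c..(\<beta> - \<gamma>) / c}|lborel. f r)"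
    and "set_integrable lborel {(\<alpha> - \<gamma>) / c..(\<beta> - \<gamma>) / c} f \<Longrightarrow> set_integrable lborel {\<alpha>..\<beta>} (\<lambda>s. f ((s - \<gamma>) / c))"
proof -
  define F where "F s = indicator {\<alpha>..\<beta>} s * f ((s - \<gamma>) / c)" for s
  have F: "F (\<gamma> + c * r) = indicator {(\<alpha> - \<gamma>) / c..(\<beta> - \<gamma>) / c} r * f r" for r
    using assms by (auto simp: F_def field_simps split: split_indicator)
  show "(LINT s:{\<alpha>..\<beta>}|lborel. f ((s - \<gamma>) / c)) = c * (LINT r:{(\<alpha> - \<gamma>) / c..(\<beta> - \<gamma>) / c}|lborel. f r)"
    using lborel_integral_real_affine[of c F \<gamma>] assms by (simp add: F) (simp add: F_def[abs_def] set_lebesgue_integral_def)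
  show "set_integrable lborel {\<alpha>..\<beta>} (\<lambda>s. f ((s - \<gamma>) / c))"
    if "set_integrable lborel {(\<alpha> - \<gamma>) / c..(\<beta> - \<gamma>) / c} f"
    using lborel_integrable_real_affine_iff[of c F \<gamma>] assms that
    by (simp add: F set_integrable_def) (simp add: F_def[abs_def])
qed

lemma set_integral_if_le:
  fixes f g :: "real \<Rightarrow> real"
  assumes f: "set_integrable lborel {0..h} f" and g: "set_integrable lborel {h..t} g" and "0 \<le> h" "h \<le> t"
  shows "set_integrable lborel {0..t} (\<lambda>s. if s \<le> h then f s else g s)"
    and "(LINT s:{0..t}|lborel. if s \<le> h then f s else g s) = (LINT s:{0..h}|lborel. f s) + (LINT s:{h..t}|lborel. g s)"
proof -
  have eq: "indicator {0..t} s * (if s \<le> h then f s else g s)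
      = indicator {0..h} s * f s + indicator {h<..t} s * (indicator {h..t} s * g s)" for s
    using assms by (auto split: split_indicator)
  have f': "integrable lborel (\<lambda>s. indicator {0..h} s * f s)"
    using f by (simp add: set_integrable_def)
  have g1: "integrable lborel (\<lambda>s. indicator {h..t} s * g s)"
    using g by (simp add: set_integrable_def)
  have g': "integrable lborel (\<lambda>s. indicator {h<..t} s * (indicator {h..t} s * g s))"
    using integrable_mult_indicator[OF _ g1, of "{h<..t}"] by simp
  have "(LINT s|lborel. indicator {h<..t} s * (indicator {h..t} s * g s)) = (LINT s|lborel. indicator {h..t} s * g s)"
  proof (rule integral_cong_AE)
    show "AE s in lborel. indicator {h<..t} s * (indicator {h..t} s * g s) = indicator {h..t} s * g s"
      using AE_lborel_singleton[of h] by eventually_elim (auto split: split_indicator)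
  qed (use g1 g' in auto)
  then show "(LINT s:{0..t}|lborel. if s \<le> h then f s else g s) = (LINT s:{0..h}|lborel. f s) + (LINT s:{h..t}|lborel. g s)"
    using f' g' by (simp add: set_lebesgue_integral_def eq)
  show "set_integrable lborel {0..t} (\<lambda>s. if s \<le> h then f s else g s)"
    using f' g' by (simp add: set_integrable_def eq)
qed

text \<open>\<open>2|x| \<le> 1 + x^2\<close> and \<open>\<rho> \<le> 1 / \<delta>\<close> turn the
  action bound into an integrable majorant of each component, as needed for splitting time integrals
  when curves are joined.\<close>

lemma action_curve_set_integrable:
  assumes "action_curve \<delta> \<rho> w A" "\<delta> > 0"
  shows "set_integrable lborel {0..1} (\<lambda>s. w s k)"
proof -
  have w: "(\<lambda>s. indicator {0..1} s * w s k) \<in> borel_measurable lborel"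
    and A: "integrable lborel (\<lambda>s. indicator {0..1} s * A s)"
    using assms unfolding action_curve_def set_integrable_def by auto
  show ?thesis unfolding set_integrable_def real_scaleR_def
  proof (rule Bochner_Integration.integrable_bound[OF _ w])
    show "integrable lborel (\<lambda>s. indicator {0..1} s + (1 / \<delta>) * (indicator {0..1} s * A s) :: real)"
      using A by simp
    show "AE s in lborel. norm (indicator {0..1} s * w s k)
        \<le> norm (indicator {0..1} s + (1 / \<delta>) * (indicator {0..1} s * A s))"
    proof (rule AE_I2)
      fix s :: real
      show "norm (indicator {0..1} s * w s k) \<le> norm (indicator {0..1} s + (1 / \<delta>) * (indicator {0..1} s * A s))"
      proof (cases "s \<in> {0..1}")
        case True
        then obtain a where a: "a summable_on UNIV" "infsum a UNIV \<le> A s" "\<And>k. 0 \<le> a k" "(w s k)\<^sup>2 \<le> a k * \<rho> s k"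
          and P: "\<rho> s \<in> Pdelta \<delta>"
          using assms(1) unfolding action_curve_def by blast
        have "(w s k)\<^sup>2 \<le> a k * (1 / \<delta>)"
          using a(4) mult_left_mono[OF PdeltaD(8)[OF P assms(2), of k] a(3)[of k]] by linarith
        also have "\<dots> \<le> A s * (1 / \<delta>)"
          using le_infsum_nonneg[OF a(1), of k] a(2,3) assms(2) by (intro mult_right_mono) auto
        finally have "(w s k)\<^sup>2 \<le> A s * (1 / \<delta>)" .
        moreover have "2 * \<bar>w s k\<bar> \<le> 1 + (w s k)\<^sup>2"
          using zero_le_power2[of "1 - \<bar>w s k\<bar>"] by (simp add: power2_diff)
        ultimately have "\<bar>w s k\<bar> \<le> 1 + (1 / \<delta>) * A s" using abs_ge_zero[of "w s k"] mult.commute[of "A s" "1 / \<delta>"] by linarith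
        also have "\<dots> \<le> \<bar>1 + (1 / \<delta>) * A s\<bar>" by (rule abs_ge_self)
        finally show ?thesis using True by simp
      qed simp
    qed
  qed
qed

text \<open>Running a curve in time \<open>h\<close> multiplies its momentum by \<open>1 / h\<close>
  and its action density by \<open>1 / h^2\<close>; over an interval of length \<open>h\<close> the
  net factor is \<open>1 / h\<close>.\<close>

lemma Dsq_concat:
  assumes c1: "action_curve \<delta> \<rho>\<^sub>1 w\<^sub>1 A\<^sub>1" and c2: "action_curve \<delta> \<rho>\<^sub>2 w\<^sub>2 A\<^sub>2" and "\<delta> > 0"
    and join: "\<rho>\<^sub>1 1 = \<rho>\<^sub>2 0" and h: "0 < h" "h < 1"
  shows "Dsq \<delta> (\<rho>\<^sub>1 0) (\<rho>\<^sub>2 1)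
    \<le> ennreal (\<delta> * ((LINT s:{0..1}|lborel. A\<^sub>1 s) / h + (LINT s:{0..1}|lborel. A\<^sub>2 s) / (1 - h)))"
proof -
  define l where "l = 1 - h"
  have l: "l > 0" using h by (simp add: l_def)
  define \<rho> where "\<rho> s = (if s \<le> h then \<rho>\<^sub>1 (s / h) else \<rho>\<^sub>2 ((s - h) / l))" for s
  define w where "w s k = (if s \<le> h then w\<^sub>1 (s / h) k / h else w\<^sub>2 ((s - h) / l) k / l)" for s k
  define A where "A s = (if s \<le> h then A\<^sub>1 (s / h) / h\<^sup>2 else A\<^sub>2 ((s - h) / l) / l\<^sup>2)" for s
  have in1: "s / h \<in> {0..1}" if "0 \<le> s" "s \<le> h" for s using that h by (simp add: field_simps)
  have in2: "(s - h) / l \<in> {0..1}" if "h \<le> s" "s \<le> 1" for s using that l by (simp add: field_simps l_def)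
  note W1 = action_curve_set_integrable[OF c1 \<open>\<delta> > 0\<close>] and W2 = action_curve_set_integrable[OF c2 \<open>\<delta> > 0\<close>]
  have L1: "set_integrable lborel {0..1} (\<lambda>s. dlap \<delta> (w\<^sub>1 s) k)" for k
    unfolding dlap_def by (intro set_integrable_divide set_integral_diff set_integral_add set_integrable_mult_right W1)
  have L2: "set_integrable lborel {0..1} (\<lambda>s. dlap \<delta> (w\<^sub>2 s) k)" for k
    unfolding dlap_def by (intro set_integrable_divide set_integral_diff set_integral_add set_integrable_mult_right W2)
  have aff1: "(LINT s:{0..t}|lborel. f (s / h)) = h * (LINT r:{0..t / h}|lborel. f r)"
     "set_integrable lborel {0..t / h} f \<Longrightarrow> set_integrable lborel {0..t} (\<lambda>s. f (s / h))" for f t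
    using set_integral_affine[OF h(1), where \<alpha>=0 and \<beta>=t and f=f and \<gamma>=0] by auto
  have aff2: "(LINT s:{h..t}|lborel. f ((s - h) / l)) = l * (LINT r:{0..(t - h) / l}|lborel. f r)"
     "set_integrable lborel {0..(t - h) / l} f \<Longrightarrow> set_integrable lborel {h..t} (\<lambda>s. f ((s - h) / l))" for f t
    using set_integral_affine[OF l, where \<alpha>=h and \<beta>=t and f=f and \<gamma>=h] by auto
  have A1: "set_integrable lborel {0..1} A\<^sub>1" and A2: "set_integrable lborel {0..1} A\<^sub>2"
    using c1 c2 unfolding action_curve_def by auto
  have r1: "\<rho>\<^sub>1 t k = \<rho>\<^sub>1 0 k + (LINT s:{0..t}|lborel. dlap \<delta> (w\<^sub>1 s) k)" if "t \<in> {0..1}" for t k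
    using c1 that unfolding action_curve_def by blast
  have r2: "\<rho>\<^sub>2 t k = \<rho>\<^sub>2 0 k + (LINT s:{0..t}|lborel. dlap \<delta> (w\<^sub>2 s) k)" if "t \<in> {0..1}" for t k
    using c2 that unfolding action_curve_def by blast
  have one: "1 - h = l" "(1 - h) / l = 1" "h / h = 1" using l h by (auto simp: l_def)
  have sA1: "set_integrable lborel {0..h} (\<lambda>s. A\<^sub>1 (s / h) / h\<^sup>2)"
    using aff1(2)[of h A\<^sub>1] A1 one by (intro set_integrable_divide) auto
  have sA2: "set_integrable lborel {h..1} (\<lambda>s. A\<^sub>2 ((s - h) / l) / l\<^sup>2)"
    using aff2(2)[of 1 A\<^sub>2] A2 one by (intro set_integrable_divide) auto
  have "action_curve \<delta> \<rho> w A"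
    unfolding action_curve_def
  proof (intro conjI ballI allI)
    fix s :: real assume s: "s \<in> {0..1}"
    show "\<rho> s \<in> Pdelta \<delta>"
      using c1 c2 in1[of s] in2[of s] s unfolding action_curve_def \<rho>_def by auto
    show "\<exists>a. a summable_on UNIV \<and> infsum a UNIV \<le> A s \<and> (\<forall>k. 0 \<le> a k \<and> (w s k)\<^sup>2 \<le> a k * \<rho> s k)"
    proof (cases "s \<le> h")
      case True
      then obtain a where a: "a summable_on UNIV" "infsum a UNIV \<le> A\<^sub>1 (s / h)"
          "\<And>k. 0 \<le> a k" "\<And>k. (w\<^sub>1 (s / h) k)\<^sup>2 \<le> a k * \<rho>\<^sub>1 (s / h) k"
        using c1[unfolded action_curve_def, THEN conjunct2, THEN conjunct2, THEN conjunct1, rule_format, OF in1[of s]] s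
        by fastforce
      have 1: "(\<lambda>k. a k * (1 / h\<^sup>2)) summable_on UNIV" by (intro summable_on_cmult_left a)
      have 2: "(\<Sum>\<^sub>\<infinity>k. a k * (1 / h\<^sup>2)) \<le> A s"
        unfolding infsum_cmult_left' using True a(2) by (simp add: A_def divide_right_mono)
      have 3: "(w s k)\<^sup>2 \<le> (a k * (1 / h\<^sup>2)) * \<rho> s k" for k
        using a(4)[of k] True by (simp add: w_def \<rho>_def power_divide divide_right_mono)
      show ?thesis using 1 2 3 a(3) by (intro exI[of _ "\<lambda>k. a k * (1 / h\<^sup>2)"]) auto
    next
      case False
      then obtain a where a: "a summable_on UNIV" "infsum a UNIV \<le> A\<^sub>2 ((s - h) / l)"
          "\<And>k. 0 \<le> a k" "\<And>k. (w\<^sub>2 ((s - h) / l) k)\<^sup>2 \<le> a k * \<rho>\<^sub>2 ((s - h) / l) k"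
        using c2[unfolded action_curve_def, THEN conjunct2, THEN conjunct2, THEN conjunct1, rule_format, OF in2[of s]] s
        by fastforce
      have 1: "(\<lambda>k. a k * (1 / l\<^sup>2)) summable_on UNIV" by (intro summable_on_cmult_left a)
      have 2: "(\<Sum>\<^sub>\<infinity>k. a k * (1 / l\<^sup>2)) \<le> A s"
        unfolding infsum_cmult_left' using False a(2) by (simp add: A_def divide_right_mono)
      have 3: "(w s k)\<^sup>2 \<le> (a k * (1 / l\<^sup>2)) * \<rho> s k" for k
        using a(4)[of k] False by (simp add: w_def \<rho>_def power_divide divide_right_mono)
      show ?thesis using 1 2 3 a(3) by (intro exI[of _ "\<lambda>k. a k * (1 / l\<^sup>2)"]) auto
    qed
  next
    fix k
    have "set_integrable lborel {0..1} (\<lambda>s. if s \<le> h then w\<^sub>1 (s / h) k / h else w\<^sub>2 ((s - h) / l) k / l)"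
      by (rule set_integral_if_le(1); (intro set_integrable_divide)?)
         (use aff1(2)[of h "\<lambda>s. w\<^sub>1 s k"] aff2(2)[of 1 "\<lambda>s. w\<^sub>2 s k"] W1 W2 one h in auto)
    then show "(\<lambda>s. indicator {0..1} s * w s k) \<in> borel_measurable lborel"
      unfolding set_integrable_def w_def by auto
  next
    show "set_integrable lborel {0..1} A"
      unfolding A_def by (rule set_integral_if_le(1)[OF sA1 sA2]) (use h in auto)
  next
    fix k t assume t: "t \<in> {0..1 :: real}"
    have eq1: "(LINT s:{0..t}|lborel. dlap \<delta> (w\<^sub>1 (s / h)) k / h) = \<rho>\<^sub>1 (t / h) k - \<rho>\<^sub>1 0 k" if "t \<le> h" "0 \<le> t" for t
      using aff1(1)[of t "\<lambda>s. dlap \<delta> (w\<^sub>1 s) k"] r1[OF in1[of t], of k] that h by simp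
    have eq2: "(LINT s:{h..t}|lborel. dlap \<delta> (w\<^sub>2 ((s - h) / l)) k / l) = \<rho>\<^sub>2 ((t - h) / l) k - \<rho>\<^sub>2 0 k" if "h \<le> t" "t \<le> 1"
      using aff2(1)[of t "\<lambda>s. dlap \<delta> (w\<^sub>2 s) k"] r2[OF in2[of t], of k] that l by simp
    have dw: "dlap \<delta> (w s) k = (if s \<le> h then dlap \<delta> (w\<^sub>1 (s / h)) k / h else dlap \<delta> (w\<^sub>2 ((s - h) / l)) k / l)" for s
      by (simp add: dlap_def w_def add_divide_distrib diff_divide_distrib mult.commute)
    have r0: "\<rho> 0 = \<rho>\<^sub>1 0" using h by (simp add: \<rho>_def)
    show "\<rho> t k = \<rho> 0 k + (LINT s:{0..t}|lborel. dlap \<delta> (w s) k)"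
    proof (cases "t \<le> h")
      case True
      have "(LINT s:{0..t}|lborel. dlap \<delta> (w s) k) = (LINT s:{0..t}|lborel. dlap \<delta> (w\<^sub>1 (s / h)) k / h)"
        unfolding set_lebesgue_integral_def using True
        by (intro Bochner_Integration.integral_cong) (auto simp: dw split: split_indicator)
      then show ?thesis using eq1[OF True] True t r0 by (simp add: \<rho>_def)
    next
      case False
      have s1: "set_integrable lborel {0..h} (\<lambda>s. dlap \<delta> (w\<^sub>1 (s / h)) k / h)"
        using aff1(2)[of h "\<lambda>s. dlap \<delta> (w\<^sub>1 s) k"] L1[of k] one by (intro set_integrable_divide) auto
      have "set_integrable lborel {0..(t - h) / l} (\<lambda>s. dlap \<delta> (w\<^sub>2 s) k)"
        by (rule set_integrable_subset[OF L2]) (use False in2[of t] t in auto)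
      then have s2: "set_integrable lborel {h..t} (\<lambda>s. dlap \<delta> (w\<^sub>2 ((s - h) / l)) k / l)"
        using aff2(2)[of t "\<lambda>s. dlap \<delta> (w\<^sub>2 s) k"] by (intro set_integrable_divide) auto
      have "(LINT s:{0..t}|lborel. dlap \<delta> (w s) k) = (\<rho>\<^sub>1 1 k - \<rho>\<^sub>1 0 k) + (\<rho>\<^sub>2 ((t - h) / l) k - \<rho>\<^sub>2 0 k)"
        unfolding dw using set_integral_if_le(2)[OF s1 s2] eq1[of h] eq2 h False t one by simp
      then show ?thesis using False r0 join by (simp add: \<rho>_def)
    qed
  qed
  from Dsq_le_action_curve[OF this \<open>\<delta> > 0\<close>]
  have "Dsq \<delta> (\<rho> 0) (\<rho> 1) \<le> ennreal (\<delta> * (LINT s:{0..1}|lborel. A s))" .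
  moreover have "(LINT s:{0..1}|lborel. A s) = (LINT s:{0..1}|lborel. A\<^sub>1 s) / h + (LINT s:{0..1}|lborel. A\<^sub>2 s) / l"
  proof -
    have "(LINT s:{0..h}|lborel. A\<^sub>1 (s / h)) = h * (LINT s:{0..1}|lborel. A\<^sub>1 s)"
      using aff1(1)[of h A\<^sub>1] one by simp
    moreover have "(LINT s:{h..1}|lborel. A\<^sub>2 ((s - h) / l)) = l * (LINT s:{0..1}|lborel. A\<^sub>2 s)"
      using aff2(1)[of 1 A\<^sub>2] one by simp
    ultimately show ?thesis
      unfolding A_def using set_integral_if_le(2)[OF sA1 sA2] h l by (simp add: power2_eq_square)
  qed
  moreover have "\<rho> 0 = \<rho>\<^sub>1 0" "\<rho> 1 = \<rho>\<^sub>2 1" using h one by (simp_all add: \<rho>_def)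
  ultimately show ?thesis by (simp add: l_def)
qed

section \<open>The interaction kernel\<close>

text \<open>\<open>K\<close>, \<open>C\<^sub>1\<close> and \<open>C\<^sub>2\<close> bound
  \<open>V\<close>, |U| and \<Delta>(V^2) / V; with the suprema inserted,
  \<open>2 * C\<^sub>1 + C\<^sub>2\<close> is \<Lambda>. The last bound is cleared of its
  denominator.\<close>

locale interaction =
  fixes \<delta> :: real and W :: "int \<Rightarrow> real" and K C\<^sub>1 C\<^sub>2 :: real
  assumes \<delta>: "\<delta> > 0"
    and W_even: "W (- k) = W k"
    and V_pos: "dlap \<delta> W k > 0"
    and V_le: "dlap \<delta> W k \<le> K"
    and U_le: "\<bar>dlap \<delta> (dlap \<delta> W) k\<bar> \<le> C\<^sub>1"
    and V_sq: "dlap \<delta> (\<lambda>j. (dlap \<delta> W j)\<^sup>2) k \<le> C\<^sub>2 * dlap \<delta> W k"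
begin

abbreviation "V \<equiv> dlap \<delta> W"
abbreviation "U \<equiv> dlap \<delta> V"

text \<open>The Laplacian of the potential of \<rho> (\<open>dlap_dconv_W\<close>), that is, the
  factor of \<rho> in the flux. Convolving with \<open>V\<close> in place of \<open>W\<close> keeps
  the kernel bounded.\<close>

definition mob :: "(int \<Rightarrow> real) \<Rightarrow> int \<Rightarrow> real" where
  "mob \<rho> = dconv \<delta> V \<rho>"

lemma V_abs: "\<bar>V k\<bar> \<le> K" using V_pos[of k] V_le[of k] by simp

lemma K_pos: "K > 0" using V_pos[of 0] V_le[of 0] by simp

lemma V_even: "V (- k) = V k" using W_even by (rule dlap_even)

lemma U_even: "U (- k) = U k" using V_even by (rule dlap_even)

lemma C\<^sub>1_nonneg: "C\<^sub>1 \<ge> 0" using U_le[of 0] by simp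

lemma V_neighbours: "(V (k + 1))\<^sup>2 + (V (k - 1))\<^sup>2 \<le> V k * (2 * V k + \<delta>\<^sup>2 * C\<^sub>2)"
proof -
  have "((V (k + 1))\<^sup>2 + (V (k - 1))\<^sup>2 - 2 * (V k)\<^sup>2) / \<delta>\<^sup>2 \<le> C\<^sub>2 * V k"
    using V_sq[of k] by (subst (asm) dlap_def)
  then show ?thesis using \<delta> by (simp add: field_simps power2_eq_square)
qed

text \<open>A negative bound would make \<open>V^2\<close> strictly concave along the integers. By
  evenness it decreases from 0 to 1, hence at least linearly from there on, and would become
  negative. The sign later allows \<open>\<theta> * C\<^sub>2\<close> to be replaced by
  \<open>C\<^sub>2\<close>.\<close>

lemma C\<^sub>2_nonneg: "C\<^sub>2 \<ge> 0"
proof (rule ccontr)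
  assume "\<not> C\<^sub>2 \<ge> 0"
  then have C2: "C\<^sub>2 < 0" by simp
  define d where "d n = (V (int n + 1))\<^sup>2 - (V (int n))\<^sup>2" for n
  have step: "(V (k + 1))\<^sup>2 - (V k)\<^sup>2 < (V k)\<^sup>2 - (V (k - 1))\<^sup>2" for k
  proof -
    have "V k * (\<delta>\<^sup>2 * C\<^sub>2) < 0" using V_pos[of k] C2 \<delta> by (simp add: mult_pos_neg)
    then show ?thesis using V_neighbours[of k] by (simp add: algebra_simps power2_eq_square)
  qed
  have d0: "d 0 < 0"
  proof -
    have "V (0 - 1) = V 1" using V_even[of 1] by simp
    then show ?thesis using step[of 0] by (simp add: d_def)
  qed
  have dn: "d n \<le> d 0" for n
  proof (induction n)
    case (Suc n)
    have "int (Suc n) - 1 = int n" "int (Suc n) = int n + 1" by auto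
    then show ?case using step[of "int (Suc n)"] Suc unfolding d_def by (simp add: add.commute)
  qed simp
  have lin: "(V (int n))\<^sup>2 \<le> (V 0)\<^sup>2 + real n * d 0" for n
  proof (induction n)
    case (Suc n)
    then show ?case using dn[of n] by (simp add: d_def algebra_simps)
  qed simp
  obtain n :: nat where n: "(V 0)\<^sup>2 < real n * (- d 0)" using reals_Archimedean3[of "- d 0"] d0 by auto
  show False using lin[of n] n zero_le_power2[of "V (int n)"] by linarith
qed

lemma mob_summable:
  assumes "\<rho> \<in> Pdelta \<delta>"
  shows "(\<lambda>l. V (k - l) * \<rho> l) summable_on UNIV"
  by (rule dconv_summand[OF PdeltaD(2)[OF assms \<delta>] V_abs])

lemma mob_pos:
  assumes "\<rho> \<in> Pdelta \<delta>"
  shows "mob \<rho> k > 0"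
proof -
  note r = PdeltaD[OF assms \<delta>]
  obtain l where l: "\<rho> l > 0"
  proof (rule ccontr)
    assume "\<not> thesis"
    then have "\<rho> l = 0" for l using r(1)[of l] that[of l] by force
    then show False using r(3) by simp
  qed
  have "0 < V (k - l) * \<rho> l" using V_pos l by simp
  also have "\<dots> \<le> (\<Sum>\<^sub>\<infinity>l. V (k - l) * \<rho> l)"
    by (rule le_infsum_nonneg[OF mob_summable[OF assms]]) (auto intro!: mult_nonneg_nonneg less_imp_le[OF V_pos] r(1))
  finally show ?thesis using \<delta> by (simp add: mob_def dconv_eq)
qed

lemma mob_le:
  assumes "\<rho> \<in> Pdelta \<delta>"
  shows "mob \<rho> k \<le> K" "\<bar>mob \<rho> k\<bar> \<le> K"
proof -
  note r = PdeltaD[OF assms \<delta>]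
  show "\<bar>mob \<rho> k\<bar> \<le> K"
    using abs_dconv_le[where f=V and k=k, OF r(2) V_abs less_imp_le[OF \<delta>]] r(1,3) by (simp add: mob_def)
  then show "mob \<rho> k \<le> K" by simp
qed

text \<open>Cauchy-Schwarz with the weight \<open>V (k - l)\<close> places the quotients
  \<open>V (k - l + i)^2 / V (k - l)\<close> against \<rho>, where the pointwise bound for
  \<open>V\<close> applies, and leaves \<open>mob \<rho> k\<close> as the other factor. Unit mass of
  \<rho> keeps the constant \<open>C\<^sub>2\<close> unchanged.\<close>

lemma mob_neighbours:
  assumes "\<rho> \<in> Pdelta \<delta>"
  shows "(mob \<rho> (k + 1))\<^sup>2 + (mob \<rho> (k - 1))\<^sup>2 \<le> mob \<rho> k * (2 * mob \<rho> k + \<delta>\<^sup>2 * C\<^sub>2)"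
proof -
  note r = PdeltaD[OF assms \<delta>]
  \<comment> \<open>A crude bound for summability; the sharp constant appears only when both
    neighbours are added.\<close>
  define R where "R = 2 * K + \<delta>\<^sup>2 * C\<^sub>2"
  have quot: "(V (j + i))\<^sup>2 / V j \<le> R" if "i = 1 \<or> i = -1" for i j
  proof -
    have "(V (j + 1))\<^sup>2 \<le> V j * (2 * V j + \<delta>\<^sup>2 * C\<^sub>2)" "(V (j - 1))\<^sup>2 \<le> V j * (2 * V j + \<delta>\<^sup>2 * C\<^sub>2)"
      using V_neighbours[of j] zero_le_power2[of "V (j + 1)"] zero_le_power2[of "V (j - 1)"] by linarith+
    then have "(V (j + i))\<^sup>2 \<le> V j * (2 * V j + \<delta>\<^sup>2 * C\<^sub>2)" using that by auto
    also have "\<dots> \<le> V j * R" using V_le[of j] V_pos[of j] by (auto simp: R_def)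
    finally show ?thesis using V_pos[of j] by (simp add: divide_le_eq mult.commute)
  qed
  define a where "a i l = (V (k - l + i))\<^sup>2 / V (k - l) * \<rho> l" for i l
  have as: "a i summable_on UNIV" if "i = 1 \<or> i = -1" for i
    unfolding a_def
  proof (rule summable_on_mult_bounded[OF r(2)])
    show "\<bar>(V (k - l + i))\<^sup>2 / V (k - l)\<bar> \<le> R" for l using quot[OF that, of "k - l"] V_pos[of "k - l"] by simp
  qed
  have CS: "(mob \<rho> (k + i))\<^sup>2 \<le> (\<delta> * infsum (a i) UNIV) * mob \<rho> k" if "i = 1 \<or> i = -1" for i
  proof -
    have "(\<Sum>\<^sub>\<infinity>l. \<bar>V (k + i - l) * \<rho> l\<bar>)\<^sup>2 \<le> infsum (a i) UNIV * (\<Sum>\<^sub>\<infinity>l. V (k - l) * \<rho> l)"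
    proof (rule infsum_Cauchy_Schwarz(2)[OF as[OF that] mob_summable[OF assms]])
      show "a i l \<ge> 0" for l using V_pos[of "k - l"] r(1)[of l] by (simp add: a_def)
      show "V (k - l) * \<rho> l \<ge> 0" for l using V_pos[of "k - l"] r(1)[of l] by simp
      show "(V (k + i - l) * \<rho> l)\<^sup>2 \<le> a i l * (V (k - l) * \<rho> l)" for l
      proof -
        have "k + i - l = k - l + i" by simp
        show ?thesis unfolding a_def \<open>k + i - l = k - l + i\<close> using V_pos[of "k - l"] by (simp add: power2_eq_square)
      qed
    qed
    moreover have "\<bar>V (k + i - l) * \<rho> l\<bar> = V (k + i - l) * \<rho> l" for l
      using V_pos[of "k + i - l"] r(1)[of l] by simp
    ultimately have "\<delta>\<^sup>2 * (\<Sum>\<^sub>\<infinity>l. V (k + i - l) * \<rho> l)\<^sup>2 \<le> \<delta>\<^sup>2 * (infsum (a i) UNIV * (\<Sum>\<^sub>\<infinity>l. V (k - l) * \<rho> l))"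
      by (intro mult_left_mono) auto
    then show ?thesis by (simp add: mob_def dconv_eq power_mult_distrib) (simp add: power2_eq_square algebra_simps)
  qed
  have "infsum (a 1) UNIV + infsum (a (-1)) UNIV = (\<Sum>\<^sub>\<infinity>l. a 1 l + a (-1) l)"
    by (rule infsum_add[symmetric]; rule as; simp)
  also have "\<dots> \<le> (\<Sum>\<^sub>\<infinity>l. 2 * (V (k - l) * \<rho> l) + \<delta>\<^sup>2 * C\<^sub>2 * \<rho> l)"
  proof (rule infsum_mono)
    show "(\<lambda>l. a 1 l + a (-1) l) summable_on UNIV" by (intro summable_on_add as) auto
    show "(\<lambda>l. 2 * (V (k - l) * \<rho> l) + \<delta>\<^sup>2 * C\<^sub>2 * \<rho> l) summable_on UNIV"
      by (intro summable_on_add summable_on_cmult_right mob_summable[OF assms] r)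
    fix l
    have "((V (k - l + 1))\<^sup>2 + (V (k - l - 1))\<^sup>2) / V (k - l) \<le> 2 * V (k - l) + \<delta>\<^sup>2 * C\<^sub>2"
      using V_neighbours[of "k - l"] V_pos[of "k - l"] by (simp add: divide_le_eq mult.commute)
    from mult_right_mono[OF this r(1)[of l]]
    show "a 1 l + a (-1) l \<le> 2 * (V (k - l) * \<rho> l) + \<delta>\<^sup>2 * C\<^sub>2 * \<rho> l"
      by (simp add: a_def add_divide_distrib algebra_simps)
  qed
  also have "\<dots> = 2 * (\<Sum>\<^sub>\<infinity>l. V (k - l) * \<rho> l) + \<delta>\<^sup>2 * C\<^sub>2 * infsum \<rho> UNIV"
    by (subst infsum_add) (auto simp only: infsum_cmult_right' intro!: summable_on_cmult_right mob_summable[OF assms] r)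
  finally have "\<delta> * (infsum (a 1) UNIV + infsum (a (-1)) UNIV) \<le> 2 * mob \<rho> k + \<delta>\<^sup>2 * C\<^sub>2"
    using \<delta> r(4) mult_left_mono[of _ _ \<delta>] by (fastforce simp: mob_def dconv_eq distrib_left algebra_simps)
  from mult_left_mono[OF this less_imp_le[OF mob_pos[OF assms, of k]]] CS[of 1] CS[of "-1"]
  show ?thesis by (simp add: algebra_simps)
qed

section \<open>Second moments, potentials and the energy\<close>

lemma one_plus_sq_summable:
  assumes "\<rho> \<in> Pdelta \<delta>"
  shows "(\<lambda>k. (1 + (real_of_int k)\<^sup>2) * \<rho> k) summable_on UNIV"
  using summable_on_add[OF PdeltaD(2,5)[OF assms \<delta>]] by (simp add: distrib_right)

text \<open>Quadratic growth of \<open>W\<close> meets the second moment of \<rho>. The explicit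
  growth in \<open>k\<close> is what makes the double sum in the energy absolutely
  convergent.\<close>

lemma W_conv:
  assumes "\<rho> \<in> Pdelta \<delta>"
  obtains M where "M \<ge> 0" "\<And>k. (\<lambda>l. W (k - l) * \<rho> l) summable_on UNIV"
    "\<And>k. (\<Sum>\<^sub>\<infinity>l. \<bar>W (k - l) * \<rho> l\<bar>) \<le> M * (1 + (real_of_int k)\<^sup>2)"
proof -
  note r = PdeltaD[OF assms \<delta>]
  obtain C where C: "C \<ge> 0" "\<And>k. \<bar>W k\<bar> \<le> C * (1 + (real_of_int k)\<^sup>2)"
     "\<And>k. \<bar>W (k + 1) - W k\<bar> \<le> C * (1 + \<bar>real_of_int k\<bar>)"
    by (rule second_difference_growth[OF _ V_abs]) (use \<delta> in auto)
  have le: "\<bar>W (k - l) * \<rho> l\<bar> \<le> (2 * C * (1 + (real_of_int k)\<^sup>2)) * ((1 + (real_of_int l)\<^sup>2) * \<rho> l)" for k l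
  proof -
    \<comment> \<open>Separates the variables through
      \<open>(k - l)^2 \<le> 2 k^2 + 2 l^2\<close>.\<close>
    have "1 + (real_of_int (k - l))\<^sup>2 \<le> 2 * (1 + (real_of_int k)\<^sup>2) * (1 + (real_of_int l)\<^sup>2)"
      using zero_le_power2[of "real_of_int k + real_of_int l"] zero_le_power2[of "real_of_int k * real_of_int l"]
      by (simp add: power2_eq_square algebra_simps)
    then have "\<bar>W (k - l)\<bar> \<le> C * (2 * (1 + (real_of_int k)\<^sup>2) * (1 + (real_of_int l)\<^sup>2))"
      using C(2)[of "k - l"] mult_left_mono[OF _ C(1)] order.trans by blast
    from mult_right_mono[OF this r(1)[of l]] show ?thesis
      using r(1)[of l] by (simp add: abs_mult algebra_simps)
  qed
  define m where "m = (\<Sum>\<^sub>\<infinity>l. (1 + (real_of_int l)\<^sup>2) * \<rho> l)"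
  have m: "m \<ge> 0" unfolding m_def using r(1) by (intro infsum_nonneg) auto
  note sq = one_plus_sq_summable[OF assms]
  have s: "(\<lambda>l. W (k - l) * \<rho> l) summable_on UNIV" for k
    by (rule summable_on_bounded_by[OF summable_on_cmult_right[OF sq] le])
  have "(\<Sum>\<^sub>\<infinity>l. \<bar>W (k - l) * \<rho> l\<bar>) \<le> 2 * C * m * (1 + (real_of_int k)\<^sup>2)" for k
  proof -
    have "(\<Sum>\<^sub>\<infinity>l. \<bar>W (k - l) * \<rho> l\<bar>) \<le> (\<Sum>\<^sub>\<infinity>l. (2 * C * (1 + (real_of_int k)\<^sup>2)) * ((1 + (real_of_int l)\<^sup>2) * \<rho> l))"
      by (rule infsum_mono[OF summable_on_abs_real[OF s] summable_on_cmult_right[OF sq] le])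
    then show ?thesis unfolding infsum_cmult_right' m_def[symmetric] by (simp add: algebra_simps)
  qed
  then show thesis using s C(1) m by (intro that[of "2 * C * m"]) auto
qed

lemma dlap_dconv_W:
  assumes "\<rho> \<in> Pdelta \<delta>"
  shows "dlap \<delta> (dconv \<delta> W \<rho>) k = mob \<rho> k"
proof -
  obtain M where "\<And>k. (\<lambda>l. W (k - l) * \<rho> l) summable_on UNIV" using W_conv[OF assms] by metis
  then show ?thesis unfolding mob_def by (rule dlap_dconv)
qed

text \<open>The energy is a symmetric quadratic form, so its increment pairs
  \<open>\<eta> - \<rho> = \<Delta>z\<close> with the potential of \<open>\<eta> + \<rho>\<close>.
  Moving the Laplacian needs \<open>infsum_mult_dlap\<close>, since the potential may grow
  quadratically while \<open>z\<close> is only summable.\<close>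

lemma energy_diff:
  assumes \<rho>: "\<rho> \<in> Pdelta \<delta>" and \<eta>: "\<eta> \<in> Pdelta \<delta>" and z: "z summable_on UNIV"
    and eq: "\<And>k. \<eta> k = \<rho> k + dlap \<delta> z k"
  shows "energy \<delta> W \<eta> - energy \<delta> W \<rho> = - (\<delta> / 2) * (\<Sum>\<^sub>\<infinity>k. z k * (mob \<rho> k + mob \<eta> k))"
proof -
  note r = PdeltaD[OF \<rho> \<delta>] and e = PdeltaD[OF \<eta> \<delta>]
  have summ: "(\<lambda>k. \<sigma> k * dconv \<delta> W \<tau> k) summable_on UNIV" and
     symm: "(\<Sum>\<^sub>\<infinity>k. \<sigma> k * dconv \<delta> W \<tau> k) = (\<Sum>\<^sub>\<infinity>k. \<tau> k * dconv \<delta> W \<sigma> k)"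
    if \<sigma>: "\<sigma> \<in> Pdelta \<delta>" and \<tau>: "\<tau> \<in> Pdelta \<delta>" for \<sigma> \<tau>
  proof -
    obtain M where M: "M \<ge> 0" "\<And>k. (\<lambda>l. W (k - l) * \<tau> l) summable_on UNIV"
      "\<And>k. (\<Sum>\<^sub>\<infinity>l. \<bar>W (k - l) * \<tau> l\<bar>) \<le> M * (1 + (real_of_int k)\<^sup>2)"
      by (rule W_conv[OF \<tau>]) (rule that)
    have B: "(\<lambda>k. M * ((1 + (real_of_int k)\<^sup>2) * \<sigma> k)) summable_on UNIV"
      by (intro summable_on_cmult_right one_plus_sq_summable \<sigma>)
    have le: "\<bar>\<sigma> k\<bar> * (\<Sum>\<^sub>\<infinity>l. \<bar>W (k - l) * \<tau> l\<bar>) \<le> M * ((1 + (real_of_int k)\<^sup>2) * \<sigma> k)" for k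
      using mult_left_mono[OF M(3)[of k] PdeltaD(1)[OF \<sigma> \<delta>, of k]] PdeltaD(1)[OF \<sigma> \<delta>, of k]
      by (simp add: algebra_simps)
    show "(\<Sum>\<^sub>\<infinity>k. \<sigma> k * dconv \<delta> W \<tau> k) = (\<Sum>\<^sub>\<infinity>k. \<tau> k * dconv \<delta> W \<sigma> k)"
      by (rule infsum_mult_dconv_sym[OF W_even M(2) B le])
    show "(\<lambda>k. \<sigma> k * dconv \<delta> W \<tau> k) summable_on UNIV"
    proof (rule summable_on_bounded_by[OF summable_on_cmult_right[OF B, of \<delta>]])
      fix k
      have "\<bar>\<Sum>\<^sub>\<infinity>l. W (k - l) * \<tau> l\<bar> \<le> (\<Sum>\<^sub>\<infinity>l. \<bar>W (k - l) * \<tau> l\<bar>)"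
        by (rule abs_infsum_le_real[OF summable_on_abs_real[OF M(2)]]) simp
      from mult_left_mono[OF this abs_ge_zero[of "\<sigma> k"]] le[of k]
      have "\<bar>\<sigma> k\<bar> * \<bar>\<Sum>\<^sub>\<infinity>l. W (k - l) * \<tau> l\<bar> \<le> M * ((1 + (real_of_int k)\<^sup>2) * \<sigma> k)" by linarith
      from mult_left_mono[OF this less_imp_le[OF \<delta>]]
      show "\<bar>\<sigma> k * dconv \<delta> W \<tau> k\<bar> \<le> \<delta> * (M * ((1 + (real_of_int k)\<^sup>2) * \<sigma> k))"
        using \<delta> by (simp add: dconv_eq abs_mult algebra_simps)
    qed
  qed
  define \<phi> where "\<phi> k = dconv \<delta> W \<eta> k + dconv \<delta> W \<rho> k" for k
  have lap: "dlap \<delta> \<phi> k = mob \<rho> k + mob \<eta> k" for k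
    using dlap_dconv_W[OF \<rho>, of k] dlap_dconv_W[OF \<eta>, of k]
    by (simp add: \<phi>_def dlap_def add_divide_distrib diff_divide_distrib)
  have "(\<Sum>\<^sub>\<infinity>k. \<eta> k * dconv \<delta> W \<eta> k) - (\<Sum>\<^sub>\<infinity>k. \<rho> k * dconv \<delta> W \<rho> k)
     = ((\<Sum>\<^sub>\<infinity>k. \<eta> k * dconv \<delta> W \<eta> k) + (\<Sum>\<^sub>\<infinity>k. \<eta> k * dconv \<delta> W \<rho> k))
        - ((\<Sum>\<^sub>\<infinity>k. \<rho> k * dconv \<delta> W \<eta> k) + (\<Sum>\<^sub>\<infinity>k. \<rho> k * dconv \<delta> W \<rho> k))"
    by (simp add: symm[OF \<rho> \<eta>])
  also have "\<dots> = (\<Sum>\<^sub>\<infinity>k. (\<eta> k * dconv \<delta> W \<eta> k + \<eta> k * dconv \<delta> W \<rho> k) - (\<rho> k * dconv \<delta> W \<eta> k + \<rho> k * dconv \<delta> W \<rho> k))"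
    by (simp add: infsum_diff_real infsum_add summable_on_add summ \<rho> \<eta>)
  also have "\<dots> = (\<Sum>\<^sub>\<infinity>k. \<phi> k * dlap \<delta> z k)"
    by (intro infsum_cong) (simp add: \<phi>_def eq algebra_simps)
  also have "\<dots> = (\<Sum>\<^sub>\<infinity>k. dlap \<delta> \<phi> k * z k)"
  proof (rule infsum_mult_dlap[where K="2 * K"])
    show "\<bar>dlap \<delta> \<phi> k\<bar> \<le> 2 * K" for k
      unfolding lap using mob_le(2)[OF \<rho>, of k] mob_le(2)[OF \<eta>, of k] by linarith
    have "(\<lambda>k. (1 + (real_of_int k)\<^sup>2) * \<eta> k - (1 + (real_of_int k)\<^sup>2) * \<rho> k) summable_on UNIV"
      by (intro summable_on_diff_real one_plus_sq_summable \<rho> \<eta>)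
    then show "(\<lambda>k. (1 + (real_of_int k)\<^sup>2) * dlap \<delta> z k) summable_on UNIV"
      by (simp add: eq algebra_simps)
  qed (use \<delta> z in auto)
  finally have "(\<Sum>\<^sub>\<infinity>k. \<eta> k * dconv \<delta> W \<eta> k) - (\<Sum>\<^sub>\<infinity>k. \<rho> k * dconv \<delta> W \<rho> k) = (\<Sum>\<^sub>\<infinity>k. z k * (mob \<rho> k + mob \<eta> k))"
    by (simp add: lap mult.commute)
  then show ?thesis unfolding energy_def by (metis (no_types, lifting) right_diff_distrib)
qed

end

section \<open>The Euler perturbation of a curve\<close>

text \<open>Subadditivity of p^2 / r with denominators cleared, so that zero denominators are
  allowed. The cross term follows from \<open>4 x y \<le> (x + y)^2\<close> with
  \<open>x = q\<^sub>1 * r\<^sub>2\<close> and \<open>y = q\<^sub>2 * r\<^sub>1\<close>.\<close>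

lemma perspective_subadditive:
  fixes x\<^sub>1 x\<^sub>2 q\<^sub>1 q\<^sub>2 r\<^sub>1 r\<^sub>2 :: real
  assumes "x\<^sub>1\<^sup>2 \<le> q\<^sub>1 * r\<^sub>1" "x\<^sub>2\<^sup>2 \<le> q\<^sub>2 * r\<^sub>2" "q\<^sub>1 \<ge> 0" "q\<^sub>2 \<ge> 0" "r\<^sub>1 \<ge> 0" "r\<^sub>2 \<ge> 0"
  shows "(x\<^sub>1 + x\<^sub>2)\<^sup>2 \<le> (q\<^sub>1 + q\<^sub>2) * (r\<^sub>1 + r\<^sub>2)"
proof -
  have "2 * (x\<^sub>1 * x\<^sub>2) \<le> q\<^sub>1 * r\<^sub>2 + q\<^sub>2 * r\<^sub>1"
  proof (rule power2_le_imp_le)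
    have "(2 * (x\<^sub>1 * x\<^sub>2))\<^sup>2 = 4 * (x\<^sub>1\<^sup>2 * x\<^sub>2\<^sup>2)" by (simp add: power_mult_distrib)
    also have "\<dots> \<le> 4 * ((q\<^sub>1 * r\<^sub>1) * (q\<^sub>2 * r\<^sub>2))" using assms by (intro mult_left_mono mult_mono) auto
    also have "\<dots> \<le> (q\<^sub>1 * r\<^sub>2 + q\<^sub>2 * r\<^sub>1)\<^sup>2"
      using zero_le_power2[of "q\<^sub>1 * r\<^sub>2 - q\<^sub>2 * r\<^sub>1"] by (simp add: power2_eq_square algebra_simps)
    finally show "(2 * (x\<^sub>1 * x\<^sub>2))\<^sup>2 \<le> (q\<^sub>1 * r\<^sub>2 + q\<^sub>2 * r\<^sub>1)\<^sup>2" .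
  qed (use assms in auto)
  then show ?thesis using assms by (simp add: power2_sum algebra_simps)
qed

context interaction
begin

text \<open>A step size restriction: at least half of the mass at a site stays there during an Euler
  step. It yields nonnegativity of the new density and later the bound
  \<open>1 / \<alpha> \<le> 2\<close>.\<close>

lemma euler_factor_bounds:
  assumes "\<rho> \<in> Pdelta \<delta>" "0 \<le> t" "4 * t * K \<le> \<delta>\<^sup>2" "0 \<le> \<theta>" "\<theta> \<le> 1"
  shows "1 / 2 \<le> 1 - 2 * t * \<theta> * mob \<rho> k / \<delta>\<^sup>2"
proof -
  have "t * (\<theta> * mob \<rho> k) \<le> t * (1 * K)"
    using assms mob_le(1)[OF assms(1), of k] mob_pos[OF assms(1), of k]
    by (intro mult_left_mono mult_mono) (auto simp: less_imp_le)
  then have "4 * (t * (\<theta> * mob \<rho> k)) \<le> \<delta>\<^sup>2" using assms(3) by linarith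
  then have "2 * t * \<theta> * mob \<rho> k / \<delta>\<^sup>2 \<le> 1 / 2" using \<delta> by (simp add: field_simps)
  then show ?thesis by linarith
qed

lemma euler_density:
  "\<rho> k + t * \<theta> * dlap \<delta> (\<lambda>j. \<rho> j * mob \<rho> j) k
   = (1 - 2 * t * \<theta> * mob \<rho> k / \<delta>\<^sup>2) * \<rho> k
     + (t * \<theta> / \<delta>\<^sup>2) * (\<rho> (k + 1) * mob \<rho> (k + 1)) + (t * \<theta> / \<delta>\<^sup>2) * (\<rho> (k - 1) * mob \<rho> (k - 1))"
  using \<delta> by (simp add: dlap_def field_simps)

lemma euler_Pdelta:
  assumes "\<rho> \<in> Pdelta \<delta>" "0 \<le> t" "4 * t * K \<le> \<delta>\<^sup>2" "0 \<le> \<theta>" "\<theta> \<le> 1"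
  shows "(\<lambda>k. \<rho> k + t * \<theta> * dlap \<delta> (\<lambda>j. \<rho> j * mob \<rho> j) k) \<in> Pdelta \<delta>"
proof -
  note r = PdeltaD[OF assms(1) \<delta>]
  define g where "g j = t * \<theta> * (\<rho> j * mob \<rho> j)" for j
  have lap: "t * \<theta> * dlap \<delta> (\<lambda>j. \<rho> j * mob \<rho> j) k = dlap \<delta> g k" for k
    by (simp add: g_def dlap_def algebra_simps add_divide_distrib diff_divide_distrib)
  have "(\<lambda>k. \<rho> k + dlap \<delta> g k) \<in> Pdelta \<delta>"
  proof (rule Pdelta_add_dlap[OF assms(1) \<delta>])
    show "\<bar>g k\<bar> \<le> (t * \<theta> * K) * \<rho> k" for k
    proof -
      have "(t * \<theta> * \<rho> k) * \<bar>mob \<rho> k\<bar> \<le> (t * \<theta> * \<rho> k) * K"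
        using assms r(1)[of k] mob_le(2)[OF assms(1), of k] by (intro mult_left_mono) auto
      then show ?thesis using assms r(1)[of k] by (simp add: g_def abs_mult algebra_simps)
    qed
    show "0 \<le> \<rho> k + dlap \<delta> g k" for k
      unfolding lap[symmetric] euler_density
      using euler_factor_bounds[OF assms, of k] r(1) mob_pos[OF assms(1)] assms
      by (intro add_nonneg_nonneg mult_nonneg_nonneg divide_nonneg_nonneg) (auto simp: less_imp_le)
  qed
  then show ?thesis by (simp add: lap)
qed

text \<open>The perturbed density splits into the mass that stays at \<open>k\<close> and the masses arriving from the two
  neighbours; splitting the perturbed momentum accordingly and using subadditivity of \<open>(p, r) \<mapsto> p\<^sup>2 / r\<close>
  avoids any Taylor expansion, which would break down where \<open>\<rho>\<close> vanishes.\<close>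
lemma euler_action:
  assumes P: "\<rho> \<in> Pdelta \<delta>" and t: "0 \<le> t" "4 * t * K \<le> \<delta>\<^sup>2" and \<theta>: "0 \<le> \<theta>" "\<theta> \<le> 1"
    and a: "a summable_on UNIV" "\<And>k. 0 \<le> a k" and w: "\<And>k. (w k)\<^sup>2 \<le> a k * \<rho> k"
  shows "\<exists>a'. a' summable_on UNIV
    \<and> infsum a' UNIV \<le> (1 + t * (2 * C\<^sub>1 + C\<^sub>2)) * infsum a UNIV - 2 * t * (\<Sum>\<^sub>\<infinity>k. w k * mob \<rho> k)
        + t\<^sup>2 * (4 * K\<^sup>2 / \<delta> + 4 * C\<^sub>1\<^sup>2 * infsum a UNIV)
    \<and> (\<forall>k. 0 \<le> a' k \<and>
        (w k + t * (\<theta> * (dlap \<delta> w k * mob \<rho> k + \<rho> k * dconv \<delta> U w k) - \<rho> k * mob \<rho> k))\<^sup>2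
         \<le> a' k * (\<rho> k + t * \<theta> * dlap \<delta> (\<lambda>j. \<rho> j * mob \<rho> j) k))"
proof -
  note r = PdeltaD[OF P \<delta>]
  define b where "b = mob \<rho>"
  define c where "c = dconv \<delta> U w"
  define A where "A = infsum a UNIV"
  have A0: "A \<ge> 0" unfolding A_def by (intro infsum_nonneg a)
  have b: "0 < b k" "b k \<le> K" "\<bar>b k\<bar> \<le> K" for k
    unfolding b_def using mob_pos[OF P] mob_le[OF P] by auto
  have ws: "w summable_on UNIV" and CS: "(\<Sum>\<^sub>\<infinity>k. \<bar>w k\<bar>)\<^sup>2 \<le> A * (1 / \<delta>)"
    using infsum_Cauchy_Schwarz[OF a(1) r(2) a(2) r(1) w] r(4) by (auto simp: A_def)
  define N where "N = (\<Sum>\<^sub>\<infinity>k. \<bar>w k\<bar>)"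
  have N0: "N \<ge> 0" unfolding N_def by (intro infsum_nonneg) auto
  have N2: "\<delta> * N\<^sup>2 \<le> A" using CS \<delta> by (simp add: N_def field_simps)
  have c: "\<bar>c k\<bar> \<le> C\<^sub>1 * (\<delta> * N)" for k
    unfolding c_def N_def by (rule abs_dconv_le[OF ws U_le]) (use \<delta> in auto)
  \<comment> \<open>The part of the perturbation proportional to the density at \<open>k\<close> is
    \<open>t * \<rho> k * m k\<close>; the rest is linear in \<open>w\<close> at \<open>k\<close>
    and its neighbours.\<close>
  define m where "m k = \<theta> * c k - b k" for k
  have m2: "(m k)\<^sup>2 \<le> 2 * K\<^sup>2 + 2 * C\<^sub>1\<^sup>2 * (\<delta> * A)" for k
  proof -
    have "(m k)\<^sup>2 \<le> 2 * (\<theta> * c k)\<^sup>2 + 2 * (b k)\<^sup>2"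
      using zero_le_power2[of "\<theta> * c k + b k"] by (simp add: m_def power2_sum power2_diff)
    moreover have "(b k)\<^sup>2 \<le> K\<^sup>2" using b[of k] by (intro power_mono) auto
    moreover have "(\<theta> * c k)\<^sup>2 \<le> C\<^sub>1\<^sup>2 * (\<delta> * A)"
    proof -
      have "\<bar>\<theta> * c k\<bar> \<le> 1 * (C\<^sub>1 * (\<delta> * N))" unfolding abs_mult using \<theta> c[of k] by (intro mult_mono) auto
      then have "(\<theta> * c k)\<^sup>2 \<le> (C\<^sub>1 * (\<delta> * N))\<^sup>2"
        using C\<^sub>1_nonneg \<delta> N0 by (subst abs_le_square_iff[symmetric]) (simp add: abs_mult)
      also have "\<dots> = (C\<^sub>1\<^sup>2 * \<delta>) * (\<delta> * N\<^sup>2)" by (simp add: power2_eq_square)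
      also have "\<dots> \<le> (C\<^sub>1\<^sup>2 * \<delta>) * A" using N2 \<delta> by (intro mult_left_mono) auto
      finally show ?thesis by simp
    qed
    ultimately show ?thesis by linarith
  qed
  define \<alpha> where "\<alpha> k = 1 - 2 * t * \<theta> * b k / \<delta>\<^sup>2" for k
  have \<alpha>: "1 / 2 \<le> \<alpha> k" "\<alpha> k \<le> 1" for k
  proof -
    show "1 / 2 \<le> \<alpha> k" unfolding \<alpha>_def b_def by (rule euler_factor_bounds[OF P t \<theta>])
    show "\<alpha> k \<le> 1" unfolding \<alpha>_def using t \<theta> b[of k] by (simp add: mult_nonneg_nonneg)
  qed
  have \<alpha>0: "0 < \<alpha> k" for k using \<alpha>(1)[of k] by linarith
  define \<epsilon> where "\<epsilon> = t * \<theta> / \<delta>\<^sup>2"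
  have \<epsilon>: "\<epsilon> \<ge> 0" using t \<theta> by (simp add: \<epsilon>_def)
  \<comment> \<open>This is \<open>(\<alpha> w + t \<rho> m)^2 / (\<alpha> \<rho>)\<close> expanded
    exactly, with \<open>w^2 / \<rho>\<close> replaced by \<open>a\<close>.\<close>
  define q where "q k = \<alpha> k * a k + 2 * t * (w k * m k) + t\<^sup>2 * (\<rho> k * ((m k)\<^sup>2 / \<alpha> k))" for k
  \<comment> \<open>The momentum \<open>\<epsilon> * b k * w (k + i)\<close> is charged to the mass
    \<open>\<epsilon> * \<rho> (k + i) * b (k + i)\<close> arriving from \<open>k + i\<close>; the
    cost is \<epsilon> times \<open>p\<close>, again with \<open>a\<close> for
    \<open>w^2 / \<rho>\<close>.\<close>
  define p where "p i k = (b k)\<^sup>2 / b (k + i) * a (k + i)" for i k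
  define a' where "a' k = q k + \<epsilon> * p 1 k + \<epsilon> * p (-1) k" for k
  have q1: "(\<alpha> k * w k + t * \<rho> k * m k)\<^sup>2 \<le> q k * (\<alpha> k * \<rho> k)" for k
  proof -
    have "q k * (\<alpha> k * \<rho> k) = (\<alpha> k)\<^sup>2 * (a k * \<rho> k) + 2 * (\<alpha> k * w k) * (t * \<rho> k * m k) + (t * \<rho> k * m k)\<^sup>2"
      using \<alpha>0[of k] by (simp add: q_def power2_eq_square field_simps)
    moreover have "(\<alpha> k)\<^sup>2 * (w k)\<^sup>2 \<le> (\<alpha> k)\<^sup>2 * (a k * \<rho> k)" using w[of k] by (intro mult_left_mono) auto
    ultimately show ?thesis by (simp add: power2_sum power_mult_distrib)
  qed
  have q0: "0 \<le> q k" for k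
  proof (cases "\<rho> k = 0")
    case True
    then have "w k = 0" using w[of k] by simp
    then show ?thesis using True a(2)[of k] \<alpha>0[of k] by (simp add: q_def)
  next
    case False
    then have "0 < \<alpha> k * \<rho> k" using r(1)[of k] \<alpha>0[of k] by simp
    then show ?thesis using order.trans[OF zero_le_power2 q1[of k]] by (simp add: zero_le_mult_iff)
  qed
  have p0: "0 \<le> p i k" for i k using a(2) b(1) by (simp add: p_def less_imp_le)
  have pi: "(\<epsilon> * (b k * w (k + i)))\<^sup>2 \<le> (\<epsilon> * p i k) * (\<epsilon> * (\<rho> (k + i) * b (k + i)))" for i k
  proof -
    have "(\<epsilon> * p i k) * (\<epsilon> * (\<rho> (k + i) * b (k + i))) = (\<epsilon> * b k)\<^sup>2 * (a (k + i) * \<rho> (k + i))"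
      using b(1)[of "k + i"] by (simp add: p_def power2_eq_square)
    moreover have "(\<epsilon> * b k)\<^sup>2 * (w (k + i))\<^sup>2 \<le> (\<epsilon> * b k)\<^sup>2 * (a (k + i) * \<rho> (k + i))"
      using w[of "k + i"] by (intro mult_left_mono) auto
    moreover have "(\<epsilon> * (b k * w (k + i)))\<^sup>2 = (\<epsilon> * b k)\<^sup>2 * (w (k + i))\<^sup>2" by (simp add: power2_eq_square)
    ultimately show ?thesis by (simp only:)
  qed
  have main: "(w k + t * (\<theta> * (dlap \<delta> w k * b k + \<rho> k * c k) - \<rho> k * b k))\<^sup>2
       \<le> a' k * (\<rho> k + t * \<theta> * dlap \<delta> (\<lambda>j. \<rho> j * b j) k)" for k
  proof -
    have "w k + t * (\<theta> * (dlap \<delta> w k * b k + \<rho> k * c k) - \<rho> k * b k)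
        = (\<alpha> k * w k + t * \<rho> k * m k) + \<epsilon> * (b k * w (k + 1)) + \<epsilon> * (b k * w (k + - 1))"
      using \<delta> by (simp add: dlap_def \<alpha>_def m_def \<epsilon>_def field_simps)
    moreover have "\<rho> k + t * \<theta> * dlap \<delta> (\<lambda>j. \<rho> j * b j) k
        = \<alpha> k * \<rho> k + \<epsilon> * (\<rho> (k + 1) * b (k + 1)) + \<epsilon> * (\<rho> (k + - 1) * b (k + - 1))"
      using euler_density[of \<rho> k t \<theta>] by (simp add: b_def \<alpha>_def \<epsilon>_def)
    moreover have "(\<alpha> k * w k + t * \<rho> k * m k + \<epsilon> * (b k * w (k + 1)) + \<epsilon> * (b k * w (k + - 1)))\<^sup>2
       \<le> (q k + \<epsilon> * p 1 k + \<epsilon> * p (-1) k)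
          * (\<alpha> k * \<rho> k + \<epsilon> * (\<rho> (k + 1) * b (k + 1)) + \<epsilon> * (\<rho> (k + - 1) * b (k + - 1)))"
      by (intro perspective_subadditive q1 pi add_nonneg_nonneg mult_nonneg_nonneg q0 p0 \<epsilon> r(1)
          less_imp_le[OF b(1)] less_imp_le[OF \<alpha>0])
    ultimately show ?thesis unfolding a'_def by simp
  qed
  have a'0: "0 \<le> a' k" for k unfolding a'_def by (intro add_nonneg_nonneg mult_nonneg_nonneg q0 p0 \<epsilon>)
  have sa: "(\<lambda>k. \<alpha> k * a k) summable_on UNIV"
    by (rule summable_on_mult_bounded[OF a(1), where M=1]) (use \<alpha> \<alpha>0 in \<open>auto simp: less_imp_le\<close>)
  have swb: "(\<lambda>k. w k * b k) summable_on UNIV"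
    using summable_on_mult_bounded[where f=b, OF ws b(3)] by (simp add: mult.commute)
  have swc: "(\<lambda>k. w k * c k) summable_on UNIV"
    using summable_on_mult_bounded[where f=c, OF ws c] by (simp add: mult.commute)
  have swm: "(\<lambda>k. w k * m k) summable_on UNIV"
    using summable_on_diff_real[OF summable_on_cmult_right[OF swc, of \<theta>] swb] by (simp add: m_def algebra_simps)
  \<comment> \<open>The leading 2 bounds \<open>1 / \<alpha>\<close>. Summed against \<rho>, of sum
    \<open>1 / \<delta>\<close>, this produces the coefficient of \<open>t\<^sup>2\<close>.\<close>
  define M where "M = 2 * (2 * K\<^sup>2 + 2 * C\<^sub>1\<^sup>2 * (\<delta> * A))"
  have mM: "0 \<le> (m k)\<^sup>2 / \<alpha> k" "(m k)\<^sup>2 / \<alpha> k \<le> M" for k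
  proof -
    show "0 \<le> (m k)\<^sup>2 / \<alpha> k" using \<alpha>0[of k] by (simp add: less_imp_le)
    have "(m k)\<^sup>2 / \<alpha> k \<le> (m k)\<^sup>2 / (1 / 2)" using \<alpha>(1)[of k] by (intro frac_le) auto
    then show "(m k)\<^sup>2 / \<alpha> k \<le> M" using m2[of k] by (simp add: M_def)
  qed
  have srm: "(\<lambda>k. \<rho> k * ((m k)\<^sup>2 / \<alpha> k)) summable_on UNIV"
    by (subst mult.commute, rule summable_on_mult_bounded[OF r(2), where M=M]) (use mM in \<open>simp only: abs_of_nonneg\<close>)
  define R where "R = 2 * K + \<delta>\<^sup>2 * C\<^sub>2"
  have nb: "(b (k + 1))\<^sup>2 + (b (k - 1))\<^sup>2 \<le> b k * (2 * b k + \<delta>\<^sup>2 * C\<^sub>2)" for k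
    unfolding b_def by (rule mob_neighbours[OF P])
  have quot: "(b (k + 1))\<^sup>2 / b k + (b (k - 1))\<^sup>2 / b k \<le> 2 * b k + \<delta>\<^sup>2 * C\<^sub>2" for k
    using nb[of k] b(1)[of k] by (simp add: add_divide_distrib[symmetric] divide_le_eq mult.commute)
  have quotR: "\<bar>(b (k + 1))\<^sup>2 / b k\<bar> \<le> R" "\<bar>(b (k - 1))\<^sup>2 / b k\<bar> \<le> R" for k
  proof -
    have "0 \<le> (b (k + 1))\<^sup>2 / b k" "0 \<le> (b (k - 1))\<^sup>2 / b k" using b(1)[of k] by (simp_all add: less_imp_le)
    then show "\<bar>(b (k + 1))\<^sup>2 / b k\<bar> \<le> R" "\<bar>(b (k - 1))\<^sup>2 / b k\<bar> \<le> R"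
      using quot[of k] b(2)[of k] unfolding R_def by linarith+
  qed
  have sp1: "(\<lambda>k. (b (k - 1))\<^sup>2 / b k * a k) summable_on UNIV" and sp2: "(\<lambda>k. (b (k + 1))\<^sup>2 / b k * a k) summable_on UNIV"
    by (rule summable_on_mult_bounded[OF a(1) quotR(2)], rule summable_on_mult_bounded[OF a(1) quotR(1)])
  \<comment> \<open>Reindexing collects the charges by their source: \<open>a k\<close> now carries
    the squared mobilities of both neighbours divided by its own, the quantity bounded in
    \<open>mob_neighbours\<close>.\<close>
  have p1: "p 1 summable_on UNIV" "infsum (p 1) UNIV = (\<Sum>\<^sub>\<infinity>k. (b (k - 1))\<^sup>2 / b k * a k)"
    using summable_on_shift_int(1)[of "\<lambda>k. (b (k - 1))\<^sup>2 / b k * a k" 1] sp1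
      infsum_shift_int(1)[of "\<lambda>k. (b (k - 1))\<^sup>2 / b k * a k" 1] by (simp_all add: p_def[abs_def])
  have p2: "p (-1) summable_on UNIV" "infsum (p (-1)) UNIV = (\<Sum>\<^sub>\<infinity>k. (b (k + 1))\<^sup>2 / b k * a k)"
    using summable_on_shift_int(2)[of "\<lambda>k. (b (k + 1))\<^sup>2 / b k * a k" 1] sp2
      infsum_shift_int(2)[of "\<lambda>k. (b (k + 1))\<^sup>2 / b k * a k" 1] by (simp_all add: p_def[abs_def])
  have sq: "q summable_on UNIV"
    unfolding q_def by (intro summable_on_add summable_on_cmult_right sa swm srm)
  have sa': "a' summable_on UNIV"
    unfolding a'_def by (intro summable_on_add summable_on_cmult_right sq p1 p2)
  have "infsum a' UNIV = infsum q UNIV + \<epsilon> * infsum (p 1) UNIV + \<epsilon> * infsum (p (-1)) UNIV"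
    unfolding a'_def by (simp add: infsum_add summable_on_add summable_on_cmult_right sq p1(1) p2(1) infsum_cmult_right')
  also have "infsum q UNIV = (\<Sum>\<^sub>\<infinity>k. \<alpha> k * a k) + 2 * t * (\<Sum>\<^sub>\<infinity>k. w k * m k) + t\<^sup>2 * (\<Sum>\<^sub>\<infinity>k. \<rho> k * ((m k)\<^sup>2 / \<alpha> k))"
    unfolding q_def by (simp only: infsum_add summable_on_add summable_on_cmult_right sa swm srm infsum_cmult_right')
  finally have tot: "infsum a' UNIV = ((\<Sum>\<^sub>\<infinity>k. \<alpha> k * a k) + \<epsilon> * infsum (p 1) UNIV + \<epsilon> * infsum (p (-1)) UNIV)
       + 2 * t * (\<Sum>\<^sub>\<infinity>k. w k * m k) + t\<^sup>2 * (\<Sum>\<^sub>\<infinity>k. \<rho> k * ((m k)\<^sup>2 / \<alpha> k))" by simp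
  have "(\<Sum>\<^sub>\<infinity>k. \<alpha> k * a k) + \<epsilon> * infsum (p 1) UNIV + \<epsilon> * infsum (p (-1)) UNIV
      = (\<Sum>\<^sub>\<infinity>k. \<alpha> k * a k + \<epsilon> * ((b (k - 1))\<^sup>2 / b k * a k) + \<epsilon> * ((b (k + 1))\<^sup>2 / b k * a k))"
    unfolding p1(2) p2(2)
    by (simp only: infsum_add summable_on_add summable_on_cmult_right sa sp1 sp2 infsum_cmult_right')
  also have "\<dots> \<le> (\<Sum>\<^sub>\<infinity>k. (1 + t * C\<^sub>2) * a k)"
  proof (rule infsum_mono)
    fix k
    \<comment> \<open>The outgoing fraction \<open>1 - \<alpha> k\<close> cancels the term
      \<open>2 * b k\<close> exactly, so retained and arriving mass together cost only
      \<open>t * C\<^sub>2\<close>.\<close>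
    have "\<epsilon> * ((b (k + 1))\<^sup>2 / b k + (b (k - 1))\<^sup>2 / b k) \<le> \<epsilon> * (2 * b k + \<delta>\<^sup>2 * C\<^sub>2)"
      by (rule mult_left_mono[OF quot \<epsilon>])
    also have "\<dots> = 2 * t * \<theta> * b k / \<delta>\<^sup>2 + t * \<theta> * C\<^sub>2" using \<delta> by (simp add: \<epsilon>_def field_simps)
    also have "\<dots> \<le> 1 - \<alpha> k + t * C\<^sub>2"
      using t \<theta> C\<^sub>2_nonneg mult_right_mono[of \<theta> 1 "t * C\<^sub>2"] by (simp add: \<alpha>_def algebra_simps)
    finally have "\<alpha> k + \<epsilon> * ((b (k + 1))\<^sup>2 / b k + (b (k - 1))\<^sup>2 / b k) \<le> 1 + t * C\<^sub>2" by simp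
    from mult_right_mono[OF this a(2)[of k]]
    show "\<alpha> k * a k + \<epsilon> * ((b (k - 1))\<^sup>2 / b k * a k) + \<epsilon> * ((b (k + 1))\<^sup>2 / b k * a k) \<le> (1 + t * C\<^sub>2) * a k"
      by (simp add: algebra_simps)
  qed (intro summable_on_add summable_on_cmult_right sa sp1 sp2 a)+
  also have "\<dots> = (1 + t * C\<^sub>2) * A" by (simp add: infsum_cmult_right' A_def)
  finally have T1: "(\<Sum>\<^sub>\<infinity>k. \<alpha> k * a k) + \<epsilon> * infsum (p 1) UNIV + \<epsilon> * infsum (p (-1)) UNIV \<le> (1 + t * C\<^sub>2) * A" .
  have "(\<Sum>\<^sub>\<infinity>k. w k * m k) = (\<Sum>\<^sub>\<infinity>k. \<theta> * (w k * c k) - w k * b k)"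
    by (intro infsum_cong) (simp add: m_def algebra_simps)
  also have "\<dots> = \<theta> * (\<Sum>\<^sub>\<infinity>k. w k * c k) - (\<Sum>\<^sub>\<infinity>k. w k * b k)"
    by (simp add: infsum_diff_real summable_on_cmult_right swb swc infsum_cmult_right')
  \<comment> \<open>The nonlocal term is bounded by the squared l^1 norm of \<open>w\<close>, which
    Cauchy-Schwarz against the mass of \<rho> reduces to the action. The prefactor
    \<open>2 * t\<close> makes it the contribution \<open>2 * C\<^sub>1\<close>.\<close>
  also have "\<theta> * (\<Sum>\<^sub>\<infinity>k. w k * c k) \<le> C\<^sub>1 * A"
  proof -
    have "\<bar>\<Sum>\<^sub>\<infinity>k. w k * c k\<bar> \<le> (\<Sum>\<^sub>\<infinity>k. (C\<^sub>1 * (\<delta> * N)) * \<bar>w k\<bar>)"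
    proof (rule abs_infsum_le_real)
      show "(\<lambda>k. (C\<^sub>1 * (\<delta> * N)) * \<bar>w k\<bar>) summable_on UNIV" by (intro summable_on_cmult_right summable_on_abs_real ws)
      show "\<bar>w k * c k\<bar> \<le> (C\<^sub>1 * (\<delta> * N)) * \<bar>w k\<bar>" for k
        using mult_right_mono[OF c[of k] abs_ge_zero[of "w k"]] by (simp add: abs_mult mult.commute)
    qed
    also have "\<dots> = C\<^sub>1 * (\<delta> * N\<^sup>2)" by (simp add: infsum_cmult_right' N_def power2_eq_square)
    also have "\<dots> \<le> C\<^sub>1 * A" by (rule mult_left_mono[OF N2 C\<^sub>1_nonneg])
    finally have *: "\<bar>\<Sum>\<^sub>\<infinity>k. w k * c k\<bar> \<le> C\<^sub>1 * A" .
    have "\<bar>\<theta> * (\<Sum>\<^sub>\<infinity>k. w k * c k)\<bar> \<le> 1 * (C\<^sub>1 * A)" unfolding abs_mult using \<theta> * by (intro mult_mono) auto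
    then show ?thesis by simp
  qed
  finally have T2: "(\<Sum>\<^sub>\<infinity>k. w k * m k) \<le> C\<^sub>1 * A - (\<Sum>\<^sub>\<infinity>k. w k * b k)" by simp
  have "(\<Sum>\<^sub>\<infinity>k. \<rho> k * ((m k)\<^sup>2 / \<alpha> k)) \<le> (\<Sum>\<^sub>\<infinity>k. \<rho> k * M)"
    by (rule infsum_mono[OF srm summable_on_cmult_left[OF r(2)]]) (rule mult_left_mono[OF mM(2) r(1)])
  also have "\<dots> = 4 * K\<^sup>2 / \<delta> + 4 * C\<^sub>1\<^sup>2 * A"
    unfolding infsum_cmult_left' r(4) using \<delta> by (simp add: M_def field_simps)
  finally have T3: "(\<Sum>\<^sub>\<infinity>k. \<rho> k * ((m k)\<^sup>2 / \<alpha> k)) \<le> 4 * K\<^sup>2 / \<delta> + 4 * C\<^sub>1\<^sup>2 * A" .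
  have "infsum a' UNIV \<le> (1 + t * C\<^sub>2) * A + 2 * t * (C\<^sub>1 * A - (\<Sum>\<^sub>\<infinity>k. w k * b k)) + t\<^sup>2 * (4 * K\<^sup>2 / \<delta> + 4 * C\<^sub>1\<^sup>2 * A)"
    unfolding tot using t by (intro add_mono mult_left_mono T1 T2 T3) auto
  then have "infsum a' UNIV \<le> (1 + t * (2 * C\<^sub>1 + C\<^sub>2)) * A - 2 * t * (\<Sum>\<^sub>\<infinity>k. w k * b k)
        + t\<^sup>2 * (4 * K\<^sup>2 / \<delta> + 4 * C\<^sub>1\<^sup>2 * A)" by (simp add: algebra_simps)
  then show ?thesis using sa' a'0 main unfolding A_def b_def c_def by blast
qed

end

section \<open>Momentum, mobility and energy along a curve of finite action\<close>

text \<open>The conditions are those delivered by \<open>Dsq_less_obtains_curve\<close>, hence hold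
  at every time, without exceptional null sets.\<close>

locale interaction_curve = interaction +
  fixes \<rho> w :: "real \<Rightarrow> int \<Rightarrow> real"
  assumes P: "\<rho> s \<in> Pdelta \<delta>"
    and w_out: "s \<notin> {0..1} \<Longrightarrow> w s k = 0"
    and w_meas: "(\<lambda>s. w s k) \<in> borel_measurable lborel"
    and w_zero: "\<rho> s k = 0 \<Longrightarrow> w s k = 0"
    and act_summable: "(\<lambda>k. (w s k)\<^sup>2 / \<rho> s k) summable_on UNIV"
    and act_integrable: "integrable lborel (\<lambda>s. \<Sum>\<^sub>\<infinity>k. (w s k)\<^sup>2 / \<rho> s k)"
    and \<rho>_eq: "\<rho> t k = \<rho> 0 k + (LINT s:{0..t}|lborel. dlap \<delta> (w s) k)"
begin

definition "act s = (\<Sum>\<^sub>\<infinity>k. (w s k)\<^sup>2 / \<rho> s k)"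
definition "mom s = (\<Sum>\<^sub>\<infinity>k. \<bar>w s k\<bar>)"
text \<open>A solution of \<open>dlap \<delta> z = \<rho> t - \<rho> 0\<close>
  (\<open>dlap_prim\<close>), and thereby the summable \<open>z\<close> in
  \<open>energy_diff\<close>.\<close>

definition "prim t k = (LINT s:{0..t}|lborel. w s k)"

lemma act_term: "0 \<le> (w s k)\<^sup>2 / \<rho> s k" "(w s k)\<^sup>2 \<le> (w s k)\<^sup>2 / \<rho> s k * \<rho> s k"
  using PdeltaD(1)[OF P[of s] \<delta>, of k] w_zero[of s k] by (cases "\<rho> s k = 0"; simp)+

lemma act_nonneg: "0 \<le> act s" unfolding act_def by (intro infsum_nonneg act_term)

lemma w_summable: "w s summable_on UNIV"
  by (rule infsum_Cauchy_Schwarz(1)[OF act_summable PdeltaD(2)[OF P \<delta>] act_term(1) PdeltaD(1)[OF P \<delta>] act_term(2)])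

lemma mom_nonneg: "0 \<le> mom s" unfolding mom_def by (intro infsum_nonneg) auto

text \<open>Cauchy-Schwarz against the total mass gives \<open>mom^2 \<le> act / \<delta>\<close>,
  and \<open>2 x \<le> 1 + x^2\<close> linearises it. The indicator keeps the majorant integrable on
  the whole line.\<close>

lemma mom_le: "mom s \<le> indicator {0..1} s + (1 / \<delta>) * act s"
proof (cases "s \<in> {0..1}")
  case True
  have "(mom s)\<^sup>2 \<le> act s * (1 / \<delta>)"
    using infsum_Cauchy_Schwarz(2)[OF act_summable PdeltaD(2)[OF P \<delta>] act_term(1) PdeltaD(1)[OF P \<delta>] act_term(2), of s]
      PdeltaD(4)[OF P \<delta>] by (simp add: mom_def act_def)
  moreover have "2 * mom s \<le> 1 + (mom s)\<^sup>2" using zero_le_power2[of "1 - mom s"] by (simp add: power2_diff)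
  ultimately show ?thesis using True mom_nonneg[of s] mult.commute[of "act s" "1 / \<delta>"] by simp
next
  case False
  then show ?thesis using w_out[OF False] act_nonneg[of s] \<delta> by (simp add: mom_def)
qed

lemma mom_integrable: "integrable lborel mom"
proof (rule Bochner_Integration.integrable_bound)
  show "integrable lborel (\<lambda>s. indicator {0..1} s + (1 / \<delta>) * act s)"
    using act_integrable by (simp add: act_def[abs_def])
  show "mom \<in> borel_measurable lborel"
    unfolding mom_def[abs_def] by (rule borel_measurable_infsum) (use w_meas in \<open>auto intro: summable_on_abs_real w_summable\<close>)
  show "AE s in lborel. norm (mom s) \<le> norm (indicator {0..1} s + (1 / \<delta>) * act s)"
    using mom_le mom_nonneg by (intro AE_I2) (simp, smt (verit))
qed

lemma integral_infsum_mom: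
  assumes f: "\<And>k. (\<lambda>s. f s k) \<in> borel_measurable lborel" and le: "\<And>s k. \<bar>f s k\<bar> \<le> M * \<bar>w s k\<bar>"
  shows "integrable lborel (\<lambda>s. infsum (f s) UNIV)"
    "\<And>k. integrable lborel (\<lambda>s. f s k)"
    "(\<lambda>k. LINT s|lborel. f s k) summable_on UNIV"
    "(LINT s|lborel. infsum (f s) UNIV) = (\<Sum>\<^sub>\<infinity>k. LINT s|lborel. f s k)"
proof -
  have s: "f s summable_on UNIV" for s
    by (rule summable_on_bounded_by[OF summable_on_cmult_right[OF summable_on_abs_real[OF w_summable]] le])
  have bd: "(\<Sum>\<^sub>\<infinity>k. \<bar>f s k\<bar>) \<le> M * mom s" for s
    unfolding mom_def infsum_cmult_right'[symmetric]
    by (intro infsum_mono summable_on_abs_real s summable_on_cmult_right w_summable le)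
  have B: "integrable lborel (\<lambda>s. M * mom s)" using mom_integrable by simp
  show "integrable lborel (\<lambda>s. infsum (f s) UNIV)" "\<And>k. integrable lborel (\<lambda>s. f s k)"
    "(\<lambda>k. LINT s|lborel. f s k) summable_on UNIV"
    "(LINT s|lborel. infsum (f s) UNIV) = (\<Sum>\<^sub>\<infinity>k. LINT s|lborel. f s k)"
    by (rule integral_infsum[OF f s B bd])+
qed

lemma w_integrable: "integrable lborel (\<lambda>s. w s k)"
  by (rule integral_infsum_mom(2)[where M=1, OF w_meas]) simp

lemma w_set_integrable: "set_integrable lborel {a..b} (\<lambda>s. w s k)"
  unfolding set_integrable_def by (rule integrable_mult_indicator[OF _ w_integrable]) simp

lemma dlap_w_integrable: "integrable lborel (\<lambda>s. dlap \<delta> (w s) k)"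
  unfolding dlap_def
  by (intro integrable_divide_zero Bochner_Integration.integrable_diff Bochner_Integration.integrable_add
      integrable_mult_right w_integrable)

lemma \<rho>_meas: "(\<lambda>s. \<rho> s k) \<in> borel_measurable lborel"
proof -
  have "(\<lambda>s. \<rho> 0 k + (LINT r:{0..s}|lborel. dlap \<delta> (w r) k)) \<in> borel_measurable lborel"
    using borel_measurable_indefinite_integral[OF borel_measurable_integrable[OF dlap_w_integrable[of k]]] by simp
  also have "(\<lambda>s. \<rho> 0 k + (LINT r:{0..s}|lborel. dlap \<delta> (w r) k)) = (\<lambda>s. \<rho> s k)"
    by (rule ext) (rule \<rho>_eq[symmetric])
  finally show ?thesis .
qed

lemma dlap_prim: "dlap \<delta> (prim t) k = \<rho> t k - \<rho> 0 k"
proof -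
  have "(LINT s:{0..t}|lborel. dlap \<delta> (w s) k) = dlap \<delta> (prim t) k"
    unfolding prim_def dlap_def
    by (simp add: set_integral_diff set_integral_add w_set_integrable set_integrable_mult_right)
  then show ?thesis using \<rho>_eq[of t k] by simp
qed

lemma prim_le: "\<bar>prim t k\<bar> \<le> (LINT s|lborel. \<bar>w s k\<bar>)"
proof -
  have "\<bar>prim t k\<bar> \<le> (LINT s|lborel. \<bar>indicator {0..t} s * w s k\<bar>)"
    unfolding prim_def set_lebesgue_integral_def real_scaleR_def by (rule integral_abs_bound)
  also have "\<dots> \<le> (LINT s|lborel. \<bar>w s k\<bar>)"
    using w_integrable[of k] integrable_mult_indicator[OF _ w_integrable[of k], of "{0..t}"]
    by (intro integral_mono) (auto split: split_indicator)
  finally show ?thesis .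
qed

lemma abs_w_sum: "(\<lambda>k. LINT s|lborel. \<bar>w s k\<bar>) summable_on UNIV"
    "(\<Sum>\<^sub>\<infinity>k. LINT s|lborel. \<bar>w s k\<bar>) = (LINT s|lborel. mom s)"
  using integral_infsum_mom(3,4)[where f="\<lambda>s k. \<bar>w s k\<bar>" and M=1] w_meas by (auto simp: mom_def)

lemma prim_summable: "prim t summable_on UNIV"
  by (rule summable_on_bounded_by[OF abs_w_sum(1) prim_le])

lemma prim_meas: "(\<lambda>t. prim t k) \<in> borel_measurable lborel"
  unfolding prim_def by (rule borel_measurable_indefinite_integral[OF w_meas])

definition "bb s = mob (\<rho> s)"
text \<open>The time derivative of \<open>bb\<close> (\<open>bb_eq\<close>), because
  \<open>V\<close> convolved with \<Delta>w is \<open>U\<close> convolved with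
  \<open>w\<close>.\<close>

definition "cc s = dconv \<delta> U (w s)"

lemma bb: "0 < bb s k" "\<bar>bb s k\<bar> \<le> K"
  unfolding bb_def using mob_pos[OF P] mob_le(2)[OF P] by auto

lemma cc_le: "\<bar>cc s k\<bar> \<le> C\<^sub>1 * (\<delta> * mom s)"
  unfolding cc_def mom_def by (rule abs_dconv_le[OF w_summable U_le]) (use \<delta> in auto)

lemma bb_meas: "(\<lambda>s. bb s k) \<in> borel_measurable lborel"
proof -
  have "(\<lambda>s. \<Sum>\<^sub>\<infinity>l. V (k - l) * \<rho> s l) \<in> borel_measurable lborel"
    by (rule borel_measurable_infsum[OF _ mob_summable[OF P]]) (use \<rho>_meas in auto)
  then show ?thesis by (simp add: bb_def mob_def dconv_eq)
qed

lemma cc_meas: "(\<lambda>s. cc s k) \<in> borel_measurable lborel"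
proof -
  have "(\<lambda>s. \<Sum>\<^sub>\<infinity>l. U (k - l) * w s l) \<in> borel_measurable lborel"
    by (rule borel_measurable_infsum[OF _ dconv_summand[OF w_summable U_le]]) (use w_meas in auto)
  then show ?thesis by (simp add: cc_def dconv_eq)
qed

lemma cc_integrable: "integrable lborel (\<lambda>s. cc s k)"
proof (rule Bochner_Integration.integrable_bound[OF _ cc_meas])
  show "integrable lborel (\<lambda>s. C\<^sub>1 * (\<delta> * mom s))" using mom_integrable by simp
  show "AE s in lborel. norm (cc s k) \<le> norm (C\<^sub>1 * (\<delta> * mom s))"
    using order.trans[OF cc_le abs_ge_self] by (intro AE_I2) (simp only: real_norm_def)
qed

lemma dconv_U_prim: "dconv \<delta> U (prim t) k = bb t k - bb 0 k"
proof -
  have "dconv \<delta> U (prim t) k = dconv \<delta> V (\<lambda>l. \<rho> t l - \<rho> 0 l) k"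
    using dconv_dlap_right[where f=V and \<delta>=\<delta> and k=k, OF prim_summable[of t] V_abs] by (simp add: dlap_prim[abs_def])
  also have "\<dots> = bb t k - bb 0 k"
    unfolding bb_def mob_def by (rule dconv_diff[OF V_abs PdeltaD(2)[OF P \<delta>] PdeltaD(2)[OF P \<delta>]])
  finally show ?thesis .
qed

text \<open>Fubini moves the time integral through the convolution and leaves \<open>U\<close>
  against the integrated momentum, which \<open>dconv_U_prim\<close> identifies as the increment of
  the mobility.\<close>

lemma bb_eq: "bb t k = bb 0 k + (LINT s:{0..t}|lborel. cc s k)"
proof -
  have *: "integrable lborel (\<lambda>s. indicator {0..t} s * w s l)" for l
    using w_set_integrable[of 0 t l] by (simp add: set_integrable_def)
  have m: "(\<lambda>s. U (k - l) * (indicator {0..t} s * w s l)) \<in> borel_measurable lborel" for l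
    using borel_measurable_integrable[OF *[of l]] by simp
  have le: "\<bar>U (k - l) * (indicator {0..t} s * w s l)\<bar> \<le> C\<^sub>1 * \<bar>w s l\<bar>" for s l
    unfolding abs_mult using U_le[of "k - l"] C\<^sub>1_nonneg
    by (intro mult_mono) (auto split: split_indicator)
  have "(LINT s:{0..t}|lborel. cc s k) = \<delta> * (LINT s|lborel. (\<Sum>\<^sub>\<infinity>l. U (k - l) * (indicator {0..t} s * w s l)))"
    unfolding set_lebesgue_integral_def cc_def dconv_eq real_scaleR_def
    by (subst integral_mult_right_zero[symmetric])
       (intro Bochner_Integration.integral_cong, auto simp: infsum_cmult_right'[symmetric] algebra_simps split: split_indicator)
  also have "\<dots> = \<delta> * (\<Sum>\<^sub>\<infinity>l. U (k - l) * prim t l)"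
    unfolding integral_infsum_mom(4)[OF m le] prim_def set_lebesgue_integral_def real_scaleR_def by simp
  also have "\<dots> = bb t k - bb 0 k" using dconv_U_prim[of t k] by (simp add: dconv_eq)
  finally show ?thesis by simp
qed

text \<open>Chain rule for the energy without differentiating it. The product rule for
  \<open>prim * bb\<close>, summed over sites, integrates to \<open>prim 1 * bb 1\<close>. By
  symmetry of \<open>U\<close> the sum of \<open>prim * cc\<close> equals that of
  \<open>w * (bb - bb 0)\<close>, so twice the wanted integral is the sum of
  \<open>prim 1 * (bb 0 + bb 1)\<close>, which is the sum in \<open>energy_diff\<close>.\<close>

lemma energy_balance:
  "integrable lborel (\<lambda>s. \<Sum>\<^sub>\<infinity>k. w s k * bb s k)"
  "\<delta> * (LINT s|lborel. (\<Sum>\<^sub>\<infinity>k. w s k * bb s k)) = energy \<delta> W (\<rho> 0) - energy \<delta> W (\<rho> 1)"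
proof -
  have m1: "(\<lambda>s. w s k * bb r k) \<in> borel_measurable lborel" for r k
    using w_meas[of k] by simp
  have m2: "(\<lambda>s. w s k * bb s k) \<in> borel_measurable lborel" for k
    using w_meas[of k] bb_meas[of k] by simp
  have le: "\<bar>w s k * bb r k\<bar> \<le> K * \<bar>w s k\<bar>" for s r k
    using mult_right_mono[OF bb(2)[of r k] abs_ge_zero[of "w s k"]] by (simp add: abs_mult mult.commute)
  note I0 = integral_infsum_mom[where f="\<lambda>s k. w s k * bb 0 k", OF m1 le]
  note I1 = integral_infsum_mom[where f="\<lambda>s k. w s k * bb s k", OF m2 le]
  show "integrable lborel (\<lambda>s. \<Sum>\<^sub>\<infinity>k. w s k * bb s k)" by (rule I1(1))
  have sw: "(\<lambda>k. w s k * bb r k) summable_on UNIV" for s r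
    by (rule summable_on_bounded_by[OF summable_on_cmult_right[OF summable_on_abs_real[OF w_summable]] le])
  have prim1: "prim 1 k = (LINT s|lborel. w s k)" for k
    unfolding prim_def set_lebesgue_integral_def
    by (intro Bochner_Integration.integral_cong) (auto simp: w_out split: split_indicator)
  have J0: "(LINT s|lborel. (\<Sum>\<^sub>\<infinity>k. w s k * bb 0 k)) = (\<Sum>\<^sub>\<infinity>k. prim 1 k * bb 0 k)"
    unfolding I0(4) prim1 by simp
  \<comment> \<open>The time derivative of \<open>prim * bb\<close> at the site
    \<open>k\<close>.\<close>
  define h where "h s k = w s k * bb s k + prim s k * cc s k" for s k
  have mh: "(\<lambda>s. h s k) \<in> borel_measurable lborel" for k
    unfolding h_def using w_meas[of k] bb_meas[of k] prim_meas[of k] cc_meas[of k] by simp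
  define Z where "Z = (LINT s|lborel. mom s)"
  have szc: "(\<lambda>k. prim s k * cc s k) summable_on UNIV" for s
    using summable_on_mult_bounded[where f="cc s", OF prim_summable[of s] cc_le] by (simp add: mult.commute)
  have sh: "h s summable_on UNIV" for s unfolding h_def by (intro summable_on_add sw szc)
  have hB: "(\<Sum>\<^sub>\<infinity>k. \<bar>h s k\<bar>) \<le> K * mom s + Z * (C\<^sub>1 * (\<delta> * mom s))" for s
  proof -
    have 1: "(\<lambda>k. K * \<bar>w s k\<bar>) summable_on UNIV" by (intro summable_on_cmult_right summable_on_abs_real w_summable)
    have 2: "(\<lambda>k. (LINT s|lborel. \<bar>w s k\<bar>) * (C\<^sub>1 * (\<delta> * mom s))) summable_on UNIV"
      by (intro summable_on_cmult_left abs_w_sum)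
    have "(\<Sum>\<^sub>\<infinity>k. \<bar>h s k\<bar>) \<le> (\<Sum>\<^sub>\<infinity>k. K * \<bar>w s k\<bar> + (LINT s|lborel. \<bar>w s k\<bar>) * (C\<^sub>1 * (\<delta> * mom s)))"
    proof (rule infsum_mono[OF summable_on_abs_real[OF sh] summable_on_add[OF 1 2]])
      fix k
      have "\<bar>prim s k * cc s k\<bar> \<le> (LINT s|lborel. \<bar>w s k\<bar>) * (C\<^sub>1 * (\<delta> * mom s))"
        unfolding abs_mult using prim_le[of s k] cc_le[of s k] by (intro mult_mono) auto
      then show "\<bar>h s k\<bar> \<le> K * \<bar>w s k\<bar> + (LINT s|lborel. \<bar>w s k\<bar>) * (C\<^sub>1 * (\<delta> * mom s))"
        unfolding h_def using le[of s k s] by linarith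
    qed
    also have "\<dots> = K * mom s + Z * (C\<^sub>1 * (\<delta> * mom s))"
      by (simp only: infsum_add[OF 1 2] infsum_cmult_right' infsum_cmult_left' abs_w_sum(2) mom_def[symmetric] Z_def)
    finally show ?thesis .
  qed
  have intB: "integrable lborel (\<lambda>s. K * mom s + Z * (C\<^sub>1 * (\<delta> * mom s)))" using mom_integrable by simp
  note H = integral_infsum[OF mh sh intB hB]
  have hk: "(LINT s|lborel. h s k) = prim 1 k * bb 1 k" for k
  proof -
    have prim0: "prim 0 k = 0"
      unfolding prim_def set_lebesgue_integral_def
      by (intro integral_eq_zero_AE) (use AE_lborel_singleton[of "0 :: real"] in \<open>eventually_elim, auto split: split_indicator\<close>)
    have "prim 1 k * bb 1 k = prim 0 k * bb 0 k + (LINT s:{0..1}|lborel. w s k * bb s k + prim s k * cc s k)"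
    proof (rule integral_product_rule(2)[OF w_integrable cc_integrable])
      show "prim t k = prim 0 k + (LINT s:{0..t}|lborel. w s k)" for t using prim0 by (simp add: prim_def)
      show "bb t k = bb 0 k + (LINT s:{0..t}|lborel. cc s k)" for t by (rule bb_eq)
    qed simp
    moreover note prim0
    moreover have "(LINT s:{0..1}|lborel. w s k * bb s k + prim s k * cc s k) = (LINT s|lborel. h s k)"
    proof -
      have "cc s k = 0" if "s \<notin> {0..1}" for s using w_out[OF that] by (simp add: cc_def dconv_eq)
      then show ?thesis
        unfolding set_lebesgue_integral_def h_def
        by (intro Bochner_Integration.integral_cong) (auto simp: w_out split: split_indicator)
    qed
    ultimately show ?thesis by simp
  qed
  have hs: "infsum (h s) UNIV = 2 * (\<Sum>\<^sub>\<infinity>k. w s k * bb s k) - (\<Sum>\<^sub>\<infinity>k. w s k * bb 0 k)" for s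
  proof -
    have "(\<Sum>\<^sub>\<infinity>k. prim s k * cc s k) = (\<Sum>\<^sub>\<infinity>k. w s k * dconv \<delta> U (prim s) k)"
      unfolding cc_def
    proof (rule infsum_mult_dconv_sym[where f=U, OF U_even dconv_summand[where f=U, OF w_summable U_le]])
      show "(\<lambda>k. \<bar>prim s k\<bar> * (C\<^sub>1 * mom s)) summable_on UNIV"
        by (intro summable_on_cmult_left summable_on_abs_real prim_summable)
      fix k
      have "(\<Sum>\<^sub>\<infinity>l. \<bar>U (k - l) * w s l\<bar>) \<le> (\<Sum>\<^sub>\<infinity>l. C\<^sub>1 * \<bar>w s l\<bar>)"
        by (intro infsum_mono summable_on_abs_real dconv_summand[OF w_summable U_le] summable_on_cmult_right w_summable)
           (auto simp: abs_mult intro!: mult_right_mono U_le)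
      then show "\<bar>prim s k\<bar> * (\<Sum>\<^sub>\<infinity>l. \<bar>U (k - l) * w s l\<bar>) \<le> \<bar>prim s k\<bar> * (C\<^sub>1 * mom s)"
        by (intro mult_left_mono) (auto simp: infsum_cmult_right' mom_def)
    qed
    also have "\<dots> = (\<Sum>\<^sub>\<infinity>k. w s k * bb s k - w s k * bb 0 k)"
      unfolding dconv_U_prim by (simp add: right_diff_distrib)
    also have "\<dots> = (\<Sum>\<^sub>\<infinity>k. w s k * bb s k) - (\<Sum>\<^sub>\<infinity>k. w s k * bb 0 k)" by (rule infsum_diff_real[OF sw sw])
    finally show ?thesis unfolding h_def using infsum_add[OF sw szc] by simp
  qed
  have X: "2 * (LINT s|lborel. (\<Sum>\<^sub>\<infinity>k. w s k * bb s k)) - (\<Sum>\<^sub>\<infinity>k. prim 1 k * bb 0 k) = (\<Sum>\<^sub>\<infinity>k. prim 1 k * bb 1 k)"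
    using H(4) I0(1) I1(1) unfolding hk hs J0[symmetric] by simp
  have "(\<lambda>k. prim 1 k * bb r k) summable_on UNIV" for r
    using summable_on_mult_bounded[where f="bb r", OF prim_summable[of 1] bb(2)] by (simp add: mult.commute)
  then have Y: "(\<Sum>\<^sub>\<infinity>k. prim 1 k * (bb 0 k + bb 1 k)) = (\<Sum>\<^sub>\<infinity>k. prim 1 k * bb 0 k) + (\<Sum>\<^sub>\<infinity>k. prim 1 k * bb 1 k)"
    by (simp add: distrib_left infsum_add)
  have "energy \<delta> W (\<rho> 1) - energy \<delta> W (\<rho> 0) = - (\<delta> / 2) * (\<Sum>\<^sub>\<infinity>k. prim 1 k * (bb 0 k + bb 1 k))"
    unfolding bb_def by (rule energy_diff[OF P P prim_summable]) (simp add: dlap_prim)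
  then have "energy \<delta> W (\<rho> 1) - energy \<delta> W (\<rho> 0) = - (\<delta> / 2) * (2 * (LINT s|lborel. (\<Sum>\<^sub>\<infinity>k. w s k * bb s k)))"
    unfolding Y using X by (simp add: algebra_simps)
  then show "\<delta> * (LINT s|lborel. (\<Sum>\<^sub>\<infinity>k. w s k * bb s k)) = energy \<delta> W (\<rho> 0) - energy \<delta> W (\<rho> 1)"
    by simp
qed

section \<open>Construction of the pushed curve\<close>

definition "gg s k = \<rho> s k * bb s k"
text \<open>The time derivative of the flux \<open>gg\<close> along the curve, by the product
  rule.\<close>

definition "ee s k = dlap \<delta> (w s) k * bb s k + \<rho> s k * cc s k"

text \<open>The density correction is \<open>t * (1 - s)\<close> times the Laplacian of
  \<open>gg\<close>. The continuity equation then asks for a momentum correction equal to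
  \<open>t\<close> times the derivative of \<open>(1 - s) * gg\<close>, the integrand here.\<close>

lemma euler_flux:
  assumes t: "0 \<le> t" "t \<le> 1"
  shows "set_integrable lborel {0..t} (\<lambda>s. (1 - s) * ee s k - gg s k)"
    and "(1 - t) * gg t k = gg 0 k + (LINT s:{0..t}|lborel. (1 - s) * ee s k - gg s k)"
proof -
  have R: "\<rho> r k = \<rho> 0 k + (LINT s:{0..r}|lborel. dlap \<delta> (w s) k)" for r by (rule \<rho>_eq)
  have gg_eq: "gg r k = gg 0 k + (LINT s:{0..r}|lborel. ee s k)" if "0 \<le> r" for r
    unfolding gg_def ee_def by (rule integral_product_rule(2)[OF dlap_w_integrable cc_integrable R bb_eq that])
  have out: "ee s k = 0" if "s \<notin> {0..1}" for s
    using w_out[OF that] by (simp add: ee_def cc_def dconv_eq dlap_def)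
  have "set_integrable lborel {0..1} (\<lambda>s. ee s k)"
    unfolding ee_def by (rule integral_product_rule(1)[OF dlap_w_integrable cc_integrable R bb_eq]) simp
  moreover have "(\<lambda>s. indicator {0..1} s *\<^sub>R ee s k) = (\<lambda>s. ee s k)"
    using out by (auto simp: fun_eq_iff split: split_indicator)
  ultimately have ee: "integrable lborel (\<lambda>s. ee s k)" by (simp add: set_integrable_def)
  have ind: "integrable lborel (\<lambda>s :: real. - indicator {0..1} s :: real)" by simp
  have lin: "1 - r = (1 - 0) + (LINT s:{0..r}|lborel. - indicator {0..1} s :: real)" if "0 \<le> r" "r \<le> t" for r :: real
  proof -
    have "(LINT s:{0..r}|lborel. - indicator {0..1} s :: real) = (LINT s|lborel. - indicator {0..r} s)"
      unfolding set_lebesgue_integral_def using that t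
      by (intro Bochner_Integration.integral_cong) (auto split: split_indicator)
    also have "\<dots> = - r" using that by simp
    finally show ?thesis by simp
  qed
  note pr = integral_product_rule[where F="\<lambda>s. gg s k" and G="\<lambda>s. 1 - s", OF ee ind gg_eq lin t(1)]
  have eq: "indicator {0..t} s * (ee s k * (1 - s) + gg s k * - indicator {0..1} s)
     = indicator {0..t} s * ((1 - s) * ee s k - gg s k)" for s
    using t by (auto split: split_indicator)
  show "set_integrable lborel {0..t} (\<lambda>s. (1 - s) * ee s k - gg s k)"
    using pr(1) unfolding set_integrable_def real_scaleR_def eq by simp
  show "(1 - t) * gg t k = gg 0 k + (LINT s:{0..t}|lborel. (1 - s) * ee s k - gg s k)"
    using pr(2) unfolding set_lebesgue_integral_def real_scaleR_def eq by (simp add: mult.commute)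
qed

text \<open>The weight \<open>1 - s\<close> makes a full Euler step at the start and none at the
  end, so the end point stays fixed. Differentiating the weight leaves \<open>- gg\<close> in the
  momentum; its contribution to the action is the energy difference by
  \<open>energy_balance\<close>.\<close>

lemma euler_curve:
  assumes t: "0 \<le> t" "4 * t * K \<le> \<delta>\<^sup>2"
  obtains \<rho>' w' A' where "action_curve \<delta> \<rho>' w' A'"
    "\<rho>' 0 = (\<lambda>k. \<rho> 0 k + t * dlap \<delta> (\<lambda>j. \<rho> 0 j * mob (\<rho> 0) j) k)" "\<rho>' 1 = \<rho> 1"
    "\<delta> * (LINT s:{0..1}|lborel. A' s) = (1 + t * (2 * C\<^sub>1 + C\<^sub>2)) * (\<delta> * (LINT s|lborel. act s))
       + 2 * t * (energy \<delta> W (\<rho> 1) - energy \<delta> W (\<rho> 0))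
       + t\<^sup>2 * (4 * K\<^sup>2 + 4 * C\<^sub>1\<^sup>2 * (\<delta> * (LINT s|lborel. act s)))"
proof -
  define p where "p s k = (1 - s) * ee s k - gg s k" for s k
  define \<rho>' where "\<rho>' s k = \<rho> s k + t * (1 - s) * dlap \<delta> (gg s) k" for s k
  define w' where "w' s k = w s k + t * p s k" for s k
  define E where "E s = (\<Sum>\<^sub>\<infinity>k. w s k * bb s k)" for s
  define A' where "A' s = (1 + t * (2 * C\<^sub>1 + C\<^sub>2)) * act s - 2 * t * E s + t\<^sup>2 * (4 * K\<^sup>2 / \<delta> + 4 * C\<^sub>1\<^sup>2 * act s)" for s
  have gg: "gg s = (\<lambda>j. \<rho> s j * mob (\<rho> s) j)" for s by (auto simp: gg_def bb_def)
  have ind_id: "(\<lambda>s. indicator {0..1} s * f s) = f" if "\<And>s. s \<notin> {0..1} \<Longrightarrow> f s = 0" for f :: "real \<Rightarrow> real"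
    using that by (auto simp: fun_eq_iff split: split_indicator)
  have act_out: "act s = 0" if "s \<notin> {0..1}" for s using w_out[OF that] by (simp add: act_def)
  have E_out: "E s = 0" if "s \<notin> {0..1}" for s using w_out[OF that] by (simp add: E_def)
  have iact: "integrable lborel act" using act_integrable by (simp add: act_def[abs_def])
  have iE: "integrable lborel E" using energy_balance(1) by (simp add: E_def[abs_def])
  have i01: "integrable lborel (indicator {0..1} :: real \<Rightarrow> real)" by simp
  have A'_eq: "indicator {0..1} s * A' s = (1 + t * (2 * C\<^sub>1 + C\<^sub>2)) * act s - 2 * t * E s
       + t\<^sup>2 * ((4 * K\<^sup>2 / \<delta>) * indicator {0..1} s + 4 * C\<^sub>1\<^sup>2 * act s)" for s
    using act_out[of s] E_out[of s] by (auto simp: A'_def split: split_indicator)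
  have p_int: "set_integrable lborel {0..r} (\<lambda>s. p s k)"
    and p_eq: "(1 - r) * gg r k = gg 0 k + (LINT s:{0..r}|lborel. p s k)" if "0 \<le> r" "r \<le> 1" for r k
    unfolding p_def using euler_flux[OF that] by auto
  have "action_curve \<delta> \<rho>' w' A'"
    unfolding action_curve_def
  proof (intro conjI ballI allI)
    fix s :: real assume s: "s \<in> {0..1}"
    then have th: "0 \<le> 1 - s" "1 - s \<le> 1" by auto
    show "\<rho>' s \<in> Pdelta \<delta>"
      using euler_Pdelta[OF P[of s] t th] unfolding \<rho>'_def gg .
    show "\<exists>a. a summable_on UNIV \<and> infsum a UNIV \<le> A' s \<and> (\<forall>k. 0 \<le> a k \<and> (w' s k)\<^sup>2 \<le> a k * \<rho>' s k)"
      using euler_action[OF P[of s] t th act_summable[of s] act_term[of s]]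
      unfolding A'_def w'_def \<rho>'_def p_def ee_def gg act_def E_def bb_def cc_def .
  next
    fix k
    have "(\<lambda>s. indicator {0..1} s * p s k) \<in> borel_measurable lborel"
      using borel_measurable_integrable[OF p_int[unfolded set_integrable_def real_scaleR_def, of 1 k]] by simp
    moreover have "(\<lambda>s. indicator {0..1} s * w s k) \<in> borel_measurable lborel"
      using w_meas[of k] by simp
    ultimately have "(\<lambda>s. indicator {0..1} s * w s k + t * (indicator {0..1} s * p s k)) \<in> borel_measurable lborel"
      by simp
    then show "(\<lambda>s. indicator {0..1} s * w' s k) \<in> borel_measurable lborel"
      by (simp add: w'_def algebra_simps)
  next
    show "set_integrable lborel {0..1} A'"
      unfolding set_integrable_def real_scaleR_def A'_eq using iact iE i01 by simp
  next
    fix k and r :: real assume "r \<in> {0..1}"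
    then have r: "0 \<le> r" "r \<le> 1" by auto
    have "(LINT s:{0..r}|lborel. dlap \<delta> (w' s) k) = (LINT s:{0..r}|lborel. dlap \<delta> (w s) k + t * dlap \<delta> (p s) k)"
      by (simp add: w'_def dlap_def add_divide_distrib diff_divide_distrib algebra_simps)
    also have "\<dots> = (LINT s:{0..r}|lborel. dlap \<delta> (w s) k) + t * (LINT s:{0..r}|lborel. dlap \<delta> (p s) k)"
    proof -
      have 1: "set_integrable lborel {0..r} (\<lambda>s. dlap \<delta> (w s) k)"
        unfolding dlap_def by (intro set_integrable_divide set_integral_diff set_integral_add set_integrable_mult_right w_set_integrable)
      have 2: "set_integrable lborel {0..r} (\<lambda>s. t * dlap \<delta> (p s) k)"
        unfolding dlap_def by (intro set_integrable_mult_right set_integrable_divide set_integral_diff set_integral_add p_int r)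
      show ?thesis using set_integral_add(2)[OF 1 2] by simp
    qed
    also have "(LINT s:{0..r}|lborel. dlap \<delta> (p s) k) = dlap \<delta> (\<lambda>j. LINT s:{0..r}|lborel. p s j) k"
      unfolding dlap_def
      by (simp add: set_integral_diff set_integral_add set_integrable_mult_right p_int r)
    also have "dlap \<delta> (\<lambda>j. LINT s:{0..r}|lborel. p s j) k = (1 - r) * dlap \<delta> (gg r) k - dlap \<delta> (gg 0) k"
    proof -
      have "(LINT s:{0..r}|lborel. p s j) = (1 - r) * gg r j - gg 0 j" for j using p_eq[OF r, of j] by simp
      then show ?thesis
        by (simp only: dlap_def) (simp add: add_divide_distrib diff_divide_distrib algebra_simps)
    qed
    also have "(LINT s:{0..r}|lborel. dlap \<delta> (w s) k) = \<rho> r k - \<rho> 0 k" using \<rho>_eq[of r k] by simp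
    finally show "\<rho>' r k = \<rho>' 0 k + (LINT s:{0..r}|lborel. dlap \<delta> (w' s) k)"
      by (simp add: \<rho>'_def algebra_simps)
  qed
  moreover have "\<rho>' 0 = (\<lambda>k. \<rho> 0 k + t * dlap \<delta> (\<lambda>j. \<rho> 0 j * mob (\<rho> 0) j) k)" "\<rho>' 1 = \<rho> 1"
    by (auto simp: \<rho>'_def gg)
  moreover have "\<delta> * (LINT s:{0..1}|lborel. A' s) = (1 + t * (2 * C\<^sub>1 + C\<^sub>2)) * (\<delta> * (LINT s|lborel. act s))
       + 2 * t * (energy \<delta> W (\<rho> 1) - energy \<delta> W (\<rho> 0))
       + t\<^sup>2 * (4 * K\<^sup>2 + 4 * C\<^sub>1\<^sup>2 * (\<delta> * (LINT s|lborel. act s)))"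
  proof -
    have X: "(LINT s:{0..1}|lborel. A' s) = (1 + t * (2 * C\<^sub>1 + C\<^sub>2)) * (LINT s|lborel. act s) - 2 * t * (LINT s|lborel. E s)
       + t\<^sup>2 * (4 * K\<^sup>2 / \<delta> + 4 * C\<^sub>1\<^sup>2 * (LINT s|lborel. act s))"
      unfolding set_lebesgue_integral_def real_scaleR_def A'_eq using iact iE i01 by simp
    have Y: "energy \<delta> W (\<rho> 1) - energy \<delta> W (\<rho> 0) = - (\<delta> * (LINT s|lborel. E s))"
      using energy_balance(2) by (simp add: E_def)
    show ?thesis unfolding X Y using \<delta> by (simp add: field_simps)
  qed
  ultimately show thesis by (rule that)
qed

end

section \<open>The flow and its Euler approximation\<close>

text \<open>A single trajectory, differentiable site by site; estimates uniform in the site have to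
  come from positivity and conservation of mass.\<close>

locale interaction_flow = interaction +
  fixes \<sigma> :: "real \<Rightarrow> int \<Rightarrow> real"
  assumes \<sigma>P: "0 \<le> t \<Longrightarrow> \<sigma> t \<in> Pdelta \<delta>"
    and \<sigma>_deriv: "0 \<le> t \<Longrightarrow> ((\<lambda>\<tau>. \<sigma> \<tau> k) has_real_derivative
          dlap \<delta> (\<lambda>j. \<sigma> t j * mob (\<sigma> t) j) k) (at t within {0..})"
begin

text \<open>Bounds the relative rate at which mass can leave a site.\<close>

definition "rate = 2 * K / \<delta>\<^sup>2"
definition "flux t k = \<sigma> t k * mob (\<sigma> t) k"

lemma rate_pos: "rate > 0" using K_pos \<delta> by (simp add: rate_def)

lemma flux_nonneg: "0 \<le> t \<Longrightarrow> 0 \<le> flux t k"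
  unfolding flux_def using PdeltaD(1)[OF \<sigma>P \<delta>] mob_pos[OF \<sigma>P] by (simp add: less_imp_le)

lemma flux_le: "0 \<le> t \<Longrightarrow> flux t k \<le> K * \<sigma> t k"
  unfolding flux_def using PdeltaD(1)[OF \<sigma>P \<delta>, of t k] mob_le(1)[OF \<sigma>P, of t k]
  by (simp add: mult.commute[of K] mult_left_mono)

lemma deriv_within:
  assumes "0 \<le> s" "s \<le> x" "x \<le> t"
  shows "((\<lambda>\<tau>. \<sigma> \<tau> k) has_real_derivative dlap \<delta> (flux x) k) (at x within {s..t})"
  using \<sigma>_deriv[of x k] assms unfolding flux_def by (auto intro: DERIV_subset)

text \<open>A site loses at most the fraction \<open>rate\<close> of its mass per unit time and
  otherwise gains from its neighbours, so the compensated density has a nonnegative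
  derivative.\<close>

lemma exp_mono:
  assumes "0 \<le> s" "s \<le> t"
  shows "exp (rate * s) * \<sigma> s k \<le> exp (rate * t) * \<sigma> t k"
proof (cases "s = t")
  case False
  then have "s < t" using assms by simp
  define F where "F x = exp (rate * x) * \<sigma> x k" for x
  define F' where "F' x = exp (rate * x) * (rate * \<sigma> x k + dlap \<delta> (flux x) k)" for x
  have "(F has_real_derivative F' x) (at x within {s..t})" if "x \<in> {s..t}" for x
    unfolding F_def F'_def
    by (rule derivative_eq_intros deriv_within refl | use that assms in \<open>simp add: algebra_simps\<close>)+
  then have "\<exists>x\<in>{s<..<t}. F t - F s = F' x * (t - s)"
    using mvt_simple[OF \<open>s < t\<close>, of F "\<lambda>x h. F' x * h"] by (auto simp: has_field_derivative_def)
  then obtain x where x: "x \<in> {s<..<t}" "F t - F s = F' x * (t - s)" by blast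
  have x0: "0 \<le> x" using x assms by auto
  have "rate * \<sigma> x k + dlap \<delta> (flux x) k = (2 / \<delta>\<^sup>2) * (K * \<sigma> x k - flux x k) + (flux x (k + 1) + flux x (k - 1)) / \<delta>\<^sup>2"
    by (simp add: rate_def dlap_def algebra_simps add_divide_distrib diff_divide_distrib)
  also have "\<dots> \<ge> 0" using flux_le[OF x0, of k] flux_nonneg[OF x0]
    by (intro add_nonneg_nonneg mult_nonneg_nonneg divide_nonneg_nonneg) auto
  finally have "F' x \<ge> 0" by (simp add: F'_def)
  then have "F t - F s \<ge> 0" using x by (simp add: mult_nonneg_nonneg)
  then show ?thesis by (simp add: F_def)
qed simp

lemma \<sigma>_growth:
  assumes "0 \<le> s" "s \<le> t"
  shows "\<sigma> s k \<le> exp (rate * (t - s)) * \<sigma> t k"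
proof -
  have "exp (rate * t) = exp (rate * s) * exp (rate * (t - s))"
    by (simp add: exp_add[symmetric] algebra_simps)
  then have "exp (rate * s) * \<sigma> s k \<le> exp (rate * s) * (exp (rate * (t - s)) * \<sigma> t k)"
    using exp_mono[OF assms, of k] by simp
  then show ?thesis by simp
qed

text \<open>Both densities have mass one, so the nonnegative difference of the growth estimate has small mass.\<close>
lemma l1_lipschitz:
  assumes "0 \<le> s" "s \<le> t"
  shows "(\<lambda>k. \<sigma> t k - \<sigma> s k) summable_on UNIV"
    "(\<Sum>\<^sub>\<infinity>k. \<bar>\<sigma> t k - \<sigma> s k\<bar>) \<le> 2 * (exp (rate * (t - s)) - 1) / \<delta>"
proof -
  have t0: "0 \<le> t" using assms by simp
  note a = PdeltaD[OF \<sigma>P[OF assms(1)] \<delta>] and b = PdeltaD[OF \<sigma>P[OF t0] \<delta>]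
  define e where "e = exp (rate * (t - s))"
  have e1: "e \<ge> 1" unfolding e_def using rate_pos assms by simp
  show s: "(\<lambda>k. \<sigma> t k - \<sigma> s k) summable_on UNIV" by (intro summable_on_diff_real a b)
  \<comment> \<open>The increment is \<open>e * \<sigma> t - \<sigma> s\<close> minus
    \<open>(e - 1) * \<sigma> t\<close>, both nonnegative. Their sum is the majorant, and
    conservation of mass evaluates it.\<close>
  have "(\<Sum>\<^sub>\<infinity>k. \<bar>\<sigma> t k - \<sigma> s k\<bar>) \<le> (\<Sum>\<^sub>\<infinity>k. (2 * e - 1) * \<sigma> t k - \<sigma> s k)"
  proof (rule infsum_mono)
    show "(\<lambda>k. \<bar>\<sigma> t k - \<sigma> s k\<bar>) summable_on UNIV" by (rule summable_on_abs_real[OF s])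
    show "(\<lambda>k. (2 * e - 1) * \<sigma> t k - \<sigma> s k) summable_on UNIV"
      by (intro summable_on_diff_real summable_on_cmult_right a b)
    fix k
    have "0 \<le> (e - 1) * \<sigma> t k" using e1 b(1)[of k] by simp
    then show "\<bar>\<sigma> t k - \<sigma> s k\<bar> \<le> (2 * e - 1) * \<sigma> t k - \<sigma> s k"
      using \<sigma>_growth[OF assms, of k] unfolding e_def[symmetric] by (simp add: algebra_simps abs_le_iff)
  qed
  also have "\<dots> = (2 * e - 1) * infsum (\<sigma> t) UNIV - infsum (\<sigma> s) UNIV"
    by (simp add: infsum_diff_real summable_on_cmult_right a b infsum_cmult_right')
  also have "\<dots> = 2 * (e - 1) / \<delta>" unfolding a(4) b(4) using \<delta> by (simp add: field_simps)
  finally show "(\<Sum>\<^sub>\<infinity>k. \<bar>\<sigma> t k - \<sigma> s k\<bar>) \<le> 2 * (exp (rate * (t - s)) - 1) / \<delta>" by (simp add: e_def)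
qed

text \<open>The bounded kernel \<open>V\<close> turns the l^1 estimate into a uniform one;
  \<open>exp x - 1 \<le> 2 x\<close> on the unit interval produces the factor 4.\<close>

lemma mob_lipschitz:
  assumes "0 \<le> s" "s \<le> t" "rate * t \<le> 1"
  shows "\<bar>mob (\<sigma> t) k - mob (\<sigma> s) k\<bar> \<le> 4 * K * rate * (t - s)"
proof -
  have t0: "0 \<le> t" using assms by simp
  have x: "0 \<le> rate * (t - s)" "rate * (t - s) \<le> 1"
    using rate_pos assms mult_nonneg_nonneg[OF less_imp_le[OF rate_pos] assms(1)]
    by (simp, unfold right_diff_distrib, linarith)
  have ex: "exp (rate * (t - s)) - 1 \<le> 2 * (rate * (t - s))"
  proof -
    have "exp (rate * (t - s)) \<le> 1 + rate * (t - s) + (rate * (t - s))\<^sup>2" by (rule exp_bound[OF x])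
    moreover have "(rate * (t - s))\<^sup>2 \<le> rate * (t - s)"
      using x mult_left_le[of "rate * (t - s)" "rate * (t - s)"] by (simp add: power2_eq_square)
    ultimately show ?thesis by linarith
  qed
  have "\<bar>mob (\<sigma> t) k - mob (\<sigma> s) k\<bar> = \<bar>dconv \<delta> V (\<lambda>l. \<sigma> t l - \<sigma> s l) k\<bar>"
    unfolding mob_def
    by (subst dconv_diff[OF V_abs PdeltaD(2)[OF \<sigma>P[OF t0] \<delta>] PdeltaD(2)[OF \<sigma>P[OF assms(1)] \<delta>]]) simp
  also have "\<dots> \<le> K * (\<delta> * (\<Sum>\<^sub>\<infinity>l. \<bar>\<sigma> t l - \<sigma> s l\<bar>))"
    by (rule abs_dconv_le[OF l1_lipschitz(1)[OF assms(1,2)] V_abs]) (use \<delta> in simp)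
  also have "\<dots> \<le> K * (\<delta> * (2 * (2 * (rate * (t - s))) / \<delta>))"
  proof (intro mult_left_mono)
    have "2 * (exp (rate * (t - s)) - 1) / \<delta> \<le> 2 * (2 * (rate * (t - s))) / \<delta>"
      using ex \<delta> by (intro divide_right_mono mult_left_mono) auto
    then show "(\<Sum>\<^sub>\<infinity>l. \<bar>\<sigma> t l - \<sigma> s l\<bar>) \<le> 2 * (2 * (rate * (t - s))) / \<delta>"
      using l1_lipschitz(2)[OF assms(1,2)] by linarith
  qed (use K_pos \<delta> in auto)
  finally show ?thesis using \<delta> by (simp add: mult.assoc)
qed

text \<open>\<open>mob\<close> is an infinite sum, so continuity at single sites is not enough and
  the uniform Lipschitz bound is used. The result makes the flux integrable for the fundamental
  theorem of calculus.\<close>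

lemma flux_continuous:
  assumes "rate * T \<le> 1"
  shows "continuous_on {0..T} (\<lambda>t. flux t k)"
proof -
  have "continuous_on {0..T} (\<lambda>t. \<sigma> t k)"
    using deriv_within[of 0 _ T k] by (intro DERIV_continuous_on) auto
  moreover have "continuous_on {0..T} (\<lambda>t. mob (\<sigma> t) k)"
  proof (rule lipschitz_on_continuous_on[OF lipschitz_onI])
    fix x y assume xy: "x \<in> {0..T}" "y \<in> {0..T}"
    have rT: "rate * x \<le> 1" "rate * y \<le> 1"
      using xy rate_pos by (auto intro!: order.trans[OF _ assms] mult_left_mono)
    show "dist (mob (\<sigma> x) k) (mob (\<sigma> y) k) \<le> (4 * K * rate) * dist x y"
    proof (cases "x \<le> y")
      case True
      then show ?thesis using mob_lipschitz[of x y k] xy rT by (simp add: dist_real_def abs_minus_commute)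
    next
      case False
      then show ?thesis using mob_lipschitz[of y x k] xy rT by (simp add: dist_real_def)
    qed
  qed (use K_pos rate_pos in auto)
  ultimately show ?thesis unfolding flux_def by (intro continuous_on_mult)
qed

text \<open>The remainder is at most \<open>T\<close> times a bound for the flux variation, which
  consists of \<open>K * J\<close> and a mobility term. In its square two bounds for
  \<open>J\<close> are multiplied: \<open>7 * \<sigma> T\<close>, at the right site but not small,
  and \<open>JT\<close>, of order \<open>T\<close> but involving neighbours. Hence order
  \<open>T ^ 3\<close> with the density at the same site as a factor.\<close>

lemma flow_error:
  assumes T: "0 \<le> T" "rate * T \<le> 1"
  obtains err e where
    "\<And>k. \<sigma> T k = \<sigma> 0 k + T * dlap \<delta> (\<lambda>j. \<sigma> 0 j * mob (\<sigma> 0) j) k + dlap \<delta> err k"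
    "\<And>k. 0 \<le> e k" "e summable_on UNIV" "infsum e UNIV \<le> 372 * K\<^sup>2 * rate * T ^ 3 / \<delta>"
    "\<And>k. (err k)\<^sup>2 \<le> e k * \<sigma> T k"
proof -
  note S = PdeltaD[OF \<sigma>P[OF T(1)] \<delta>]
  have cont: "continuous_on {0..r} (\<lambda>t. flux t k)" if "r \<le> T" for r k
    using flux_continuous[OF T(2), of k] by (rule continuous_on_subset) (use that in auto)
  note int = integrable_continuous_real[OF cont]
  define I where "I r k = integral {0..r} (\<lambda>t. flux t k)" for r k
  have I0: "0 \<le> I r k" for r k
  proof (cases "(\<lambda>t. flux t k) integrable_on {0..r}")
    case True
    then show ?thesis unfolding I_def by (rule integral_nonneg) (auto intro: flux_nonneg)
  qed (simp add: I_def not_integrable_integral)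
  have Imono: "I r k \<le> I T k" if "0 \<le> r" "r \<le> T" for r k
    unfolding I_def using that by (intro integral_subset_le int) (auto intro: flux_nonneg)
  have FTC: "\<sigma> r k - \<sigma> 0 k = dlap \<delta> (I r) k" if r: "0 \<le> r" "r \<le> T" for r k
  proof -
    have "((\<lambda>t. dlap \<delta> (flux t) k) has_integral \<sigma> r k - \<sigma> 0 k) {0..r}"
      using r(1) deriv_within[of 0 _ r k]
      by (intro fundamental_theorem_of_calculus) (auto simp: has_real_derivative_iff_has_vector_derivative)
    moreover have "((\<lambda>t. dlap \<delta> (flux t) k) has_integral dlap \<delta> (I r) k) {0..r}"
      unfolding dlap_def I_def
      by (intro has_integral_divide has_integral_diff has_integral_add has_integral_mult_right integrable_integral int r)
    ultimately show ?thesis by (rule has_integral_unique)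
  qed
  \<comment> \<open>Earlier densities are dominated by the final one, against which the error is
    measured; 3 bounds \<open>exp 1\<close>.\<close>
  have \<sigma>3: "\<sigma> r k \<le> 3 * \<sigma> T k" if "0 \<le> r" "r \<le> T" for r k
  proof -
    have "rate * (T - r) \<le> 1"
      unfolding right_diff_distrib using T(2) mult_nonneg_nonneg[OF less_imp_le[OF rate_pos] that(1)] by linarith
    then have "exp (rate * (T - r)) \<le> 3" using exp_le order.trans[OF exp_le_cancel_iff[THEN iffD2]] by blast
    then have "exp (rate * (T - r)) * \<sigma> T k \<le> 3 * \<sigma> T k" using S(1)[of k] by (intro mult_right_mono)
    then show ?thesis using \<sigma>_growth[OF that, of k] by linarith
  qed
  have IS: "I T k \<le> 3 * K * T * \<sigma> T k" for k
  proof -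
    have "I T k \<le> integral {0..T} (\<lambda>_. K * (3 * \<sigma> T k))"
      unfolding I_def
    proof (rule integral_le[OF int])
      fix r assume "r \<in> {0..T}"
      then have r: "0 \<le> r" "r \<le> T" by auto
      show "flux r k \<le> K * (3 * \<sigma> T k)"
        using flux_le[OF r(1), of k] mult_left_mono[OF \<sigma>3[OF r, of k], of K] K_pos by linarith
    qed auto
    then show ?thesis using T by (simp add: algebra_simps)
  qed
  have KT: "2 * K * T \<le> \<delta>\<^sup>2" using T(2) \<delta> by (simp add: rate_def field_simps)
  \<comment> \<open>Inflow plus outflow over the whole interval, which bounds the displacement of
    the density at every time up to \<open>T\<close>.\<close>
  define J where "J k = (I T (k + 1) + I T (k - 1) + 2 * I T k) / \<delta>\<^sup>2" for k
  have J0: "0 \<le> J k" for k unfolding J_def using I0 by simp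
  have I3: "2 * I T k / \<delta>\<^sup>2 \<le> 3 * \<sigma> T k" for k
  proof -
    have "2 * I T k \<le> (2 * K * T) * (3 * \<sigma> T k)" using IS[of k] by (simp add: algebra_simps)
    also have "\<dots> \<le> \<delta>\<^sup>2 * (3 * \<sigma> T k)" using KT S(1)[of k] by (intro mult_right_mono) auto
    finally show ?thesis using \<delta> by (simp add: divide_le_eq mult.commute)
  qed
  \<comment> \<open>Adding twice the outflow turns inflow minus outflow into inflow plus outflow.
    The net change is at most \<open>\<sigma> T\<close> and the outflow at most
    \<open>3 * \<sigma> T\<close>, whence 1 + 2 * 3 = 7.\<close>
  have J7: "J k \<le> 7 * \<sigma> T k" for k
  proof -
    have "J k = (\<sigma> T k - \<sigma> 0 k) + 2 * (2 * I T k / \<delta>\<^sup>2)"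
      unfolding FTC[OF T(1) order.refl] by (simp add: J_def dlap_def diff_divide_distrib add_divide_distrib)
    then show ?thesis using I3[of k] PdeltaD(1)[OF \<sigma>P[OF order.refl] \<delta>, of k] by linarith
  qed
  have JT: "J k \<le> (3 / 2) * rate * T * (\<sigma> T (k + 1) + \<sigma> T (k - 1) + 2 * \<sigma> T k)" for k
  proof -
    have "J k \<le> (3 * K * T * \<sigma> T (k + 1) + 3 * K * T * \<sigma> T (k - 1) + 2 * (3 * K * T * \<sigma> T k)) / \<delta>\<^sup>2"
      unfolding J_def by (intro divide_right_mono add_mono mult_left_mono IS) auto
    then show ?thesis by (simp add: rate_def algebra_simps add_divide_distrib)
  qed
  define err where "err k = I T k - T * flux 0 k" for k
  have err: "\<bar>err k\<bar> \<le> T * (K * J k + 12 * K * (rate * T) * \<sigma> T k)" for k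
  proof -
    have diff: "\<bar>flux r k - flux 0 k\<bar> \<le> K * J k + 12 * K * (rate * T) * \<sigma> T k" if r: "0 \<le> r" "r \<le> T" for r
    proof -
      have "\<bar>\<sigma> r k - \<sigma> 0 k\<bar> \<le> (I r (k + 1) + I r (k - 1) + 2 * I r k) / \<delta>\<^sup>2"
        unfolding FTC[OF r] dlap_def abs_divide using I0[of r] \<delta> by (intro frac_le) (auto simp: abs_le_iff)
      also have "\<dots> \<le> J k" unfolding J_def by (intro divide_right_mono add_mono mult_left_mono Imono r) auto
      finally have d1: "\<bar>\<sigma> r k - \<sigma> 0 k\<bar> \<le> J k" .
      have r1: "rate * r \<le> 1" using r rate_pos by (auto intro!: order.trans[OF _ T(2)] mult_left_mono)
      have "4 * K * rate * (r - 0) \<le> 4 * K * rate * T" using r K_pos rate_pos by (intro mult_left_mono) auto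
      then have d2: "\<bar>mob (\<sigma> r) k - mob (\<sigma> 0) k\<bar> \<le> 4 * K * rate * T"
        using mob_lipschitz[OF order.refl r(1) r1, of k] by linarith
      have "flux r k - flux 0 k = (\<sigma> r k - \<sigma> 0 k) * mob (\<sigma> r) k + \<sigma> 0 k * (mob (\<sigma> r) k - mob (\<sigma> 0) k)"
        by (simp add: flux_def algebra_simps)
      also have "\<bar>\<dots>\<bar> \<le> \<bar>\<sigma> r k - \<sigma> 0 k\<bar> * \<bar>mob (\<sigma> r) k\<bar> + \<bar>\<sigma> 0 k\<bar> * \<bar>mob (\<sigma> r) k - mob (\<sigma> 0) k\<bar>"
        unfolding abs_mult[symmetric] by (rule abs_triangle_ineq)
      also have "\<dots> \<le> J k * K + (3 * \<sigma> T k) * (4 * K * rate * T)"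
        using d1 d2 mob_le(2)[OF \<sigma>P[OF r(1)], of k] \<sigma>3[of 0 k] PdeltaD(1)[OF \<sigma>P[OF order.refl] \<delta>, of k] J0[of k] T(1) S(1)[of k]
        by (intro add_mono mult_mono) auto
      finally show ?thesis by (simp add: algebra_simps)
    qed
    have "err k = integral {0..T} (\<lambda>r. flux r k - flux 0 k)"
      unfolding err_def I_def using T(1) by (subst integral_diff[OF int]) auto
    also have "norm \<dots> \<le> integral {0..T} (\<lambda>_. K * J k + 12 * K * (rate * T) * \<sigma> T k)"
      using diff by (intro integral_norm_bound_integral integrable_diff int) auto
    finally show ?thesis using T(1) by simp
  qed
  \<comment> \<open>From \<open>(x + y)^2 \<le> 2 x^2 + 2 y^2\<close>: 21 is 2 times 3/2 times 7,
    and 288 is 2 times 12 squared. Summation over sites yields 4 times 21 plus 288, that is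
    372.\<close>
  define e where "e k = K\<^sup>2 * rate * T ^ 3 * (21 * (\<sigma> T (k + 1) + \<sigma> T (k - 1) + 2 * \<sigma> T k) + 288 * \<sigma> T k)" for k
  have e0: "0 \<le> e k" for k unfolding e_def using S(1) T(1) rate_pos by simp
  have esq: "(err k)\<^sup>2 \<le> e k * \<sigma> T k" for k
  proof -
    define x where "x = rate * T"
    have x: "0 \<le> x" "x \<le> 1" using T rate_pos by (simp_all add: x_def)
    have x2: "x\<^sup>2 \<le> x" using x mult_left_le[of x x] by (simp add: power2_eq_square)
    define s where "s = \<sigma> T k"
    have s0: "0 \<le> s" using S(1) by (simp add: s_def)
    define G where "G = \<sigma> T (k + 1) + \<sigma> T (k - 1) + 2 * \<sigma> T k"
    have "(err k)\<^sup>2 \<le> (T * (K * J k + 12 * K * x * s))\<^sup>2"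
      using err[of k] by (subst abs_le_square_iff[symmetric]) (simp add: x_def s_def)
    also have "\<dots> = (T\<^sup>2 * K\<^sup>2) * (J k + 12 * x * s)\<^sup>2" by (simp add: power2_eq_square algebra_simps)
    also have "\<dots> \<le> (T\<^sup>2 * K\<^sup>2) * (x * (21 * G + 288 * s) * s)"
    proof (rule mult_left_mono)
      have "(J k + 12 * x * s)\<^sup>2 \<le> 2 * (J k * J k) + 288 * (x\<^sup>2 * (s * s))"
        using zero_le_power2[of "J k - 12 * x * s"] by (simp add: power2_eq_square algebra_simps)
      also have "\<dots> \<le> 2 * ((3 / 2 * x * G) * (7 * s)) + 288 * (x * (s * s))"
        using J0[of k] J7[of k] JT[of k] x2 s0
        by (intro add_mono mult_left_mono mult_mono mult_right_mono) (auto simp: x_def s_def G_def mult.assoc intro: order.trans)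
      finally show "(J k + 12 * x * s)\<^sup>2 \<le> x * (21 * G + 288 * s) * s" by (simp add: algebra_simps)
    qed simp
    also have "\<dots> = e k * \<sigma> T k"
    proof -
      have "e k * \<sigma> T k = K\<^sup>2 * rate * T ^ 3 * (21 * G + 288 * s) * s" by (simp only: e_def G_def s_def)
      then show ?thesis by (simp add: x_def power2_eq_square power3_eq_cube)
    qed
    finally show ?thesis .
  qed
  have sh: "(\<lambda>k. \<sigma> T (k + 1)) summable_on UNIV" "(\<lambda>k. \<sigma> T (k - 1)) summable_on UNIV"
    using S(2) by (simp_all add: summable_on_shift_int(1,2)[of "\<sigma> T"])
  have es: "e summable_on UNIV"
    unfolding e_def by (intro summable_on_cmult_right summable_on_add sh S)
  have "infsum e UNIV = K\<^sup>2 * rate * T ^ 3 * (21 * (infsum (\<sigma> T) UNIV + infsum (\<sigma> T) UNIV + 2 * infsum (\<sigma> T) UNIV) + 288 * infsum (\<sigma> T) UNIV)"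
    unfolding e_def
    by (simp only: infsum_cmult_right' infsum_add summable_on_add summable_on_cmult_right sh S infsum_shift_int[of "\<sigma> T"])
  also have "\<dots> = 372 * K\<^sup>2 * rate * T ^ 3 / \<delta>" unfolding S(4) by (simp add: field_simps)
  finally have ei: "infsum e UNIV = 372 * K\<^sup>2 * rate * T ^ 3 / \<delta>" .
  have "\<sigma> T k = \<sigma> 0 k + T * dlap \<delta> (\<lambda>j. \<sigma> 0 j * mob (\<sigma> 0) j) k + dlap \<delta> err k" for k
    using FTC[OF T(1) order.refl, of k]
    by (simp add: err_def flux_def dlap_def add_divide_distrib diff_divide_distrib algebra_simps)
  then show thesis using e0 es ei esq by (intro that[of err e]) auto
qed

end

lemma action_curve_nonneg:
  assumes "action_curve \<delta> \<rho> w A"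
  shows "0 \<le> (LINT s:{0..1}|lborel. A s)"
proof -
  have "0 \<le> A s" if s: "s \<in> {0..1}" for s
  proof -
    obtain a where "a summable_on UNIV \<and> infsum a UNIV \<le> A s \<and> (\<forall>k. 0 \<le> a k \<and> (w s k)\<^sup>2 \<le> a k * \<rho> s k)"
      using assms[unfolded action_curve_def, THEN conjunct2, THEN conjunct2, THEN conjunct1, rule_format, OF s] by (rule exE)
    then show ?thesis using infsum_nonneg[of UNIV a] by auto
  qed
  then show ?thesis unfolding set_lebesgue_integral_def
    by (intro Bochner_Integration.integral_nonneg) (auto split: split_indicator)
qed

context interaction_flow
begin

text \<open>The quadratic parametrisation \<open>(1 - s)\<^sup>2\<close> keeps the action density bounded although only the
  density \<open>\<sigma> T\<close> controls the error.\<close>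
lemma flow_error_curve:
  assumes T: "0 \<le> T" "2 * rate * T \<le> 1"
  obtains \<rho>' w' A' where "action_curve \<delta> \<rho>' w' A'" "\<rho>' 0 = \<sigma> T"
    "\<rho>' 1 = (\<lambda>k. \<sigma> 0 k + T * dlap \<delta> (\<lambda>j. \<sigma> 0 j * mob (\<sigma> 0) j) k)"
    "\<delta> * (LINT s:{0..1}|lborel. A' s) \<le> 1488 * K\<^sup>2 * rate * T ^ 3"
proof -
  have rT: "0 \<le> rate * T" using T rate_pos by simp
  have T1: "rate * T \<le> 1" using T(2) rT by linarith
  have "2 * rate * T = 4 * T * K / \<delta>\<^sup>2" by (simp add: rate_def)
  then have T4: "4 * T * K \<le> \<delta>\<^sup>2" using T(2) \<delta> by (simp add: divide_le_eq)
  obtain err e where err: "\<And>k. \<sigma> T k = \<sigma> 0 k + T * dlap \<delta> (\<lambda>j. \<sigma> 0 j * mob (\<sigma> 0) j) k + dlap \<delta> err k"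
    and e: "\<And>k. 0 \<le> e k" "e summable_on UNIV" "infsum e UNIV \<le> 372 * K\<^sup>2 * rate * T ^ 3 / \<delta>"
    and sq: "\<And>k. (err k)\<^sup>2 \<le> e k * \<sigma> T k"
    by (rule flow_error[OF T(1) T1]) (rule that)
  define E where "E k = \<sigma> 0 k + T * dlap \<delta> (\<lambda>j. \<sigma> 0 j * mob (\<sigma> 0) j) k" for k
  have EP: "E \<in> Pdelta \<delta>"
    using euler_Pdelta[OF \<sigma>P[OF order.refl] T(1) T4, of 1] by (simp add: E_def[abs_def])
  note SP = \<sigma>P[OF T(1)]
  define \<rho>' where "\<rho>' s k = (1 - (1 - s)\<^sup>2) * E k + (1 - s)\<^sup>2 * \<sigma> T k" for s k
  define w' where "w' s k = - (2 * (1 - s)) * err k" for s k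
  \<comment> \<open>The 4 is the square of the factor 2 in the derivative of the weight; it turns
    372 into 1488.\<close>
  define A' where "A' s = 4 * infsum e UNIV" for s :: real
  have "action_curve \<delta> \<rho>' w' A'"
    unfolding action_curve_def
  proof (intro conjI ballI allI)
    fix s :: real assume s: "s \<in> {0..1}"
    have u: "0 \<le> (1 - s)\<^sup>2" "(1 - s)\<^sup>2 \<le> 1" using s by (auto intro: power_le_one)
    show "\<rho>' s \<in> Pdelta \<delta>"
      unfolding \<rho>'_def by (rule Pdelta_convex[OF EP SP \<delta> u])
    have "(w' s k)\<^sup>2 \<le> 4 * e k * \<rho>' s k" for k
    proof -
      have "(w' s k)\<^sup>2 = (4 * (1 - s)\<^sup>2) * (err k)\<^sup>2"
        by (simp only: w'_def power_mult_distrib power2_minus) simp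
      also have "\<dots> \<le> (4 * (1 - s)\<^sup>2) * (e k * \<sigma> T k)" using sq[of k] by (intro mult_left_mono) auto
      also have "\<dots> = 4 * e k * ((1 - s)\<^sup>2 * \<sigma> T k)" by simp
      also have "\<dots> \<le> 4 * e k * \<rho>' s k"
        using e(1)[of k] u PdeltaD(1)[OF EP \<delta>, of k] by (intro mult_left_mono) (auto simp: \<rho>'_def)
      finally show ?thesis .
    qed
    then show "\<exists>a. a summable_on UNIV \<and> infsum a UNIV \<le> A' s \<and> (\<forall>k. 0 \<le> a k \<and> (w' s k)\<^sup>2 \<le> a k * \<rho>' s k)"
      using e by (intro exI[of _ "\<lambda>k. 4 * e k"]) (auto simp: A'_def infsum_cmult_right' intro!: summable_on_cmult_right)
  next
    fix k show "(\<lambda>s. indicator {0..1} s * w' s k) \<in> borel_measurable lborel" unfolding w'_def by measurable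
  next
    show "set_integrable lborel {0..1} A'" unfolding A'_def set_integrable_def by simp
  next
    fix k and t :: real assume t: "t \<in> {0..1}"
    have "(LBINT s. (- 2 * (1 - s)) * indicator {0..t} s) = (1 - t)\<^sup>2 - (1 - 0)\<^sup>2"
    proof (rule integral_FTC_Icc_real)
      show "((\<lambda>s. (1 - s)\<^sup>2) has_real_derivative - 2 * (1 - s)) (at s)" for s :: real
        by (auto intro!: derivative_eq_intros)
    qed (use t in \<open>auto intro!: continuous_intros\<close>)
    then have I: "(LINT s:{0..t}|lborel. - 2 * (1 - s)) = (1 - t)\<^sup>2 - 1"
      unfolding set_lebesgue_integral_def real_scaleR_def by (simp only: mult.commute[of "indicator _ _"]) simp
    have "(LINT s:{0..t}|lborel. dlap \<delta> (w' s) k) = (LINT s:{0..t}|lborel. (- 2 * (1 - s)) * dlap \<delta> err k)"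
      by (intro set_lebesgue_integral_cong) (auto simp: w'_def dlap_def algebra_simps add_divide_distrib diff_divide_distrib)
    also have "\<dots> = ((1 - t)\<^sup>2 - 1) * dlap \<delta> err k" unfolding set_integral_mult_left I ..
    finally have "(LINT s:{0..t}|lborel. dlap \<delta> (w' s) k) = ((1 - t)\<^sup>2 - 1) * dlap \<delta> err k" .
    moreover have "\<sigma> T k = E k + dlap \<delta> err k" using err[of k] by (simp add: E_def)
    ultimately show "\<rho>' t k = \<rho>' 0 k + (LINT s:{0..t}|lborel. dlap \<delta> (w' s) k)"
      by (simp add: \<rho>'_def algebra_simps)
  qed
  moreover have "\<rho>' 0 = \<sigma> T" "\<rho>' 1 = (\<lambda>k. \<sigma> 0 k + T * dlap \<delta> (\<lambda>j. \<sigma> 0 j * mob (\<sigma> 0) j) k)"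
    by (auto simp: \<rho>'_def E_def)
  moreover have "\<delta> * (LINT s:{0..1}|lborel. A' s) \<le> 1488 * K\<^sup>2 * rate * T ^ 3"
    using e(3) \<delta> by (simp add: A'_def set_lebesgue_integral_def field_simps)
  ultimately show thesis by (rule that)
qed

section \<open>Expansion of the squared distance and the difference quotient\<close>

text \<open>The near minimiser exceeds the infimum by at most \<open>t\<^sup>2\<close>, negligible
  against \<open>t\<close>. The gap curve from the flow to the Euler point gets the time
  \<open>h = t * sqrt t\<close>, so its cost \<open>t ^ 3 / h\<close> is again \<open>h\<close> up
  to a constant; the pushed curve gets \<open>1 - h\<close>.\<close>

lemma Dsq_step:
  assumes D: "Dsq \<delta> (\<sigma> 0) \<eta> = ennreal D" "0 \<le> D"
    and t: "0 < t" "t < 1 / 2" "2 * rate * t \<le> 1"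
  shows "\<exists>c. Dsq \<delta> (\<sigma> t) \<eta> \<le> ennreal c \<and> 0 \<le> c \<and> c \<le> 1488 * K\<^sup>2 * rate * (t * sqrt t)
    + ((1 + t * (2 * C\<^sub>1 + C\<^sub>2)) * (D + t\<^sup>2) + 2 * t * (energy \<delta> W \<eta> - energy \<delta> W (\<sigma> 0))
       + t\<^sup>2 * (4 * K\<^sup>2 + 4 * C\<^sub>1\<^sup>2 * (D + t\<^sup>2))) / (1 - t * sqrt t)"
proof -
  have "Dsq \<delta> (\<sigma> 0) \<eta> < ennreal (D + t\<^sup>2)"
    unfolding D(1) using D(2) t by (simp add: ennreal_less_iff)
  then obtain \<rho> w :: "real \<Rightarrow> int \<Rightarrow> real" where
    c: "\<And>s. \<rho> s \<in> Pdelta \<delta>" and c0: "\<rho> 0 = \<sigma> 0" and c1: "\<rho> 1 = \<eta>"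
    and c2: "\<And>s k. s \<notin> {0..1} \<Longrightarrow> w s k = 0" and c3: "\<And>k. (\<lambda>s. w s k) \<in> borel_measurable lborel"
    and c4: "\<And>s k. \<rho> s k = 0 \<Longrightarrow> w s k = 0"
    and c5: "\<And>s. (\<lambda>k. (w s k)\<^sup>2 / \<rho> s k) summable_on UNIV"
    and c6: "integrable lborel (\<lambda>s. \<Sum>\<^sub>\<infinity>k. (w s k)\<^sup>2 / \<rho> s k)"
    and c7: "\<delta> * (LINT s|lborel. (\<Sum>\<^sub>\<infinity>k. (w s k)\<^sup>2 / \<rho> s k)) \<le> D + t\<^sup>2"
    and c8: "\<And>t k. \<rho> t k = \<sigma> 0 k + (LINT s:{0..t}|lborel. dlap \<delta> (w s) k)"
    by (rule Dsq_less_obtains_curve[OF _ \<delta>]) (rule that)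
  interpret C: interaction_curve \<delta> W K C\<^sub>1 C\<^sub>2 \<rho> w
    by unfold_locales (rule c, erule c2, rule c3, erule c4, rule c5, rule c6, unfold c0, rule c8)
  define B where "B = \<delta> * (LINT s|lborel. C.act s)"
  have B: "B \<le> D + t\<^sup>2" using c7 by (simp add: B_def C.act_def)
  have "2 * rate * t = 4 * t * K / \<delta>\<^sup>2" by (simp add: rate_def)
  then have T4: "4 * t * K \<le> \<delta>\<^sup>2" using t(3) \<delta> by (simp add: divide_le_eq)
  define X where "X b = (1 + t * (2 * C\<^sub>1 + C\<^sub>2)) * b + 2 * t * (energy \<delta> W \<eta> - energy \<delta> W (\<sigma> 0)) + t\<^sup>2 * (4 * K\<^sup>2 + 4 * C\<^sub>1\<^sup>2 * b)" for b
  obtain \<rho>2 w2 A2 where 2: "action_curve \<delta> \<rho>2 w2 A2"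
    "\<rho>2 0 = (\<lambda>k. \<sigma> 0 k + t * dlap \<delta> (\<lambda>j. \<sigma> 0 j * mob (\<sigma> 0) j) k)" "\<rho>2 1 = \<eta>"
    "\<delta> * (LINT s:{0..1}|lborel. A2 s) = X B"
    by (rule C.euler_curve[OF less_imp_le[OF t(1)] T4, unfolded c0 c1 B_def[symmetric]])
      (rule that, assumption+, simp only: X_def)
  obtain \<rho>1 w1 A1 where 1: "action_curve \<delta> \<rho>1 w1 A1" "\<rho>1 0 = \<sigma> t"
    "\<rho>1 1 = (\<lambda>k. \<sigma> 0 k + t * dlap \<delta> (\<lambda>j. \<sigma> 0 j * mob (\<sigma> 0) j) k)"
    "\<delta> * (LINT s:{0..1}|lborel. A1 s) \<le> 1488 * K\<^sup>2 * rate * t ^ 3"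
    by (rule flow_error_curve[OF less_imp_le[OF t(1)] t(3)]) (rule that)
  define h where "h = t * sqrt t"
  have h: "0 < h" "h < 1"
  proof -
    show "0 < h" using t by (simp add: h_def)
    have "t * sqrt t < 1 * 1" using t by (intro mult_strict_mono) (auto simp: real_sqrt_less_iff)
    then show "h < 1" by (simp add: h_def)
  qed
  define c where "c = (\<delta> * (LINT s:{0..1}|lborel. A1 s)) / h + X B / (1 - h)"
  have "\<delta> * ((LINT s:{0..1}|lborel. A1 s) / h + (LINT s:{0..1}|lborel. A2 s) / (1 - h)) = c"
    unfolding c_def 2(4)[symmetric] by (simp add: distrib_left)
  then have "Dsq \<delta> (\<rho>1 0) (\<rho>2 1) \<le> ennreal c"
    using Dsq_concat[OF 1(1) 2(1) \<delta> _ h] by (simp add: 1(3) 2(2))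
  then have "Dsq \<delta> (\<sigma> t) \<eta> \<le> ennreal c" unfolding 1(2) 2(3) .
  moreover have "0 \<le> c"
    unfolding c_def 2(4)[symmetric] using action_curve_nonneg[OF 1(1)] action_curve_nonneg[OF 2(1)] h \<delta> by simp
  moreover have "c \<le> 1488 * K\<^sup>2 * rate * (t * sqrt t) + X (D + t\<^sup>2) / (1 - h)"
    unfolding c_def
  proof (intro add_mono)
    have "(\<delta> * (LINT s:{0..1}|lborel. A1 s)) / h \<le> (1488 * K\<^sup>2 * rate * t ^ 3) / h"
      using 1(4) h by (intro divide_right_mono) auto
    also have "t ^ 3 = (t * sqrt t) * h" using t by (simp add: h_def power3_eq_cube)
    finally show "(\<delta> * (LINT s:{0..1}|lborel. A1 s)) / h \<le> 1488 * K\<^sup>2 * rate * (t * sqrt t)"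
      using h by simp
    have "X B \<le> X (D + t\<^sup>2)"
      unfolding X_def using B t C\<^sub>1_nonneg C\<^sub>2_nonneg by (intro add_mono mult_left_mono) auto
    then show "X B / (1 - h) \<le> X (D + t\<^sup>2) / (1 - h)" using h by (intro divide_right_mono) auto
  qed
  ultimately show ?thesis unfolding X_def h_def by blast
qed

text \<open>All terms beyond first order are absorbed into \<open>t * sqrt t\<close> with a constant
  independent of \<open>t\<close>, by \<open>t\<^sup>2 \<le> h\<close> and
  \<open>h \<le> 1 / 2\<close> for \<open>h = t * sqrt t\<close>.\<close>

lemma Dsq_expansion:
  assumes D: "Dsq \<delta> (\<sigma> 0) \<eta> = ennreal D" "0 \<le> D"
  obtains M where "M \<ge> 0" "\<And>t. 0 < t \<Longrightarrow> t < 1 / 2 \<Longrightarrow> 2 * rate * t \<le> 1 \<Longrightarrow>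
     enn2real (Dsq \<delta> (\<sigma> t) \<eta>) \<le> D + t * ((2 * C\<^sub>1 + C\<^sub>2) * D + 2 * (energy \<delta> W \<eta> - energy \<delta> W (\<sigma> 0))) + (t * sqrt t) * M"
     "\<And>t. 0 < t \<Longrightarrow> t < 1 / 2 \<Longrightarrow> 2 * rate * t \<le> 1 \<Longrightarrow> Dsq \<delta> (\<sigma> t) \<eta> < \<infinity>"
proof -
  define L where "L = 2 * C\<^sub>1 + C\<^sub>2"
  have L: "L \<ge> 0" using C\<^sub>1_nonneg C\<^sub>2_nonneg by (simp add: L_def)
  define F where "F = energy \<delta> W \<eta> - energy \<delta> W (\<sigma> 0)"
  define N where "N = 4 * K\<^sup>2 + 4 * C\<^sub>1\<^sup>2 * (D + 1)"
  define Y where "Y = (1 + L) * (D + 1) + 2 * \<bar>F\<bar> + N"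
  have N: "N \<ge> 0" using D(2) by (simp add: N_def)
  have Y: "Y \<ge> 0" using D(2) L N by (simp add: Y_def)
  define M where "M = 1488 * K\<^sup>2 * rate + (1 + L) + N + 4 * Y"
  have M: "M \<ge> 0" using L N Y rate_pos by (simp add: M_def)
  show thesis
  proof (rule that[OF M])
    fix t :: real assume t: "0 < t" "t < 1 / 2" "2 * rate * t \<le> 1"
    define h where "h = t * sqrt t"
    have st: "sqrt t \<le> sqrt (1 / 2)" using t by simp
    have "sqrt (1 / 2) \<le> 1" by simp
    then have s1: "sqrt t \<le> 1" using st by linarith
    have h: "0 < h" "h \<le> 1 / 2" "h \<le> t"
    proof -
      show "0 < h" using t by (simp add: h_def)
      show "h \<le> t" unfolding h_def using t s1 mult_left_le[of "sqrt t" t] by simp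
      then show "h \<le> 1 / 2" using t by simp
    qed
    have t2h: "t\<^sup>2 \<le> h"
    proof -
      have "t * t = h * sqrt t" using t by (simp add: h_def)
      also have "\<dots> \<le> h" using h s1 mult_left_le[of "sqrt t" h] by simp
      finally show ?thesis by (simp add: power2_eq_square)
    qed
    have t21: "t\<^sup>2 \<le> 1" using t2h h by linarith
    define X where "X = (1 + t * L) * (D + t\<^sup>2) + 2 * t * F + t\<^sup>2 * (4 * K\<^sup>2 + 4 * C\<^sub>1\<^sup>2 * (D + t\<^sup>2))"
    have last: "t\<^sup>2 * (4 * K\<^sup>2 + 4 * C\<^sub>1\<^sup>2 * (D + t\<^sup>2)) \<le> t\<^sup>2 * N"
      unfolding N_def using t21 by (intro mult_left_mono add_mono) auto
    have tL: "t * L \<le> L" using L t mult_right_mono[of t 1 L] by simp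
    have "(1 + t * L) * t\<^sup>2 \<le> (1 + L) * h" using tL t2h L t by (intro mult_mono) auto
    moreover have "t\<^sup>2 * N \<le> h * N" using t2h N by (intro mult_right_mono) auto
    ultimately have X1: "X \<le> D + t * (L * D + 2 * F) + h * ((1 + L) + N)"
      unfolding X_def using last by (simp add: algebra_simps)
    have "(1 + t * L) * (D + t\<^sup>2) \<le> (1 + L) * (D + 1)" using tL t21 L D(2) t by (intro mult_mono) auto
    moreover have "2 * t * F \<le> 2 * \<bar>F\<bar>"
    proof -
      have "2 * t * F \<le> 2 * t * \<bar>F\<bar>" using t by (intro mult_left_mono) auto
      also have "\<dots> \<le> 2 * \<bar>F\<bar>" using t mult_right_mono[of "2 * t" 2 "\<bar>F\<bar>"] by simp
      finally show ?thesis .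
    qed
    moreover have "t\<^sup>2 * N \<le> N" using t21 N mult_right_mono[of "t\<^sup>2" 1 N] by simp
    ultimately have X2: "X \<le> Y" unfolding X_def Y_def using last by linarith
    \<comment> \<open>The energy difference has no sign, so \<open>X\<close> is bounded through the
      nonnegative \<open>Y\<close> before the denominator is replaced by
      \<open>1 / 2\<close>.\<close>
    have "X / (1 - h) \<le> X + 4 * h * Y"
    proof -
      have "X / (1 - h) = X + h * X / (1 - h)" using h by (simp add: field_simps)
      also have "h * X / (1 - h) \<le> h * Y / (1 - h)" using h X2 by (intro divide_right_mono mult_left_mono) auto
      also have "\<dots> \<le> h * Y / (1 / 2)" using h Y by (intro divide_left_mono) auto
      also have "\<dots> \<le> 4 * h * Y" using h Y by simp
      finally show ?thesis by simp
    qed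
    then have "1488 * K\<^sup>2 * rate * h + X / (1 - h) \<le> D + t * (L * D + 2 * F) + h * M"
      using X1 by (simp add: M_def algebra_simps)
    moreover obtain c where c: "Dsq \<delta> (\<sigma> t) \<eta> \<le> ennreal c" "0 \<le> c" "c \<le> 1488 * K\<^sup>2 * rate * h + X / (1 - h)"
      using Dsq_step[OF D t] unfolding X_def L_def F_def h_def by blast
    moreover have "enn2real (Dsq \<delta> (\<sigma> t) \<eta>) \<le> c" using c(1,2) by (simp add: enn2real_leI)
    ultimately show "enn2real (Dsq \<delta> (\<sigma> t) \<eta>) \<le> D + t * ((2 * C\<^sub>1 + C\<^sub>2) * D + 2 * (energy \<delta> W \<eta> - energy \<delta> W (\<sigma> 0))) + (t * sqrt t) * M"
      unfolding L_def F_def h_def by linarith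
    show "Dsq \<delta> (\<sigma> t) \<eta> < \<infinity>" using c(1) by (simp add: le_less_trans[OF _ ennreal_less_top])
  qed
qed

text \<open>Finiteness of the distance at small times makes the extended quotient a real one; it
  exceeds the claimed bound by at most \<open>sqrt t * (M / 2)\<close>.\<close>

lemma Limsup_Dsq:
  assumes fin: "Dsq \<delta> (\<sigma> 0) \<eta> < \<infinity>"
  shows "Limsup (at_right 0) (\<lambda>t. (enn2ereal (Dsq \<delta> (\<sigma> t) \<eta>) - enn2ereal (Dsq \<delta> (\<sigma> 0) \<eta>)) / ereal (2 * t))
    \<le> ereal ((2 * C\<^sub>1 + C\<^sub>2) / 2 * enn2real (Dsq \<delta> (\<sigma> 0) \<eta>) + (energy \<delta> W \<eta> - energy \<delta> W (\<sigma> 0)))"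
proof -
  define D where "D = enn2real (Dsq \<delta> (\<sigma> 0) \<eta>)"
  have D: "Dsq \<delta> (\<sigma> 0) \<eta> = ennreal D" "0 \<le> D" using fin by (auto simp: D_def)
  define R where "R = (2 * C\<^sub>1 + C\<^sub>2) / 2 * D + (energy \<delta> W \<eta> - energy \<delta> W (\<sigma> 0))"
  obtain M where M: "M \<ge> 0" "\<And>t. 0 < t \<Longrightarrow> t < 1 / 2 \<Longrightarrow> 2 * rate * t \<le> 1 \<Longrightarrow>
     enn2real (Dsq \<delta> (\<sigma> t) \<eta>) \<le> D + t * ((2 * C\<^sub>1 + C\<^sub>2) * D + 2 * (energy \<delta> W \<eta> - energy \<delta> W (\<sigma> 0))) + (t * sqrt t) * M"
     "\<And>t. 0 < t \<Longrightarrow> t < 1 / 2 \<Longrightarrow> 2 * rate * t \<le> 1 \<Longrightarrow> Dsq \<delta> (\<sigma> t) \<eta> < \<infinity>"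
    by (rule Dsq_expansion[OF D]) (rule that)
  have ev: "eventually (\<lambda>t. (enn2ereal (Dsq \<delta> (\<sigma> t) \<eta>) - enn2ereal (Dsq \<delta> (\<sigma> 0) \<eta>)) / ereal (2 * t)
     \<le> ereal (R + sqrt t * (M / 2))) (at_right 0)"
  proof -
    have "eventually (\<lambda>t :: real. t \<in> {0<..<min (1 / 2) (1 / (2 * rate))}) (at_right 0)"
      using rate_pos by (intro eventually_at_right_real) auto
    then show ?thesis
    proof eventually_elim
      case (elim t)
      then have t: "0 < t" "t < 1 / 2" "2 * rate * t \<le> 1" using rate_pos by (auto simp: field_simps)
      define Dt where "Dt = enn2real (Dsq \<delta> (\<sigma> t) \<eta>)"
      have Dt: "enn2ereal (Dsq \<delta> (\<sigma> t) \<eta>) = ereal Dt" using M(3)[OF t] by (simp add: Dt_def enn2ereal_ennreal[symmetric])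
      have D0: "enn2ereal (Dsq \<delta> (\<sigma> 0) \<eta>) = ereal D" using D by simp
      have "Dt - D \<le> (R + sqrt t * (M / 2)) * (2 * t)"
        using M(2)[OF t] by (simp add: Dt_def R_def field_simps)
      then have "(Dt - D) / (2 * t) \<le> R + sqrt t * (M / 2)" using t by (simp add: pos_divide_le_eq)
      then show ?case unfolding Dt D0 using t by simp
    qed
  qed
  have "((\<lambda>t. ereal (R + sqrt t * (M / 2))) \<longlongrightarrow> ereal (R + sqrt 0 * (M / 2))) (at_right 0)"
    by (intro tendsto_intros) 
  then have "Limsup (at_right 0) (\<lambda>t. ereal (R + sqrt t * (M / 2))) = ereal R"
    by (simp add: lim_imp_Limsup)
  then show ?thesis using Limsup_mono[OF ev] by (simp add: R_def D_def)
qed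

end

theorem theorem1p3:
  fixes \<delta> :: real and W :: "int \<Rightarrow> real" and S :: "real \<Rightarrow> (int \<Rightarrow> real) \<Rightarrow> (int \<Rightarrow> real)"
  assumes "\<delta> > 0"
    and "\<And>k. W (- k) = W k"
    and "\<And>k. dlap \<delta> W k > 0"
    and "bdd_above (range (dlap \<delta> W))"
    and "bdd_above (range (\<lambda>k. \<bar>dlap \<delta> (dlap \<delta> W) k\<bar>))"
    and "bdd_above (range (\<lambda>k. dlap \<delta> (\<lambda>j. (dlap \<delta> W j)\<^sup>2) k / dlap \<delta> W k))"
    and "generated_semigroup \<delta> W S"
  shows "contractive \<delta>
           (- (2 * (SUP k. \<bar>dlap \<delta> (dlap \<delta> W) k\<bar>)
               + (SUP k. dlap \<delta> (\<lambda>j. (dlap \<delta> W j)\<^sup>2) k / dlap \<delta> W k)))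
           (energy \<delta> W) S"
proof -
  define C1 where "C1 = (SUP k. \<bar>dlap \<delta> (dlap \<delta> W) k\<bar>)"
  define C2 where "C2 = (SUP k. dlap \<delta> (\<lambda>j. (dlap \<delta> W j)\<^sup>2) k / dlap \<delta> W k)"
  define K where "K = (SUP k. dlap \<delta> W k)"
  interpret interaction \<delta> W K C1 C2
  proof
    show "dlap \<delta> W k \<le> K" for k unfolding K_def by (rule cSUP_upper[OF _ assms(4)]) simp
    show "\<bar>dlap \<delta> (dlap \<delta> W) k\<bar> \<le> C1" for k unfolding C1_def by (rule cSUP_upper[OF _ assms(5)]) simp
    have q: "dlap \<delta> (\<lambda>j. (dlap \<delta> W j)\<^sup>2) k / dlap \<delta> W k \<le> C2" for k unfolding C2_def by (rule cSUP_upper[OF _ assms(6)]) simp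
    show "dlap \<delta> (\<lambda>j. (dlap \<delta> W j)\<^sup>2) k \<le> C2 * dlap \<delta> W k" for k
      using q[of k] assms(3)[of k] by (simp add: pos_divide_le_eq)
  qed (use assms in auto)
  show ?thesis
    unfolding contractive_def C1_def[symmetric] C2_def[symmetric]
  proof (intro ballI impI)
    fix \<rho> \<eta> assume \<rho>: "\<rho> \<in> Pdelta \<delta>" and "\<eta> \<in> Pdelta \<delta>" and fin: "Dsq \<delta> \<rho> \<eta> < \<infinity>"
    have S: "S 0 \<rho> = \<rho>" "\<And>t. 0 \<le> t \<Longrightarrow> S t \<rho> \<in> Pdelta \<delta>"
      "\<And>t k. 0 \<le> t \<Longrightarrow> ((\<lambda>\<tau>. S \<tau> \<rho> k) has_real_derivative
            dlap \<delta> (\<lambda>j. S t \<rho> j * dlap \<delta> (dconv \<delta> W (S t \<rho>)) j) k) (at t within {0..})"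
      using assms(7) \<rho> unfolding generated_semigroup_def by blast+
    interpret interaction_flow \<delta> W K C1 C2 "\<lambda>t. S t \<rho>"
    proof
      \<comment> \<open>Membership in \<open>Pdelta\<close> makes the convolution with
        \<open>W\<close> converge absolutely, so its Laplacian may be computed under the sum as
        \<open>mob\<close>.\<close>
      show "((\<lambda>\<tau>. S \<tau> \<rho> k) has_real_derivative dlap \<delta> (\<lambda>j. S t \<rho> j * mob (S t \<rho>) j) k) (at t within {0..})"
        if "0 \<le> t" for t k using S(3)[OF that, of k] dlap_dconv_W[OF S(2)[OF that]] by simp
    qed (rule S(2))
    define D where "D = enn2real (Dsq \<delta> \<rho> \<eta>)"
    have *: "Limsup (at_right 0) (\<lambda>t. (enn2ereal (Dsq \<delta> (S t \<rho>) \<eta>) - enn2ereal (Dsq \<delta> \<rho> \<eta>)) / ereal (2 * t))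
       \<le> ereal ((2 * C1 + C2) / 2 * D + (energy \<delta> W \<eta> - energy \<delta> W \<rho>))"
      using Limsup_Dsq[of \<eta>] fin by (simp add: S(1) D_def)
    have eq: "(2 * C1 + C2) / 2 * D + (energy \<delta> W \<eta> - energy \<delta> W \<rho>) + - (2 * C1 + C2) / 2 * D = energy \<delta> W \<eta> - energy \<delta> W \<rho>"
      by (simp add: field_simps)
    from add_right_mono[OF *, of "ereal (- (2 * C1 + C2) / 2 * D)"]
    show "Limsup (at_right 0) (\<lambda>t. (enn2ereal (Dsq \<delta> (S t \<rho>) \<eta>) - enn2ereal (Dsq \<delta> \<rho> \<eta>)) / ereal (2 * t))
         + ereal (- (2 * C1 + C2) / 2 * enn2real (Dsq \<delta> \<rho> \<eta>)) \<le> ereal (energy \<delta> W \<eta> - energy \<delta> W \<rho>)"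
      unfolding D_def[symmetric] plus_ereal.simps eq .
  qed
qed

end
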